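(* Let $\mathbf{M}=(\mathbf{M}_K)_{K\in\mathcal K}$ be a $\mathcal G$-family of $\mathbb Z[\mathcal G]$-modules, let $p$ be a prime and put $\mathcal M_K:=\mathbf{M}_K\otimes_{\mathbb Z}\mathbb Z_p$. Let $\chi$ be an irreducible rational character of $\mathcal G$ and put $\mathbf{M}^{\rm alg}_\chi:=\{x\in\mathbf{M}_{K_\chi},\ x^{P_\chi(\sigma_\chi)}=1\}$ and $\mathcal M^{\rm alg}_\chi:=\mathbf{M}^{\rm alg}_\chi\otimes_{\mathbb Z}\mathbb Z_p$. Then $$\mathbf{M}^{\rm alg}_\chi=\{x\in\mathbf{M}_{K_\chi},\ \nu_{K_\chi/k}(x)=1\ \text{for all subfields } k\subsetneq K_\chi\},$$ $$\mathcal M^{\rm alg}_\chi=\{x\in\mathcal M_{K_\chi},\ \nu_{K_\chi/k}(x)=1\ \text{for all subfields } k\subsetneq K_\chi\}.$$ Moreover, one may limit the norm conditions to $\nu_{K_\chi/k_\ell}(x)=1$ for all prime divisors $\ell$ of $[K_\chi:\mathbb Q]$, where $k_\ell\subset K_\chi$ is the subfield such that $[K_\chi:k_\ell]=\ell$.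
   Context: $\mathbb Q^{\rm ab}$ is the maximal abelian extension of $\mathbb Q$ and $\mathcal G:=\mathrm{Gal}(\mathbb Q^{\rm ab}/\mathbb Q)$; $\mathcal K$ is the set of finite extensions of $\mathbb Q$ contained in $\mathbb Q^{\rm ab}$. A $\mathcal G$-family of $\mathbb Z[\mathcal G]$-modules is a family $(\mathbf M_K)_{K\in\mathcal K}$ of (multiplicatively written) $\mathbb Z[\mathcal G]$-modules such that $\mathrm{Gal}(\mathbb Q^{\rm ab}/K)$ acts trivially on $\mathbf M_K$ for every $K$, so that $\mathbf M_K$ is a $\mathbb Z[\mathrm{Gal}(K/\mathbb Q)]$-module. For $k\subseteq K$ in $\mathcal K$, the algebraic norm is $\nu_{K/k}:=\sum_{\sigma\in\mathrm{Gal}(K/k)}\sigma\in\mathbb Z[\mathrm{Gal}(K/k)]$, acting on $\mathbf M_K$. An irreducible rational character $\chi$ of $\mathcal G$ is the sum of the $\mathrm{Gal}(\overline{\mathbb Q}/\mathbb Q)$-conjugates of a degree one character $\psi$ of finite order of $\mathcal G$ (one writes $\psi\mid\chi$); $g_\chi$ is the order of any $\psi\mid\chi$, $K_\chi$ is the subfield of $\mathbb Q^{\rm ab}$ fixed by $\mathrm{Ker}(\psi)$, and $G_\chi:=\mathrm{Gal}(K_\chi/\mathbb Q)$, cyclic of order $g_\chi$, has a chosen generator $\sigma_\chi$. $P_\chi\in\mathbb Z[X]$ is the $g_\chi$-th cyclotomic polynomial. *)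

theory Defs
  imports
    "HOL-Algebra.Algebraic_Closure_Type"
    "HOL-Algebra.Free_Abelian_Groups"
    "HOL-Algebra.Multiplicative_Group"
    "HOL-Algebra.Bij"
    "HOL-Algebra.Module"
    "HOL-Analysis.Abstract_Topology"
begin

section \<open>Number fields inside the complex numbers\<close>

text \<open>All fields are subfields of the complex field, and \<open>\<rat>\<close> is the prime field.\<close>

abbreviation CC :: "complex ring"
  where "CC \<equiv> ring_of_type_algebra"

definition Qbar :: "complex set"
  where "Qbar = {z. algebraic z}"

text \<open>Automorphisms of \<open>L\<close> are extensional functions, so that equality of functions is
  equality of automorphisms of \<open>L\<close>.\<close>

definition Gal :: "complex set \<Rightarrow> complex set \<Rightarrow> (complex \<Rightarrow> complex) monoid"
  where "Gal L k = (BijGroup L)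
    \<lparr>carrier := {\<sigma> \<in> Bij L. \<sigma> \<in> ring_hom (CC\<lparr>carrier := L\<rparr>) (CC\<lparr>carrier := L\<rparr>) \<and> (\<forall>x\<in>k. \<sigma> x = x)}\<rparr>"

definition fixed_field :: "complex set \<Rightarrow> (complex \<Rightarrow> complex) set \<Rightarrow> complex set"
  where "fixed_field L H = {x \<in> L. \<forall>\<sigma>\<in>H. \<sigma> x = x}"

definition number_field :: "complex set \<Rightarrow> bool"
  where "number_field K \<longleftrightarrow> subfield K CC \<and> ring.finite_dimension CC \<rat> K"

definition field_degree :: "complex set \<Rightarrow> complex set \<Rightarrow> nat"
  where "field_degree K k = ring.dim CC k K"

definition finite_abelian_ext :: "complex set \<Rightarrow> bool"
  where "finite_abelian_ext F \<longleftrightarrow> number_field F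
    \<and> fixed_field F (carrier (Gal F \<rat>)) = \<rat> \<and> comm_group (Gal F \<rat>)"

text \<open>The maximal abelian extension of \<open>\<rat>\<close>, as the union (equivalently, since finite abelian
  extensions are stable under compositum, the compositum) of all finite abelian extensions.\<close>

definition Qab :: "complex set"
  where "Qab = \<Union>{F. finite_abelian_ext F}"

definition GG :: "(complex \<Rightarrow> complex) monoid"
  where "GG = Gal Qab \<rat>"

definition KK :: "complex set set"
  where "KK = {K. number_field K \<and> K \<subseteq> Qab}"


section \<open>Group rings over the integers and families of modules\<close>

definition group_ring :: "('g, 'r) monoid_scheme \<Rightarrow> ('g \<Rightarrow>\<^sub>0 int) ring"
  where "group_ring G =
    \<lparr>carrier = {c. Poly_Mapping.keys c \<subseteq> carrier G},
     monoid.mult = (\<lambda>c d. frag_extend (\<lambda>a. frag_extend (\<lambda>b. frag_of (a \<otimes>\<^bsub>G\<^esub> b)) d) c),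
     one = frag_of \<one>\<^bsub>G\<^esub>,
     ring.zero = 0,
     add = (+)\<rparr>"

text \<open>The modules are multiplicative in the source; here they are \<open>HOL-Algebra\<close> modules, hence
  additive: \<open>x\<^sup>\<alpha>\<close> is \<open>\<alpha> \<odot> x\<close> and the neutral element \<open>1\<close> is \<open>\<zero>\<close>.
  (The record fields \<open>mult\<close> and \<open>one\<close> of a module are not used.)\<close>

definition GG_family :: "(complex set \<Rightarrow> ((complex \<Rightarrow> complex) \<Rightarrow>\<^sub>0 int, 'm) module) \<Rightarrow> bool"
  where "GG_family M \<longleftrightarrow> (\<forall>K\<in>KK. module (group_ring GG) (M K) \<and>
    (\<forall>\<sigma>\<in>carrier (Gal Qab K). \<forall>x\<in>carrier (M K). frag_of \<sigma> \<odot>\<^bsub>M K\<^esub> x = x))"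

text \<open>\<open>M K\<close> as a module over the group ring of \<open>Gal K \<rat>\<close>: each automorphism of \<open>K\<close> acts through
  some extension of it to \<open>Qab\<close>. For a family as above the choice is irrelevant, two extensions
  differing by an element of \<open>Gal Qab K\<close>.\<close>

definition lift_aut :: "complex set \<Rightarrow> (complex \<Rightarrow> complex) \<Rightarrow> (complex \<Rightarrow> complex)"
  where "lift_aut K \<tau> = (SOME \<sigma>. \<sigma> \<in> carrier GG \<and> restrict \<sigma> K = \<tau>)"

definition descend :: "(complex set \<Rightarrow> ((complex \<Rightarrow> complex) \<Rightarrow>\<^sub>0 int, 'm) module) \<Rightarrow> complex set
    \<Rightarrow> ((complex \<Rightarrow> complex) \<Rightarrow>\<^sub>0 int, 'm) module"
  where "descend M K = (M K)
    \<lparr>smult := \<lambda>\<alpha> x. frag_extend (\<lambda>\<tau>. frag_of (lift_aut K \<tau>)) \<alpha> \<odot>\<^bsub>M K\<^esub> x\<rparr>"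

definition alg_norm :: "complex set \<Rightarrow> complex set \<Rightarrow> ((complex \<Rightarrow> complex) \<Rightarrow>\<^sub>0 int)"
  where "alg_norm K k = (\<Sum>\<sigma>\<in>carrier (Gal K k). frag_of \<sigma>)"

definition poly_at :: "('g, 'r) monoid_scheme \<Rightarrow> int poly \<Rightarrow> 'g \<Rightarrow> ('g \<Rightarrow>\<^sub>0 int)"
  where "poly_at G P g =
    (\<Sum>i\<le>Polynomial.degree P. frag_cmul (Polynomial.coeff P i) (frag_of (g [^]\<^bsub>G\<^esub> i)))"


section \<open>Tensor products of abelian groups and the p-adic integers\<close>

definition tensor_rels :: "('a, 'r) monoid_scheme \<Rightarrow> ('b, 's) monoid_scheme \<Rightarrow> ('a \<times> 'b \<Rightarrow>\<^sub>0 int) set"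
  where "tensor_rels A B = generate (free_Abelian_group (carrier A \<times> carrier B))
    ({frag_of (a \<otimes>\<^bsub>A\<^esub> a', b) - frag_of (a, b) - frag_of (a', b) |a a' b.
        a \<in> carrier A \<and> a' \<in> carrier A \<and> b \<in> carrier B} \<union>
     {frag_of (a, b \<otimes>\<^bsub>B\<^esub> b') - frag_of (a, b) - frag_of (a, b') |a b b'.
        a \<in> carrier A \<and> b \<in> carrier B \<and> b' \<in> carrier B})"

definition tensor :: "('a, 'r) monoid_scheme \<Rightarrow> ('b, 's) monoid_scheme \<Rightarrow> ('a \<times> 'b \<Rightarrow>\<^sub>0 int) set monoid"
  where "tensor A B = free_Abelian_group (carrier A \<times> carrier B) Mod tensor_rels A B"

text \<open>\<open>tensor_map A' B f\<close> is the homomorphism \<open>f \<otimes> id\<close> from \<open>tensor A B\<close> to \<open>tensor A' B\<close> induced by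
  a homomorphism \<open>f\<close> from \<open>A\<close> to \<open>A'\<close>. Elements are cosets \<open>C\<close>; all representatives \<open>c\<close> of \<open>C\<close> give
  the same coset, so that the union is that coset.\<close>

definition tensor_map :: "('a, 'r) monoid_scheme \<Rightarrow> ('b, 's) monoid_scheme \<Rightarrow> ('c \<Rightarrow> 'a)
    \<Rightarrow> ('c \<times> 'b \<Rightarrow>\<^sub>0 int) set \<Rightarrow> ('a \<times> 'b \<Rightarrow>\<^sub>0 int) set"
  where "tensor_map A' B f C = (\<Union>c\<in>C. tensor_rels A' B #>\<^bsub>free_Abelian_group (carrier A' \<times> carrier B)\<^esub>
    frag_extend (\<lambda>(a, b). frag_of (f a, b)) c)"

text \<open>The inverse limit of the rings of integers modulo \<open>p\<^sup>n\<close>, with residues in \<open>{0..<p\<^sup>n}\<close>.\<close>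

definition padic_int :: "nat \<Rightarrow> (nat \<Rightarrow> int) ring"
  where "padic_int p =
    \<lparr>carrier = {x. \<forall>n. x n \<in> {0..<int p ^ n} \<and> x (Suc n) mod int p ^ n = x n},
     monoid.mult = (\<lambda>x y n. (x n * y n) mod int p ^ n),
     one = (\<lambda>n. 1 mod int p ^ n),
     ring.zero = (\<lambda>n. 0),
     add = (\<lambda>x y n. (x n + y n) mod int p ^ n)\<rparr>"

text \<open>\<open>N\<close> tensored over the integers with the \<open>p\<close>-adic integers, with the action of the scalars of
  \<open>N\<close> on the left factor.\<close>

definition tensor_Zp :: "nat \<Rightarrow> ('r, 'm) module \<Rightarrow> ('r, ('m \<times> (nat \<Rightarrow> int) \<Rightarrow>\<^sub>0 int) set) module"
  where "tensor_Zp p N = (let T = tensor (add_monoid N) (add_monoid (padic_int p)) in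
    \<lparr>carrier = carrier T,
     monoid.mult = (\<lambda>_ _. undefined),
     one = undefined,
     ring.zero = \<one>\<^bsub>T\<^esub>,
     add = monoid.mult T,
     module.smult = (\<lambda>\<alpha>. tensor_map (add_monoid N) (add_monoid (padic_int p)) (\<lambda>x. \<alpha> \<odot>\<^bsub>N\<^esub> x))\<rparr>)"


section \<open>Rational characters\<close>

text \<open>The Krull topology: the cosets of the subgroups \<open>Gal Qab F\<close>, \<open>F\<close> finite over \<open>\<rat>\<close>, form a base.\<close>

definition krull_topology :: "(complex \<Rightarrow> complex) topology"
  where "krull_topology =
    topology_generated_by {\<sigma> <#\<^bsub>GG\<^esub> carrier (Gal Qab F) |\<sigma> F. \<sigma> \<in> carrier GG \<and> F \<in> KK}"

text \<open>Degree one characters of finite order, continuous as always for a Galois group.\<close>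

definition finite_order_char :: "((complex \<Rightarrow> complex) \<Rightarrow> complex) \<Rightarrow> bool"
  where "finite_order_char \<psi> \<longleftrightarrow>
    \<psi> \<in> hom GG (mult_of CC) \<and> \<psi> \<in> extensional (carrier GG) \<and>
    continuous_map krull_topology euclidean \<psi> \<and>
    (\<exists>n>0. \<forall>s\<in>carrier GG. \<psi> s ^ n = 1)"

definition char_order :: "((complex \<Rightarrow> complex) \<Rightarrow> complex) \<Rightarrow> nat"
  where "char_order \<psi> = (LEAST n. n > 0 \<and> (\<forall>s\<in>carrier GG. \<psi> s ^ n = 1))"

definition char_conjugates :: "((complex \<Rightarrow> complex) \<Rightarrow> complex) \<Rightarrow> ((complex \<Rightarrow> complex) \<Rightarrow> complex) set"
  where "char_conjugates \<psi> = {compose (carrier GG) \<tau> \<psi> |\<tau>. \<tau> \<in> carrier (Gal Qbar \<rat>)}"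

text \<open>\<open>constituent \<psi> \<chi>\<close> is the relation written \<open>\<psi> | \<chi>\<close>; each conjugate occurs once in the sum.\<close>

definition constituent ::
    "((complex \<Rightarrow> complex) \<Rightarrow> complex) \<Rightarrow> ((complex \<Rightarrow> complex) \<Rightarrow> complex) \<Rightarrow> bool"
  where "constituent \<psi> \<chi> \<longleftrightarrow> finite_order_char \<psi> \<and>
    \<chi> = (\<lambda>s\<in>carrier GG. \<Sum>\<phi>\<in>char_conjugates \<psi>. \<phi> s)"

definition irreducible_rational_char :: "((complex \<Rightarrow> complex) \<Rightarrow> complex) \<Rightarrow> bool"
  where "irreducible_rational_char \<chi> \<longleftrightarrow> (\<exists>\<psi>. constituent \<psi> \<chi>)"

text \<open>The field and the order attached to \<open>\<chi>\<close> are computed from a constituent \<open>\<psi>\<close> of \<open>\<chi>\<close>.\<close>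

definition char_field :: "((complex \<Rightarrow> complex) \<Rightarrow> complex) \<Rightarrow> complex set"
  where "char_field \<psi> = fixed_field Qab (kernel GG (mult_of CC) \<psi>)"

definition cyclotomic :: "nat \<Rightarrow> int poly"
  where "cyclotomic n = (THE P. map_poly of_int P =
    (\<Prod>\<zeta>\<in>{\<zeta>::complex. \<zeta> ^ n = 1 \<and> (\<forall>m. 0 < m \<and> m < n \<longrightarrow> \<zeta> ^ m \<noteq> 1)}. [:- \<zeta>, 1:]))"


section \<open>The two descriptions of the chi-part\<close>

definition M_alg :: "(complex set \<Rightarrow> ((complex \<Rightarrow> complex) \<Rightarrow>\<^sub>0 int, 'm) module)
    \<Rightarrow> ((complex \<Rightarrow> complex) \<Rightarrow> complex) \<Rightarrow> (complex \<Rightarrow> complex) \<Rightarrow> 'm set"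
  where "M_alg M \<psi> \<sigma> = (let K = char_field \<psi>; N = descend M K in
    {x \<in> carrier N. poly_at (Gal K \<rat>) (cyclotomic (char_order \<psi>)) \<sigma> \<odot>\<^bsub>N\<^esub> x = \<zero>\<^bsub>N\<^esub>})"

definition norm_kernel :: "((complex \<Rightarrow> complex) \<Rightarrow>\<^sub>0 int, 'n) module \<Rightarrow> complex set
    \<Rightarrow> complex set set \<Rightarrow> 'n set"
  where "norm_kernel N K S = {x \<in> carrier N. \<forall>k\<in>S. alg_norm K k \<odot>\<^bsub>N\<^esub> x = \<zero>\<^bsub>N\<^esub>}"

definition proper_subfields :: "complex set \<Rightarrow> complex set set"
  where "proper_subfields K = {k. subfield k CC \<and> k \<subset> K}"

definition subfield_of_codegree :: "complex set \<Rightarrow> nat \<Rightarrow> complex set"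
  where "subfield_of_codegree K l = (THE k. subfield k CC \<and> k \<subseteq> K \<and> field_degree K k = l)"

definition prime_codegree_subfields :: "complex set \<Rightarrow> complex set set"
  where "prime_codegree_subfields K =
    {subfield_of_codegree K l |l. prime l \<and> l dvd field_degree K \<rat>}"

end

theory Submission
  imports Defs
begin

text \<open>Let \<open>g\<close> be the order of \<open>\<psi>\<close>. The field \<open>K\<close> of \<open>\<psi>\<close> is cyclic of degree \<open>g\<close> over the
rationals, and letting \<open>X\<close> act as the generator \<open>\<sigma>\<close> turns both \<open>M K\<close> and its tensor product
with the \<open>p\<close>-adic integers into modules over the integer polynomials on which \<open>X^g - 1\<close> acts as
zero. If \<open>k\<close> is a subfield of \<open>K\<close> and \<open>m\<close> is the degree of \<open>K\<close> over \<open>k\<close>, the Galois group of \<open>K\<close>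
over \<open>k\<close> consists of the powers of \<open>\<sigma>^(g/m)\<close>, so the norm from \<open>K\<close> to \<open>k\<close> acts as the
polynomial \<open>N_m = (X^g - 1) / (X^(g/m) - 1)\<close>, which is the product of the cyclotomic polynomials
\<open>P_d\<close> over the divisors \<open>d\<close> of \<open>g\<close> that do not divide \<open>g/m\<close>
(\<open>geometric_norm_eq_prod_cyclotomic\<close>, \<open>alg_norm_eq_poly_at\<close>).

For \<open>m > 1\<close> the factor \<open>P_g\<close> occurs in this product, so whatever \<open>P_g(\<sigma>)\<close> kills is killed by
all norms to proper subfields. The converse needs only the norms \<open>N_l\<close> with \<open>l\<close> prime. The
annihilator of an element is an ideal, and \<open>P_g\<close> lies in the ideal generated by the \<open>N_l\<close>
(\<open>cyclotomic_mem_ideal\<close>): the set of indices \<open>d\<close> occurring in \<open>N_l\<close> is closed under passing to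
multiples that divide \<open>g\<close>, these sets meet in \<open>{g}\<close>, and an ideal that contains the products of
\<open>P_d\<close> over two such sets contains the product over their intersection, because \<open>P_d\<close> and \<open>P_e\<close>
generate the unit ideal of the integer polynomials whenever neither of \<open>d\<close>, \<open>e\<close> divides the other
(\<open>cyclotomic_comaximal\<close>). This argument concerns modules over the integer polynomials and covers
the tensor product as well.

What is left in the \<open>p\<close>-adic case is that the kernel of \<open>P_g(\<sigma>)\<close>, tensored with the \<open>p\<close>-adic
integers, is the kernel of \<open>P_g(\<sigma>)\<close> on the tensor product. This holds for every torsion-free
factor \<open>B\<close> (\<open>tensor_kernel_torsion_free\<close>). Elements of tensor products are detected by characters with
values in the unit circle, that is, by bilinear maps into the circle; these are homomorphisms into
\<open>Hom(B, circle)\<close>, a divisible group since \<open>B\<close> is torsion-free, and homomorphisms into a divisible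
group extend from subgroups.

The Galois theory takes place inside the field of all algebraic numbers. Embeddings of subfields
extend to automorphisms of that field, and an element outside a subfield \<open>k\<close> is moved by an
automorphism that fixes \<open>k\<close> (\<open>field_hom_extends\<close>, \<open>moved_by_Gal\<close>). The maximal abelian extension
is the set of algebraic numbers on which all automorphisms commute (\<open>commuting_algebraics_eq_Qab\<close>);
hence it is a field and each of its subfields is normal. Since \<open>\<psi>\<close> is continuous, its kernel contains
the stabilizer of a finite set. Artin's argument with the polynomial whose roots form an orbit then shows
that an automorphism fixes \<open>K\<close> only if \<open>\<psi>\<close> is \<open>1\<close> on it (\<open>char_field_galois\<close>), so that \<open>K\<close> has
degree \<open>g\<close> (\<open>char_order_eq\<close>).\<close>

section \<open>Homomorphisms into divisible groups\<close>

text \<open>A homomorphism from a subgroup of \<open>G\<close> to \<open>D\<close>, given by its graph. In this form partial homomorphisms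
are ordered by inclusion and the union of a chain of them is again one, as Zorn's lemma requires.\<close>

definition hom_graph :: "('a, 'm) monoid_scheme \<Rightarrow> ('b, 'n) monoid_scheme \<Rightarrow> ('a \<times> 'b) set \<Rightarrow> bool"
  where "hom_graph G D \<Gamma> \<longleftrightarrow> \<Gamma> \<subseteq> carrier G \<times> carrier D \<and> (\<one>\<^bsub>G\<^esub>, \<one>\<^bsub>D\<^esub>) \<in> \<Gamma> \<and>
    (\<forall>x d y e. (x, d) \<in> \<Gamma> \<longrightarrow> (y, e) \<in> \<Gamma> \<longrightarrow> (x \<otimes>\<^bsub>G\<^esub> inv\<^bsub>G\<^esub> y, d \<otimes>\<^bsub>D\<^esub> inv\<^bsub>D\<^esub> e) \<in> \<Gamma>) \<and>
    (\<forall>d. (\<one>\<^bsub>G\<^esub>, d) \<in> \<Gamma> \<longrightarrow> d = \<one>\<^bsub>D\<^esub>)"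

definition divisible_group :: "('b, 'n) monoid_scheme \<Rightarrow> bool"
  where "divisible_group D \<longleftrightarrow> comm_group D \<and>
    (\<forall>d\<in>carrier D. \<forall>n::nat. 0 < n \<longrightarrow> (\<exists>e\<in>carrier D. e [^]\<^bsub>D\<^esub> n = d))"

lemma int_subgroup_multiples:
  fixes P :: "int \<Rightarrow> bool"
  assumes "P 0" and diff: "\<And>j k. P j \<Longrightarrow> P k \<Longrightarrow> P (j - k)"
  obtains m :: nat where "\<And>k. P k \<longleftrightarrow> int m dvd k"
proof (cases "\<exists>n::nat. 0 < n \<and> P (int n)")
  case False
  have neg: "P (- k)" if "P k" for k using diff[OF \<open>P 0\<close> that] by simp
  have "k = 0" if "P k" for k
  proof (rule ccontr)
    assume "k \<noteq> 0"
    have "P (int (nat \<bar>k\<bar>))" using that neg[OF that] by (cases "k \<ge> 0") auto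
    then show False using False \<open>k \<noteq> 0\<close> by (metis zero_less_abs_iff zero_less_nat_eq)
  qed
  then have "P k \<longleftrightarrow> int 0 dvd k" for k using \<open>P 0\<close> by auto
  then show thesis by (rule that)
next
  case True
  define m where "m = (LEAST n::nat. 0 < n \<and> P (int n))"
  have m: "0 < m" "P (int m)" using LeastI_ex[OF True] unfolding m_def by auto
  have least: "m \<le> n" if "0 < n" "P (int n)" for n
    unfolding m_def using that by (intro Least_le) auto
  have neg: "P (- k)" if "P k" for k using diff[OF \<open>P 0\<close> that] by simp
  have add: "P (j + k)" if "P j" "P k" for j k using diff[OF \<open>P j\<close> neg[OF \<open>P k\<close>]] by simp
  have nmul: "P (int m * int n)" for n
    by (induction n) (use \<open>P 0\<close> m add in \<open>auto simp: algebra_simps\<close>)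
  have mul: "P (int m * j)" for j
  proof (cases "j \<ge> 0")
    case True then show ?thesis using nmul[of "nat j"] by simp
  next
    case False then show ?thesis using neg[OF nmul[of "nat (- j)"]] by simp
  qed
  have "int m dvd k" if "P k" for k
  proof -
    have "P (k mod int m)" using diff[OF that mul[of "k div int m"]] by (simp add: minus_mult_div_eq_mod)
    moreover have "0 \<le> k mod int m" "k mod int m < int m" using m by auto
    ultimately have "k mod int m = 0"
      using least[of "nat (k mod int m)"] by fastforce
    then show ?thesis by auto
  qed
  then have "P k \<longleftrightarrow> int m dvd k" for k using mul by (auto simp: dvd_def)
  then show thesis by (rule that)
qed

lemma hom_graph_int_pow:
  assumes "comm_group G" "comm_group D" "hom_graph G D \<Gamma>" "(x, d) \<in> \<Gamma>"
  shows "(x [^]\<^bsub>G\<^esub> (k::int), d [^]\<^bsub>D\<^esub> k) \<in> \<Gamma>"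
proof -
  interpret G: comm_group G by fact
  interpret D: comm_group D by fact
  have one: "(\<one>\<^bsub>G\<^esub>, \<one>\<^bsub>D\<^esub>) \<in> \<Gamma>" and sub: "\<Gamma> \<subseteq> carrier G \<times> carrier D"
    and diff: "\<And>x d y e. (x, d) \<in> \<Gamma> \<Longrightarrow> (y, e) \<in> \<Gamma> \<Longrightarrow> (x \<otimes>\<^bsub>G\<^esub> inv\<^bsub>G\<^esub> y, d \<otimes>\<^bsub>D\<^esub> inv\<^bsub>D\<^esub> e) \<in> \<Gamma>"
    using assms(3) by (auto simp: hom_graph_def)
  have c: "x \<in> carrier G" "d \<in> carrier D" using sub assms(4) by auto
  have iv: "(inv\<^bsub>G\<^esub> y, inv\<^bsub>D\<^esub> e) \<in> \<Gamma>" if "(y, e) \<in> \<Gamma>" for y e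
  proof -
    have "y \<in> carrier G" "e \<in> carrier D" using that sub by auto
    then show ?thesis using diff[OF one that] by simp
  qed
  have n: "(x [^]\<^bsub>G\<^esub> (n::nat), d [^]\<^bsub>D\<^esub> n) \<in> \<Gamma>" for n
  proof (induction n)
    case 0 then show ?case using one by simp
  next
    case (Suc n) then show ?case using diff[OF Suc iv[OF assms(4)]] c by simp
  qed
  show ?thesis
  proof (cases k rule: int_cases2)
    case (nonneg m) then show ?thesis using n[of m] by (simp only: int_pow_int)
  next
    case (nonpos m) then show ?thesis
      using iv[OF n[of m]] c by (simp only: G.int_pow_neg_int D.int_pow_neg_int)
  qed
qed

lemma hom_graph_unique:
  assumes "comm_group G" "comm_group D" "hom_graph G D \<Gamma>" "(x, d) \<in> \<Gamma>" "(x, e) \<in> \<Gamma>"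
  shows "d = e"
proof -
  interpret G: comm_group G by fact
  interpret D: comm_group D by fact
  have c: "x \<in> carrier G" "d \<in> carrier D" "e \<in> carrier D" using assms by (auto simp: hom_graph_def)
  have "(x \<otimes>\<^bsub>G\<^esub> inv\<^bsub>G\<^esub> x, d \<otimes>\<^bsub>D\<^esub> inv\<^bsub>D\<^esub> e) \<in> \<Gamma>" using assms unfolding hom_graph_def by blast
  then have "d \<otimes>\<^bsub>D\<^esub> inv\<^bsub>D\<^esub> e = \<one>\<^bsub>D\<^esub>" using assms(3) c unfolding hom_graph_def by simp
  then have "d = inv\<^bsub>D\<^esub> (inv\<^bsub>D\<^esub> e)" using D.inv_equality[of d "inv\<^bsub>D\<^esub> e"] c by simp
  then show ?thesis using c by simp
qed

text \<open>The new domain consists of the products of an element of the old one with a power of \<open>x\<close>. The condition on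
\<open>d\<close> makes the value at such a product independent of how the product is written.\<close>

lemma hom_graph_adjoin:
  assumes "comm_group G" "comm_group D" "hom_graph G D \<Gamma>" "x \<in> carrier G" "d \<in> carrier D"
    and compat: "\<And>k e. (x [^]\<^bsub>G\<^esub> (k::int), e) \<in> \<Gamma> \<Longrightarrow> e = d [^]\<^bsub>D\<^esub> k"
  obtains \<Gamma>' where "hom_graph G D \<Gamma>'" "\<Gamma> \<subseteq> \<Gamma>'" "(x, d) \<in> \<Gamma>'"
proof
  interpret G: comm_group G by fact
  interpret D: comm_group D by fact
  have one: "(\<one>\<^bsub>G\<^esub>, \<one>\<^bsub>D\<^esub>) \<in> \<Gamma>" and sub: "\<Gamma> \<subseteq> carrier G \<times> carrier D"
    and diff: "\<And>x d y e. (x, d) \<in> \<Gamma> \<Longrightarrow> (y, e) \<in> \<Gamma> \<Longrightarrow> (x \<otimes>\<^bsub>G\<^esub> inv\<^bsub>G\<^esub> y, d \<otimes>\<^bsub>D\<^esub> inv\<^bsub>D\<^esub> e) \<in> \<Gamma>"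
    using assms(3) by (auto simp: hom_graph_def)
  define \<Gamma>' where "\<Gamma>' = {(y \<otimes>\<^bsub>G\<^esub> x [^]\<^bsub>G\<^esub> k, e \<otimes>\<^bsub>D\<^esub> d [^]\<^bsub>D\<^esub> k) |y e k::int. (y, e) \<in> \<Gamma>}"
  show "\<Gamma> \<subseteq> \<Gamma>'"
  proof
    fix z assume "z \<in> \<Gamma>"
    moreover obtain y e where "z = (y, e)" by fastforce
    ultimately show "z \<in> \<Gamma>'" unfolding \<Gamma>'_def using sub assms(4,5)
      by (auto intro!: exI[of _ y] exI[of _ e] exI[of _ "0::int"])
  qed
  show "(x, d) \<in> \<Gamma>'" unfolding \<Gamma>'_def using one assms(4,5)
    by (auto intro!: exI[of _ "\<one>\<^bsub>G\<^esub>"] exI[of _ "\<one>\<^bsub>D\<^esub>"] exI[of _ "1::int"] simp: G.int_pow_1 D.int_pow_1)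
  show "hom_graph G D \<Gamma>'" unfolding hom_graph_def
  proof (intro conjI allI impI)
    show "\<Gamma>' \<subseteq> carrier G \<times> carrier D" unfolding \<Gamma>'_def using sub assms(4,5) by auto
    show "(\<one>\<^bsub>G\<^esub>, \<one>\<^bsub>D\<^esub>) \<in> \<Gamma>'" using \<open>\<Gamma> \<subseteq> \<Gamma>'\<close> one by auto
  next
    fix y e z f assume "(y, e) \<in> \<Gamma>'" "(z, f) \<in> \<Gamma>'"
    then obtain y' e' k z' f' j where h: "(y', e') \<in> \<Gamma>" "(z', f') \<in> \<Gamma>"
        "y = y' \<otimes>\<^bsub>G\<^esub> x [^]\<^bsub>G\<^esub> (k::int)" "e = e' \<otimes>\<^bsub>D\<^esub> d [^]\<^bsub>D\<^esub> k"
        "z = z' \<otimes>\<^bsub>G\<^esub> x [^]\<^bsub>G\<^esub> (j::int)" "f = f' \<otimes>\<^bsub>D\<^esub> d [^]\<^bsub>D\<^esub> j"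
      unfolding \<Gamma>'_def by auto
    have c: "y' \<in> carrier G" "z' \<in> carrier G" "e' \<in> carrier D" "f' \<in> carrier D" using h sub by auto
    have "y \<otimes>\<^bsub>G\<^esub> inv\<^bsub>G\<^esub> z = (y' \<otimes>\<^bsub>G\<^esub> inv\<^bsub>G\<^esub> z') \<otimes>\<^bsub>G\<^esub> x [^]\<^bsub>G\<^esub> (k - j)"
      using c assms(4) by (simp add: h G.int_pow_diff G.inv_mult G.m_ac)
    moreover have "e \<otimes>\<^bsub>D\<^esub> inv\<^bsub>D\<^esub> f = (e' \<otimes>\<^bsub>D\<^esub> inv\<^bsub>D\<^esub> f') \<otimes>\<^bsub>D\<^esub> d [^]\<^bsub>D\<^esub> (k - j)"
      using c assms(5) by (simp add: h D.int_pow_diff D.inv_mult D.m_ac)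
    ultimately show "(y \<otimes>\<^bsub>G\<^esub> inv\<^bsub>G\<^esub> z, e \<otimes>\<^bsub>D\<^esub> inv\<^bsub>D\<^esub> f) \<in> \<Gamma>'"
      unfolding \<Gamma>'_def using diff[OF h(1,2)] by auto
  next
    fix e assume "(\<one>\<^bsub>G\<^esub>, e) \<in> \<Gamma>'"
    then obtain y' e' k where h: "(y', e') \<in> \<Gamma>"
        "\<one>\<^bsub>G\<^esub> = y' \<otimes>\<^bsub>G\<^esub> x [^]\<^bsub>G\<^esub> (k::int)" "e = e' \<otimes>\<^bsub>D\<^esub> d [^]\<^bsub>D\<^esub> k"
      unfolding \<Gamma>'_def by auto
    have c: "y' \<in> carrier G" "e' \<in> carrier D" using h sub by auto
    have "y' = inv\<^bsub>G\<^esub> (x [^]\<^bsub>G\<^esub> k)" using G.inv_equality[of y' "x [^]\<^bsub>G\<^esub> k"] c h(2) assms(4) by simp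
    then have y': "y' = x [^]\<^bsub>G\<^esub> (- k)" using assms(4) by (simp add: G.int_pow_neg)
    have "e' = d [^]\<^bsub>D\<^esub> (- k)" using compat[of "- k" e'] h(1) y' by simp
    then show "e = \<one>\<^bsub>D\<^esub>" using h(3) assms(5) by (simp add: D.int_pow_neg)
  qed
qed

text \<open>The exponents \<open>k\<close> for which the \<open>k\<close>-th power of \<open>x\<close> lies in the domain are the multiples of some
\<open>m\<close>. A value at \<open>x\<close> is therefore admissible exactly if its \<open>m\<close>-th power is the prescribed value at
the \<open>m\<close>-th power of \<open>x\<close>, and divisibility provides one. So a maximal partial homomorphism is defined
everywhere.\<close>

lemma hom_graph_extends_to_hom:
  assumes "comm_group G" "divisible_group D" "hom_graph G D \<Gamma>"
  obtains h where "h \<in> hom G D" "\<And>x d. (x, d) \<in> \<Gamma> \<Longrightarrow> h x = d"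
proof -
  have "comm_group D" using assms by (simp add: divisible_group_def)
  interpret G: comm_group G by fact
  interpret D: comm_group D by fact
  define \<A> where "\<A> = {\<Delta>. hom_graph G D \<Delta> \<and> \<Gamma> \<subseteq> \<Delta>}"
  have "\<exists>M\<in>\<A>. \<forall>\<Delta>\<in>\<A>. M \<subseteq> \<Delta> \<longrightarrow> \<Delta> = M"
  proof (rule subset_Zorn_nonempty)
    show "\<A> \<noteq> {}" using assms by (auto simp: \<A>_def)
  next
    fix C assume C: "C \<noteq> {}" "subset.chain \<A> C"
    then have CA: "C \<subseteq> \<A>" by (auto simp: subset.chain_def)
    have two: "\<exists>\<Delta>\<in>C. p \<in> \<Delta> \<and> q \<in> \<Delta>" if "p \<in> \<Union>C" "q \<in> \<Union>C" for p q
      using that C(2) unfolding subset_chain_def by blast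
    have "hom_graph G D (\<Union>C)" unfolding hom_graph_def
    proof (intro conjI allI impI)
      show "\<Union>C \<subseteq> carrier G \<times> carrier D" using CA by (auto simp: \<A>_def hom_graph_def)
      show "(\<one>\<^bsub>G\<^esub>, \<one>\<^bsub>D\<^esub>) \<in> \<Union>C" using CA C(1) by (auto simp: \<A>_def hom_graph_def)
      show "d = \<one>\<^bsub>D\<^esub>" if "(\<one>\<^bsub>G\<^esub>, d) \<in> \<Union>C" for d using CA that by (auto simp: \<A>_def hom_graph_def)
      show "(x \<otimes>\<^bsub>G\<^esub> inv\<^bsub>G\<^esub> y, d \<otimes>\<^bsub>D\<^esub> inv\<^bsub>D\<^esub> e) \<in> \<Union>C" if xy: "(x, d) \<in> \<Union>C" "(y, e) \<in> \<Union>C" for x d y e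
      proof -
        obtain \<Delta> where "\<Delta> \<in> C" "(x, d) \<in> \<Delta>" "(y, e) \<in> \<Delta>" using two[OF xy] by auto
        moreover then have "hom_graph G D \<Delta>" using CA by (auto simp: \<A>_def)
        ultimately show ?thesis unfolding hom_graph_def by blast
      qed
    qed
    then show "\<Union>C \<in> \<A>" using CA C(1) by (auto simp: \<A>_def)
  qed
  then obtain M where "M \<in> \<A>" and maxA: "\<And>\<Delta>. \<Delta> \<in> \<A> \<Longrightarrow> M \<subseteq> \<Delta> \<Longrightarrow> \<Delta> = M" by auto
  then have M: "hom_graph G D M" "\<Gamma> \<subseteq> M" by (simp_all add: \<A>_def)
  have max: "\<Delta> = M" if "hom_graph G D \<Delta>" "M \<subseteq> \<Delta>" for \<Delta>
    using maxA[of \<Delta>] that M(2) by (simp add: \<A>_def)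
  have one: "(\<one>\<^bsub>G\<^esub>, \<one>\<^bsub>D\<^esub>) \<in> M" and sub: "M \<subseteq> carrier G \<times> carrier D"
    and diff: "\<And>x d y e. (x, d) \<in> M \<Longrightarrow> (y, e) \<in> M \<Longrightarrow> (x \<otimes>\<^bsub>G\<^esub> inv\<^bsub>G\<^esub> y, d \<otimes>\<^bsub>D\<^esub> inv\<^bsub>D\<^esub> e) \<in> M"
    using M(1) by (auto simp: hom_graph_def)
  have total: "\<exists>d. (x, d) \<in> M" if x: "x \<in> carrier G" for x
  proof -
    obtain m :: nat where m: "\<And>k. (\<exists>e. (x [^]\<^bsub>G\<^esub> (k::int), e) \<in> M) \<longleftrightarrow> int m dvd k"
    proof (rule int_subgroup_multiples[of "\<lambda>k. \<exists>e. (x [^]\<^bsub>G\<^esub> (k::int), e) \<in> M"])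
      show "\<exists>e. (x [^]\<^bsub>G\<^esub> (0::int), e) \<in> M" using one by auto
      show "\<exists>e. (x [^]\<^bsub>G\<^esub> (j - k), e) \<in> M" if "\<exists>e. (x [^]\<^bsub>G\<^esub> j, e) \<in> M" "\<exists>e. (x [^]\<^bsub>G\<^esub> k, e) \<in> M" for j k :: int
      proof -
        from that obtain e f where "(x [^]\<^bsub>G\<^esub> j, e) \<in> M" "(x [^]\<^bsub>G\<^esub> k, f) \<in> M" by auto
        from diff[OF this] show ?thesis using x by (auto simp: G.int_pow_diff)
      qed
    qed (rule that)
    obtain e where e: "(x [^]\<^bsub>G\<^esub> int m, e) \<in> M" using m[of "int m"] by auto
    then have ec: "e \<in> carrier D" using sub by auto
    \<comment> \<open>For \<open>m = 0\<close>, only the zeroth power of \<open>x\<close> lies in the domain, and any value would do.\<close>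
    have "\<exists>d\<in>carrier D. d [^]\<^bsub>D\<^esub> int m = e"
    proof (cases "m = 0")
      case True
      then have "e = \<one>\<^bsub>D\<^esub>" using e M(1) by (auto simp: hom_graph_def)
      then show ?thesis using True by auto
    next
      case False
      then show ?thesis using assms(2) ec unfolding divisible_group_def by (auto simp: int_pow_int)
    qed
    then obtain d where d: "d \<in> carrier D" "d [^]\<^bsub>D\<^esub> int m = e" by auto
    have compat: "f = d [^]\<^bsub>D\<^esub> k" if xf: "(x [^]\<^bsub>G\<^esub> (k::int), f) \<in> M" for k f
    proof -
      obtain j where j: "k = int m * j" using m[of k] xf by (auto elim: dvdE)
      have "(x [^]\<^bsub>G\<^esub> k, e [^]\<^bsub>D\<^esub> j) \<in> M"
        using hom_graph_int_pow[OF \<open>comm_group G\<close> \<open>comm_group D\<close> M(1) e, of j] x by (simp add: G.int_pow_pow j)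
      then have "f = e [^]\<^bsub>D\<^esub> j"
        by (rule hom_graph_unique[OF \<open>comm_group G\<close> \<open>comm_group D\<close> M(1) xf])
      then show ?thesis unfolding j d(2)[symmetric] using d(1) by (simp only: D.int_pow_pow)
    qed
    obtain M' where "hom_graph G D M'" "M \<subseteq> M'" "(x, d) \<in> M'"
      using hom_graph_adjoin[OF \<open>comm_group G\<close> \<open>comm_group D\<close> M(1) x d(1) compat] by blast
    then show ?thesis using max[of M'] by blast
  qed
  define h where "h x = (THE d. (x, d) \<in> M)" for x
  have h: "h x = d" if "(x, d) \<in> M" for x d
    unfolding h_def using that hom_graph_unique[OF \<open>comm_group G\<close> \<open>comm_group D\<close> M(1)] by blast
  have hM: "(x, h x) \<in> M" if "x \<in> carrier G" for x using total[OF that] h by auto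
  have "h \<in> hom G D"
  proof (rule homI)
    show "h x \<in> carrier D" if "x \<in> carrier G" for x using hM[OF that] sub by auto
    fix x y assume xy: "x \<in> carrier G" "y \<in> carrier G"
    have c: "h x \<in> carrier D" "h y \<in> carrier D" using xy hM sub by auto
    have "(\<one>\<^bsub>G\<^esub> \<otimes>\<^bsub>G\<^esub> inv\<^bsub>G\<^esub> y, \<one>\<^bsub>D\<^esub> \<otimes>\<^bsub>D\<^esub> inv\<^bsub>D\<^esub> (h y)) \<in> M" using diff one hM xy by blast
    from diff[OF hM[OF xy(1)] this] show "h (x \<otimes>\<^bsub>G\<^esub> y) = h x \<otimes>\<^bsub>D\<^esub> h y" using h xy c by simp
  qed
  moreover have "h x = d" if "(x, d) \<in> \<Gamma>" for x d using h M(2) that by auto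
  ultimately show thesis by (rule that)
qed

lemma hom_extends_to_divisible:
  assumes "comm_group G" "divisible_group D" "subgroup H G" "f \<in> hom (G\<lparr>carrier := H\<rparr>) D"
  obtains h where "h \<in> hom G D" "\<And>x. x \<in> H \<Longrightarrow> h x = f x"
proof -
  have "comm_group D" using assms by (simp add: divisible_group_def)
  interpret G: comm_group G by fact
  interpret D: comm_group D by fact
  interpret H: subgroup H G by fact
  have gh: "group_hom (G\<lparr>carrier := H\<rparr>) D f"
    using assms(4) H.subgroup_is_group[OF G.is_group] D.is_group by (simp add: group_hom_def group_hom_axioms_def)
  have fone: "f \<one>\<^bsub>G\<^esub> = \<one>\<^bsub>D\<^esub>" using group_hom.hom_one[OF gh] by simp
  have fc: "f x \<in> carrier D" if "x \<in> H" for x using hom_in_carrier[OF assms(4)] that by simp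
  have finv: "f (inv\<^bsub>G\<^esub> x) = inv\<^bsub>D\<^esub> f x" if "x \<in> H" for x
    using group_hom.hom_inv[OF gh] that G.m_inv_consistent[OF assms(3)] by simp
  have fm: "f (x \<otimes>\<^bsub>G\<^esub> y) = f x \<otimes>\<^bsub>D\<^esub> f y" if "x \<in> H" "y \<in> H" for x y
    using hom_mult[OF assms(4)] that by simp
  have "hom_graph G D ((\<lambda>x. (x, f x)) ` H)"
    unfolding hom_graph_def
  proof (intro conjI allI impI)
    show "(\<lambda>x. (x, f x)) ` H \<subseteq> carrier G \<times> carrier D" using fc by auto
    show "(\<one>\<^bsub>G\<^esub>, \<one>\<^bsub>D\<^esub>) \<in> (\<lambda>x. (x, f x)) ` H" 
      by (rule image_eqI[of _ _ "\<one>\<^bsub>G\<^esub>"]) (simp_all add: fone)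
    show "d = \<one>\<^bsub>D\<^esub>" if "(\<one>\<^bsub>G\<^esub>, d) \<in> (\<lambda>x. (x, f x)) ` H" for d using that fone by auto
    show "(x \<otimes>\<^bsub>G\<^esub> inv\<^bsub>G\<^esub> y, d \<otimes>\<^bsub>D\<^esub> inv\<^bsub>D\<^esub> e) \<in> (\<lambda>x. (x, f x)) ` H"
      if "(x, d) \<in> (\<lambda>x. (x, f x)) ` H" "(y, e) \<in> (\<lambda>x. (x, f x)) ` H" for x d y e
    proof -
      have "x \<in> H" "y \<in> H" "d = f x" "e = f y" using that by auto
      then show ?thesis using fm[of x "inv\<^bsub>G\<^esub> y"] finv[of y] H.m_inv_closed H.m_closed by auto
    qed
  qed
  then obtain h where "h \<in> hom G D" "\<And>x d. (x, d) \<in> (\<lambda>x. (x, f x)) ` H \<Longrightarrow> h x = d"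
    using hom_graph_extends_to_hom[OF assms(1,2)] by blast
  then show thesis using that[of h] by auto
qed

section \<open>Characters with values in the unit circle\<close>

definition circle_group :: "complex monoid"
  where "circle_group = \<lparr>carrier = {z. norm z = 1}, monoid.mult = (*), one = 1\<rparr>"

lemma comm_group_circle_group: "comm_group circle_group"
proof (rule comm_groupI)
  show "\<exists>y\<in>carrier circle_group. y \<otimes>\<^bsub>circle_group\<^esub> x = \<one>\<^bsub>circle_group\<^esub>"
    if "x \<in> carrier circle_group" for x
    using that unfolding circle_group_def
    by (intro bexI[of _ "inverse x"]) (auto simp: norm_inverse intro: left_inverse)
qed (auto simp: circle_group_def norm_mult)

lemma circle_group_nat_pow: "z [^]\<^bsub>circle_group\<^esub> (n::nat) = z ^ n"
proof (induction n)
  case 0 show ?case by (simp only: nat_pow_0 power_0) (simp add: circle_group_def)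
next
  case (Suc n) show ?case by (simp only: nat_pow_Suc Suc) (simp add: circle_group_def mult.commute)
qed

lemma divisible_circle_group: "divisible_group circle_group"
  unfolding divisible_group_def
proof (intro conjI ballI allI impI)
  fix d :: complex and n :: nat assume d: "d \<in> carrier circle_group" "0 < n"
  then have "norm d = 1" by (simp add: circle_group_def)
  then have "d \<noteq> 0" by auto
  then have "d = cis (Arg d)" using \<open>norm d = 1\<close> by (simp add: cis_Arg sgn_div_norm)
  then have "cis (Arg d / n) ^ n = d" using d by (simp add: DeMoivre)
  then show "\<exists>e\<in>carrier circle_group. e [^]\<^bsub>circle_group\<^esub> n = d"
    by (intro bexI[of _ "cis (Arg d / n)"]) (simp_all only: circle_group_nat_pow, simp_all add: circle_group_def)
qed (rule comm_group_circle_group)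

text \<open>Let the powers of \<open>t\<close> that lie in \<open>H\<close> be those whose exponent is divisible by \<open>m\<close>. As \<open>t\<close> is not in
\<open>H\<close>, \<open>m\<close> is not \<open>1\<close>, and there is a root of unity \<open>d\<close> other than \<open>1\<close> with \<open>d^m = 1\<close>. The trivial
homomorphism on \<open>H\<close> accepts \<open>d\<close> as its value at \<open>t\<close>, and the circle is divisible.\<close>

lemma character_separates_subgroup:
  assumes "comm_group G" "subgroup H G" "t \<in> carrier G" "t \<notin> H"
  obtains \<phi> where "\<phi> \<in> hom G circle_group" "\<And>x. x \<in> H \<Longrightarrow> \<phi> x = 1" "\<phi> t \<noteq> 1"
proof -
  interpret G: comm_group G by fact
  interpret S: comm_group circle_group by (rule comm_group_circle_group)
  interpret H: subgroup H G by fact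
  have graph: "hom_graph G circle_group (H \<times> {1})"
    unfolding hom_graph_def using S.inv_one by (auto simp: circle_group_def)
  obtain m :: nat where m: "\<And>k. t [^]\<^bsub>G\<^esub> (k::int) \<in> H \<longleftrightarrow> int m dvd k"
    by (rule int_subgroup_multiples[of "\<lambda>k. t [^]\<^bsub>G\<^esub> (k::int) \<in> H"]) (use assms(3) in \<open>auto simp: G.int_pow_diff\<close>)
  have m1: "m \<noteq> 1" using m[of 1] assms(3,4) by (auto simp: G.int_pow_1)
  obtain d :: complex where d: "d \<noteq> 1" "norm d = 1" "d ^ m = 1"
  proof (cases "m = 0")
    case True
    then show thesis using that[of "-1"] by auto
  next
    case False
    have "cis (2 * pi / m) \<noteq> 1"
    proof
      assume "cis (2 * pi / m) = 1"
      then have "(1::nat) = 0"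
        using bij_betw_imp_inj_on[OF bij_betw_roots_unity[of m]] False m1
        by (intro inj_onD[of "\<lambda>k::nat. cis (2 * pi * real k / real m)" "{..<m}" 1 0]) auto
      then show False by simp
    qed
    then show thesis using that[of "cis (2 * pi / m)"] False by (simp add: DeMoivre)
  qed
  have dc: "d \<in> carrier circle_group" using d by (simp add: circle_group_def)
  have "e = d [^]\<^bsub>circle_group\<^esub> k" if te: "(t [^]\<^bsub>G\<^esub> (k::int), e) \<in> H \<times> {1}" for k e
  proof -
    obtain j where j: "k = int m * j" using m[of k] te by (auto elim: dvdE)
    have "d [^]\<^bsub>circle_group\<^esub> int m = \<one>\<^bsub>circle_group\<^esub>"
      using d by (simp add: int_pow_int circle_group_nat_pow) (simp add: circle_group_def)
    then have "d [^]\<^bsub>circle_group\<^esub> k = \<one>\<^bsub>circle_group\<^esub>" unfolding j using dc by (metis S.int_pow_pow S.int_pow_one)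
    then show ?thesis using that by (simp add: circle_group_def)
  qed
  then obtain \<Gamma> where \<Gamma>: "hom_graph G circle_group \<Gamma>" "H \<times> {1} \<subseteq> \<Gamma>" "(t, d) \<in> \<Gamma>"
    using hom_graph_adjoin[OF assms(1) comm_group_circle_group graph assms(3) dc] by blast
  obtain \<phi> where "\<phi> \<in> hom G circle_group" "\<And>x d. (x, d) \<in> \<Gamma> \<Longrightarrow> \<phi> x = d"
    using hom_graph_extends_to_hom[OF assms(1) divisible_circle_group \<Gamma>(1)] by blast
  then show thesis using that[of \<phi>] \<Gamma> d(1) by blast
qed

section \<open>Tensor products of abelian groups\<close>

definition pure_tensor :: "('a, 'r) monoid_scheme \<Rightarrow> ('b, 's) monoid_scheme \<Rightarrow> 'a \<Rightarrow> 'b \<Rightarrow> ('a \<times> 'b \<Rightarrow>\<^sub>0 int) set"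
  where "pure_tensor A B a b = tensor_rels A B #>\<^bsub>free_Abelian_group (carrier A \<times> carrier B)\<^esub> frag_of (a, b)"

definition bilinear_on :: "('a, 'r) monoid_scheme \<Rightarrow> ('b, 's) monoid_scheme \<Rightarrow> ('c, 't) monoid_scheme \<Rightarrow> ('a \<Rightarrow> 'b \<Rightarrow> 'c) \<Rightarrow> bool"
  where "bilinear_on A B D \<beta> \<longleftrightarrow>
    (\<forall>a\<in>carrier A. \<forall>b\<in>carrier B. \<beta> a b \<in> carrier D) \<and>
    (\<forall>a\<in>carrier A. \<forall>a'\<in>carrier A. \<forall>b\<in>carrier B. \<beta> (a \<otimes>\<^bsub>A\<^esub> a') b = \<beta> a b \<otimes>\<^bsub>D\<^esub> \<beta> a' b) \<and>
    (\<forall>a\<in>carrier A. \<forall>b\<in>carrier B. \<forall>b'\<in>carrier B. \<beta> a (b \<otimes>\<^bsub>B\<^esub> b') = \<beta> a b \<otimes>\<^bsub>D\<^esub> \<beta> a b')"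

locale tensor_factors = A: comm_group A + B: comm_group B
  for A :: "('a, 'r) monoid_scheme" and B :: "('b, 's) monoid_scheme"
begin

abbreviation "F \<equiv> free_Abelian_group (carrier A \<times> carrier B)"
abbreviation "R \<equiv> tensor_rels A B"

lemma tensor_rels_normal: "R \<lhd> F"
proof -
  have "subgroup R F" unfolding tensor_rels_def
    by (rule group.generate_is_subgroup[OF group_free_Abelian_group])
      (use keys_diff keys_add in \<open>force dest!: subsetD[OF keys_diff]\<close>)
  then show ?thesis
    by (rule comm_group.subgroup_imp_normal[OF abelian_free_Abelian_group])
qed

lemma tensor_rels_subgroup: "subgroup R F"
  using tensor_rels_normal normal_imp_subgroup by blast

lemma comm_group_tensor: "comm_group (tensor A B)"
  unfolding tensor_def
  by (rule comm_group.abelian_FactGroup[OF abelian_free_Abelian_group tensor_rels_subgroup])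

lemma tensor_carrierE:
  assumes "t \<in> carrier (tensor A B)"
  obtains c where "c \<in> carrier F" "t = R #>\<^bsub>F\<^esub> c"
  using assms unfolding tensor_def FactGroup_def RCOSETS_def by auto

lemma tensor_carrierI: "c \<in> carrier F \<Longrightarrow> R #>\<^bsub>F\<^esub> c \<in> carrier (tensor A B)"
  unfolding tensor_def FactGroup_def RCOSETS_def by auto

lemma tensor_mult: "c \<in> carrier F \<Longrightarrow> d \<in> carrier F \<Longrightarrow>
    (R #>\<^bsub>F\<^esub> c) \<otimes>\<^bsub>tensor A B\<^esub> (R #>\<^bsub>F\<^esub> d) = R #>\<^bsub>F\<^esub> (c + d)"
  using normal.rcos_sum[OF tensor_rels_normal, of c d] unfolding tensor_def FactGroup_def by simp

lemma tensor_coset_hom: "(\<lambda>c. R #>\<^bsub>F\<^esub> c) \<in> hom F (tensor A B)"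
  by (rule homI) (use tensor_carrierI tensor_mult in auto)

lemma tensor_coset_mem: "c \<in> carrier F \<Longrightarrow> d \<in> R #>\<^bsub>F\<^esub> c \<longleftrightarrow> d - c \<in> R"
proof -
  assume c: "c \<in> carrier F"
  show ?thesis
  proof
    assume "d \<in> R #>\<^bsub>F\<^esub> c"
    then show "d - c \<in> R" unfolding r_coset_def by auto
  next
    assume "d - c \<in> R"
    then show "d \<in> R #>\<^bsub>F\<^esub> c" unfolding r_coset_def by (auto intro!: bexI[of _ "d - c"])
  qed
qed

lemma tensor_rels_add_left:
  "a \<in> carrier A \<Longrightarrow> a' \<in> carrier A \<Longrightarrow> b \<in> carrier B \<Longrightarrow>
    frag_of (a \<otimes>\<^bsub>A\<^esub> a', b) - frag_of (a, b) - frag_of (a', b) \<in> R"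
  unfolding tensor_rels_def by (rule generate.incl) blast

lemma tensor_rels_add_right:
  "a \<in> carrier A \<Longrightarrow> b \<in> carrier B \<Longrightarrow> b' \<in> carrier B \<Longrightarrow>
    frag_of (a, b \<otimes>\<^bsub>B\<^esub> b') - frag_of (a, b) - frag_of (a, b') \<in> R"
  unfolding tensor_rels_def by (rule generate.incl) blast

lemma tensor_rels_induct:
  assumes c: "c \<in> R" and zero: "P 0"
    and left: "\<And>a a' b. a \<in> carrier A \<Longrightarrow> a' \<in> carrier A \<Longrightarrow> b \<in> carrier B \<Longrightarrow>
      P (frag_of (a \<otimes>\<^bsub>A\<^esub> a', b) - frag_of (a, b) - frag_of (a', b))"
    and right: "\<And>a b b'. a \<in> carrier A \<Longrightarrow> b \<in> carrier B \<Longrightarrow> b' \<in> carrier B \<Longrightarrow>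
      P (frag_of (a, b \<otimes>\<^bsub>B\<^esub> b') - frag_of (a, b) - frag_of (a, b'))"
    and uminus: "\<And>c. c \<in> carrier F \<Longrightarrow> P c \<Longrightarrow> P (- c)"
    and add: "\<And>c d. c \<in> carrier F \<Longrightarrow> d \<in> carrier F \<Longrightarrow> P c \<Longrightarrow> P d \<Longrightarrow> P (c + d)"
  shows "P c"
proof -
  have RF: "c \<in> R \<Longrightarrow> c \<in> carrier F" for c using subgroup.mem_carrier[OF tensor_rels_subgroup] by blast
  show ?thesis using c unfolding tensor_rels_def
  proof (induction rule: generate.induct)
    case one then show ?case using zero by simp
  next
    case (incl h) then show ?case using left right by auto
  next
    case (inv h)
    then have "h \<in> R" unfolding tensor_rels_def by (rule generate.incl)
    then have "h \<in> carrier F" by (rule RF)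
    moreover have "P h" using inv left right by auto
    ultimately show ?case using uminus[of h] by (simp add: inv_free_Abelian_group)
  next
    case (eng h1 h2) then show ?case using add RF unfolding tensor_rels_def by simp
  qed
qed

lemma pure_tensor_closed: "a \<in> carrier A \<Longrightarrow> b \<in> carrier B \<Longrightarrow> pure_tensor A B a b \<in> carrier (tensor A B)"
  unfolding pure_tensor_def by (rule tensor_carrierI) simp

lemma tensor_coset_eqI:
  assumes "c \<in> carrier F" "d \<in> carrier F" "c - d \<in> R" shows "R #>\<^bsub>F\<^esub> c = R #>\<^bsub>F\<^esub> d"
  using assms tensor_coset_mem[of d c] group.repr_independence[OF group_free_Abelian_group _ _ tensor_rels_subgroup] by metis

lemma bilinear_pure_tensor: "bilinear_on A B (tensor A B) (pure_tensor A B)"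
  unfolding bilinear_on_def
proof (intro conjI ballI)
  fix a a' b assume h: "a \<in> carrier A" "a' \<in> carrier A" "b \<in> carrier B"
  show "pure_tensor A B (a \<otimes>\<^bsub>A\<^esub> a') b = pure_tensor A B a b \<otimes>\<^bsub>tensor A B\<^esub> pure_tensor A B a' b"
  proof -
    have "frag_of (a, b) + frag_of (a', b) \<in> carrier F" using h keys_add[of "frag_of (a, b)" "frag_of (a', b)"] by auto
    from tensor_coset_eqI[OF _ this, of "frag_of (a \<otimes>\<^bsub>A\<^esub> a', b)"] show ?thesis
      unfolding pure_tensor_def using h tensor_rels_add_left[OF h] by (simp add: tensor_mult diff_diff_add)
  qed
next
  fix a b b' assume h: "a \<in> carrier A" "b \<in> carrier B" "b' \<in> carrier B"
  show "pure_tensor A B a (b \<otimes>\<^bsub>B\<^esub> b') = pure_tensor A B a b \<otimes>\<^bsub>tensor A B\<^esub> pure_tensor A B a b'"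
  proof -
    have "frag_of (a, b) + frag_of (a, b') \<in> carrier F" using h keys_add[of "frag_of (a, b)" "frag_of (a, b')"] by auto
    from tensor_coset_eqI[OF _ this, of "frag_of (a, b \<otimes>\<^bsub>B\<^esub> b')"] show ?thesis
      unfolding pure_tensor_def using h tensor_rels_add_right[OF h] by (simp add: tensor_mult diff_diff_add)
  qed
qed (rule pure_tensor_closed)

lemma tensor_induct [consumes 1, case_names pure diff]:
  assumes t: "t \<in> carrier (tensor A B)"
    and pure: "\<And>a b. a \<in> carrier A \<Longrightarrow> b \<in> carrier B \<Longrightarrow> P (pure_tensor A B a b)"
    and diff: "\<And>s t. s \<in> carrier (tensor A B) \<Longrightarrow> t \<in> carrier (tensor A B) \<Longrightarrow> P s \<Longrightarrow> P t \<Longrightarrow>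
      P (s \<otimes>\<^bsub>tensor A B\<^esub> inv\<^bsub>tensor A B\<^esub> t)"
  shows "P t"
proof -
  interpret T: comm_group "tensor A B" by (rule comm_group_tensor)
  have gh: "group_hom F (tensor A B) (\<lambda>c. R #>\<^bsub>F\<^esub> c)"
    using tensor_coset_hom by (simp add: group_hom_def group_hom_axioms_def)
  obtain c where c: "c \<in> carrier F" "t = R #>\<^bsub>F\<^esub> c" using t by (rule tensor_carrierE)
  have "P (R #>\<^bsub>F\<^esub> c)"
  proof (rule free_Abelian_group_induct[of c "carrier A \<times> carrier B" "\<lambda>c. P (R #>\<^bsub>F\<^esub> c)"])
    show "Poly_Mapping.keys c \<subseteq> carrier A \<times> carrier B" using c by simp
    show "P (R #>\<^bsub>F\<^esub> 0)"
      using diff[OF pure_tensor_closed pure_tensor_closed pure pure, of \<open>\<one>\<^bsub>A\<^esub>\<close> \<open>\<one>\<^bsub>B\<^esub>\<close> \<open>\<one>\<^bsub>A\<^esub>\<close> \<open>\<one>\<^bsub>B\<^esub>\<close>]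
        group_hom.hom_one[OF gh] pure_tensor_closed[of "\<one>\<^bsub>A\<^esub>" "\<one>\<^bsub>B\<^esub>"] by simp
    show "P (R #>\<^bsub>F\<^esub> frag_of x)" if "x \<in> carrier A \<times> carrier B" for x
      using that pure unfolding pure_tensor_def by auto
    show "P (R #>\<^bsub>F\<^esub> (x - y))" if "Poly_Mapping.keys x \<subseteq> carrier A \<times> carrier B"
      "Poly_Mapping.keys y \<subseteq> carrier A \<times> carrier B" "P (R #>\<^bsub>F\<^esub> x)" "P (R #>\<^bsub>F\<^esub> y)" for x y
    proof -
      have "R #>\<^bsub>F\<^esub> (x - y) = (R #>\<^bsub>F\<^esub> x) \<otimes>\<^bsub>tensor A B\<^esub> inv\<^bsub>tensor A B\<^esub> (R #>\<^bsub>F\<^esub> y)"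
        using group_hom.hom_mult[OF gh, of x "- y"] group_hom.hom_inv[OF gh, of y] that by simp
      then show ?thesis using diff[OF tensor_carrierI tensor_carrierI] that by simp
    qed
  qed
  then show ?thesis using c by simp
qed

lemma hom_tensor_cong:
  assumes "group G" "\<phi> \<in> hom (tensor A B) G" "\<psi> \<in> hom (tensor A B) G"
    and eq: "\<And>a b. a \<in> carrier A \<Longrightarrow> b \<in> carrier B \<Longrightarrow> \<phi> (pure_tensor A B a b) = \<psi> (pure_tensor A B a b)"
    and "t \<in> carrier (tensor A B)"
  shows "\<phi> t = \<psi> t"
proof -
  interpret T: comm_group "tensor A B" by (rule comm_group_tensor)
  have g: "group_hom (tensor A B) G \<phi>" "group_hom (tensor A B) G \<psi>"
    using assms by (simp_all add: group_hom_def group_hom_axioms_def)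
  show ?thesis using assms(5)
  proof (induction rule: tensor_induct)
    case (pure a b) then show ?case by (rule eq)
  next
    case (diff s t)
    then show ?case using group_hom.hom_mult[OF g(1)] group_hom.hom_mult[OF g(2)]
        group_hom.hom_inv[OF g(1)] group_hom.hom_inv[OF g(2)] by simp
  qed
qed

text \<open>The bilinear map extends to the free abelian group, where it kills the defining relations. The value on a
coset is read off any of its elements.\<close>

lemma tensor_universal:
  assumes "comm_group D" "bilinear_on A B D \<beta>"
  obtains \<phi> where "\<phi> \<in> hom (tensor A B) D"
    "\<And>a b. a \<in> carrier A \<Longrightarrow> b \<in> carrier B \<Longrightarrow> \<phi> (pure_tensor A B a b) = \<beta> a b"
proof -
  interpret D: comm_group D by fact
  have \<beta>: "\<And>a b. a \<in> carrier A \<Longrightarrow> b \<in> carrier B \<Longrightarrow> \<beta> a b \<in> carrier D"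
    "\<And>a a' b. a \<in> carrier A \<Longrightarrow> a' \<in> carrier A \<Longrightarrow> b \<in> carrier B \<Longrightarrow> \<beta> (a \<otimes>\<^bsub>A\<^esub> a') b = \<beta> a b \<otimes>\<^bsub>D\<^esub> \<beta> a' b"
    "\<And>a b b'. a \<in> carrier A \<Longrightarrow> b \<in> carrier B \<Longrightarrow> b' \<in> carrier B \<Longrightarrow> \<beta> a (b \<otimes>\<^bsub>B\<^esub> b') = \<beta> a b \<otimes>\<^bsub>D\<^esub> \<beta> a b'"
    using assms(2) by (simp_all add: bilinear_on_def)
  obtain h where h: "h \<in> hom F D" "\<And>x. x \<in> carrier A \<times> carrier B \<Longrightarrow> h (frag_of x) = (case x of (a, b) \<Rightarrow> \<beta> a b)"
    by (rule D.free_Abelian_group_universal[of "\<lambda>(a, b). \<beta> a b" "carrier A \<times> carrier B"]) (use \<beta>(1) in auto)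
  have gh: "group_hom F D h" using h by (simp add: group_hom_def group_hom_axioms_def)
  have hc: "h c \<in> carrier D" if "c \<in> carrier F" for c using hom_in_carrier[OF h(1) that] .
  have hadd: "h (c + d) = h c \<otimes>\<^bsub>D\<^esub> h d" if "c \<in> carrier F" "d \<in> carrier F" for c d
    using group_hom.hom_mult[OF gh that] by simp
  have hneg: "h (- c) = inv\<^bsub>D\<^esub> h c" if "c \<in> carrier F" for c
    using group_hom.hom_inv[OF gh that] that by simp
  have hdiff: "h (c - d) = h c \<otimes>\<^bsub>D\<^esub> inv\<^bsub>D\<^esub> h d" if "c \<in> carrier F" "d \<in> carrier F" for c d
    using hadd[of c "- d"] hneg[of d] that by simp
  have kd: "c - d \<in> carrier F" if "c \<in> carrier F" "d \<in> carrier F" for c d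
    using that keys_diff[of c d] by auto
  have rel: "h c = \<one>\<^bsub>D\<^esub>" if "c \<in> R" for c
    using that
  proof (rule tensor_rels_induct)
    show "h 0 = \<one>\<^bsub>D\<^esub>" using group_hom.hom_one[OF gh] by simp
    show "h (- c) = \<one>\<^bsub>D\<^esub>" if "c \<in> carrier F" "h c = \<one>\<^bsub>D\<^esub>" for c using that hneg by simp
    show "h (c + d) = \<one>\<^bsub>D\<^esub>" if "c \<in> carrier F" "d \<in> carrier F" "h c = \<one>\<^bsub>D\<^esub>" "h d = \<one>\<^bsub>D\<^esub>" for c d
      using that hadd by simp
  next
    fix a a' b assume q: "a \<in> carrier A" "a' \<in> carrier A" "b \<in> carrier B"
    have c: "frag_of (a \<otimes>\<^bsub>A\<^esub> a', b) \<in> carrier F" "frag_of (a, b) \<in> carrier F" "frag_of (a', b) \<in> carrier F"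
      using q by simp_all
    show "h (frag_of (a \<otimes>\<^bsub>A\<^esub> a', b) - frag_of (a, b) - frag_of (a', b)) = \<one>\<^bsub>D\<^esub>"
      using q \<beta> by (subst hdiff[OF kd[OF c(1,2)] c(3)], subst hdiff[OF c(1,2)])
        (simp add: h(2) D.m_ac)
  next
    fix a b b' assume q: "a \<in> carrier A" "b \<in> carrier B" "b' \<in> carrier B"
    have c: "frag_of (a, b \<otimes>\<^bsub>B\<^esub> b') \<in> carrier F" "frag_of (a, b) \<in> carrier F" "frag_of (a, b') \<in> carrier F"
      using q by simp_all
    show "h (frag_of (a, b \<otimes>\<^bsub>B\<^esub> b') - frag_of (a, b) - frag_of (a, b')) = \<one>\<^bsub>D\<^esub>"
      using q \<beta> by (subst hdiff[OF kd[OF c(1,2)] c(3)], subst hdiff[OF c(1,2)])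
        (simp add: h(2) D.m_ac)
  qed
  define \<phi> where "\<phi> C = h (SOME c. c \<in> C)" for C
  have \<phi>: "\<phi> (R #>\<^bsub>F\<^esub> c) = h c" if c: "c \<in> carrier F" for c
  proof -
    have "c \<in> R #>\<^bsub>F\<^esub> c" using group.rcos_self[OF group_free_Abelian_group c tensor_rels_subgroup] .
    then have "(SOME d. d \<in> R #>\<^bsub>F\<^esub> c) \<in> R #>\<^bsub>F\<^esub> c" by (rule someI)
    then have "(SOME d. d \<in> R #>\<^bsub>F\<^esub> c) - c \<in> R" (is "?d - c \<in> R") using tensor_coset_mem[OF c] by blast
    moreover from this have "?d - c \<in> carrier F" using subgroup.mem_carrier[OF tensor_rels_subgroup] by blast
    ultimately have "h ?d = h c" using hadd[of "?d - c" c] rel[of "?d - c"] c hc[OF c] by simp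
    then show ?thesis by (simp add: \<phi>_def)
  qed
  show thesis
  proof (rule that[of \<phi>])
    show "\<phi> \<in> hom (tensor A B) D"
    proof (rule homI)
      fix s t assume "s \<in> carrier (tensor A B)" "t \<in> carrier (tensor A B)"
      then obtain c d where cd: "c \<in> carrier F" "s = R #>\<^bsub>F\<^esub> c" "d \<in> carrier F" "t = R #>\<^bsub>F\<^esub> d"
        using tensor_carrierE[of s] tensor_carrierE[of t] by metis
      moreover have "c + d \<in> carrier F" using cd keys_add[of c d] by auto
      ultimately show "\<phi> (s \<otimes>\<^bsub>tensor A B\<^esub> t) = \<phi> s \<otimes>\<^bsub>D\<^esub> \<phi> t" using tensor_mult \<phi> hadd by simp
    next
      fix s assume "s \<in> carrier (tensor A B)"
      then obtain c where "c \<in> carrier F" "s = R #>\<^bsub>F\<^esub> c" by (rule tensor_carrierE)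
      then show "\<phi> s \<in> carrier D" using \<phi> hc by simp
    qed
    show "\<phi> (pure_tensor A B a b) = \<beta> a b" if "a \<in> carrier A" "b \<in> carrier B" for a b
      unfolding pure_tensor_def using \<phi>[of "frag_of (a, b)"] h(2)[of "(a, b)"] that by simp
  qed
qed

lemma bilinear_on_hom:
  assumes "\<phi> \<in> hom (tensor A B) D"
  shows "bilinear_on A B D (\<lambda>a b. \<phi> (pure_tensor A B a b))"
proof -
  have "\<phi> (s \<otimes>\<^bsub>tensor A B\<^esub> t) = \<phi> s \<otimes>\<^bsub>D\<^esub> \<phi> t" if "s \<in> carrier (tensor A B)" "t \<in> carrier (tensor A B)" for s t
    using hom_mult[OF assms that] .
  then show ?thesis using bilinear_pure_tensor hom_in_carrier[OF assms] unfolding bilinear_on_def by simp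
qed

end

lemma frag_map_fst_closed:
  assumes "\<And>a. a \<in> A \<Longrightarrow> f a \<in> A'" "c \<in> carrier (free_Abelian_group (A \<times> B))"
  shows "frag_extend (\<lambda>(a, b). frag_of (f a, b)) c \<in> carrier (free_Abelian_group (A' \<times> B))"
proof -
  have "Poly_Mapping.keys (frag_extend (\<lambda>(a, b). frag_of (f a, b)) c)
      \<subseteq> (\<Union>x\<in>Poly_Mapping.keys c. Poly_Mapping.keys (case x of (a, b) \<Rightarrow> frag_of (f a, b)))"
    by (rule keys_frag_extend)
  also have "\<dots> \<subseteq> A' \<times> B" using assms by (auto split: prod.splits)
  finally show ?thesis by simp
qed

text \<open>The relations of \<open>A\<close> and \<open>B\<close> go to those of \<open>A'\<close> and \<open>B\<close>, so all elements of a coset have images in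
one and the same coset, and the union in the definition of \<open>tensor_map\<close> is that coset.\<close>

lemma tensor_map_coset:
  assumes "comm_group A" "comm_group A'" "comm_group B" "f \<in> hom A A'"
    and c: "c \<in> carrier (free_Abelian_group (carrier A \<times> carrier B))"
  shows "tensor_map A' B f (tensor_rels A B #>\<^bsub>free_Abelian_group (carrier A \<times> carrier B)\<^esub> c) =
    tensor_rels A' B #>\<^bsub>free_Abelian_group (carrier A' \<times> carrier B)\<^esub> frag_extend (\<lambda>(a, b). frag_of (f a, b)) c"
    (is "?L = tensor_rels A' B #>\<^bsub>?F'\<^esub> ?f c")
proof -
  interpret S: tensor_factors A B using assms by (simp add: tensor_factors_def)
  interpret S': tensor_factors A' B using assms by (simp add: tensor_factors_def)
  have fc: "f a \<in> carrier A'" if "a \<in> carrier A" for a using hom_in_carrier[OF assms(4) that] .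
  have fm: "f (a \<otimes>\<^bsub>A\<^esub> a') = f a \<otimes>\<^bsub>A'\<^esub> f a'" if "a \<in> carrier A" "a' \<in> carrier A" for a a'
    using hom_mult[OF assms(4) that] .
  have fF: "?f d \<in> carrier S'.F" if "d \<in> carrier S.F" for d
    by (rule frag_map_fst_closed[OF fc that])
  have rel: "?f d \<in> S'.R" if "d \<in> S.R" for d
    using that
  proof (rule S.tensor_rels_induct)
    show "?f 0 \<in> S'.R" using subgroup.one_closed[OF S'.tensor_rels_subgroup] by simp
    show "?f (- d) \<in> S'.R" if "d \<in> carrier S.F" "?f d \<in> S'.R" for d
      using subgroup.m_inv_closed[OF S'.tensor_rels_subgroup that(2)] fF[OF that(1)] by (simp add: frag_extend_minus)
    show "?f (d + e) \<in> S'.R" if "?f d \<in> S'.R" "?f e \<in> S'.R" for d e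
      using subgroup.m_closed[OF S'.tensor_rels_subgroup that] by (simp add: frag_extend_add)
  next
    fix a a' b assume "a \<in> carrier A" "a' \<in> carrier A" "b \<in> carrier B"
    then show "?f (frag_of (a \<otimes>\<^bsub>A\<^esub> a', b) - frag_of (a, b) - frag_of (a', b)) \<in> S'.R"
      using S'.tensor_rels_add_left[of "f a" "f a'" b] fc fm by (simp add: frag_extend_diff)
  next
    fix a b b' assume "a \<in> carrier A" "b \<in> carrier B" "b' \<in> carrier B"
    then show "?f (frag_of (a, b \<otimes>\<^bsub>B\<^esub> b') - frag_of (a, b) - frag_of (a, b')) \<in> S'.R"
      using S'.tensor_rels_add_right[of "f a" b b'] fc by (simp add: frag_extend_diff)
  qed
  have "S'.R #>\<^bsub>S'.F\<^esub> ?f d = S'.R #>\<^bsub>S'.F\<^esub> ?f c" if "d \<in> S.R #>\<^bsub>S.F\<^esub> c" for d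
  proof -
    have dc: "d - c \<in> S.R" using that S.tensor_coset_mem[OF c] by blast
    then have "d - c \<in> carrier S.F" using subgroup.mem_carrier[OF S.tensor_rels_subgroup] by blast
    then have "d \<in> carrier S.F" using c keys_add[of "d - c" c] by auto
    then show ?thesis using S'.tensor_coset_eqI[OF fF fF[OF c]] rel[OF dc] by (simp add: frag_extend_diff)
  qed
  moreover have "c \<in> S.R #>\<^bsub>S.F\<^esub> c"
    using group.rcos_self[OF group_free_Abelian_group c S.tensor_rels_subgroup] .
  ultimately show ?thesis unfolding tensor_map_def by blast
qed

lemma tensor_map_hom:
  assumes "comm_group A" "comm_group A'" "comm_group B" "f \<in> hom A A'"
  shows "tensor_map A' B f \<in> hom (tensor A B) (tensor A' B)"
proof (rule homI)
  interpret S: tensor_factors A B using assms by (simp add: tensor_factors_def)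
  interpret S': tensor_factors A' B using assms by (simp add: tensor_factors_def)
  have fc: "f a \<in> carrier A'" if "a \<in> carrier A" for a using hom_in_carrier[OF assms(4) that] .
  have fF: "frag_extend (\<lambda>(a, b). frag_of (f a, b)) d \<in> carrier S'.F" if "d \<in> carrier S.F" for d
    by (rule frag_map_fst_closed[OF fc that])
  fix s t assume s: "s \<in> carrier (tensor A B)"
  obtain c where c: "c \<in> carrier S.F" "s = S.R #>\<^bsub>S.F\<^esub> c" using s by (rule S.tensor_carrierE)
  show "tensor_map A' B f s \<in> carrier (tensor A' B)"
    using tensor_map_coset[OF assms c(1)] fF[OF c(1)] S'.tensor_carrierI c(2) by simp
  assume t: "t \<in> carrier (tensor A B)"
  obtain d where d: "d \<in> carrier S.F" "t = S.R #>\<^bsub>S.F\<^esub> d" using t by (rule S.tensor_carrierE)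
  have "c + d \<in> carrier S.F" using c d keys_add[of c d] by auto
  then show "tensor_map A' B f (s \<otimes>\<^bsub>tensor A B\<^esub> t) = tensor_map A' B f s \<otimes>\<^bsub>tensor A' B\<^esub> tensor_map A' B f t"
    using tensor_map_coset[OF assms] S.tensor_mult S'.tensor_mult[OF fF fF] c d by (simp add: frag_extend_add)
qed

lemma tensor_map_pure:
  assumes "comm_group A" "comm_group A'" "comm_group B" "f \<in> hom A A'" "a \<in> carrier A" "b \<in> carrier B"
  shows "tensor_map A' B f (pure_tensor A B a b) = pure_tensor A' B (f a) b"
  unfolding pure_tensor_def using tensor_map_coset[OF assms(1-4), of "frag_of (a, b)"] assms(5,6) by simp

section \<open>Flatness of torsion-free groups\<close>

definition torsion_free :: "('a, 'm) monoid_scheme \<Rightarrow> bool"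
  where "torsion_free B \<longleftrightarrow> (\<forall>b\<in>carrier B. \<forall>n::nat. 0 < n \<longrightarrow> b [^]\<^bsub>B\<^esub> n = \<one>\<^bsub>B\<^esub> \<longrightarrow> b = \<one>\<^bsub>B\<^esub>)"

definition hom_group :: "('b, 's) monoid_scheme \<Rightarrow> ('d, 't) monoid_scheme \<Rightarrow> ('b \<Rightarrow> 'd) monoid"
  where "hom_group B D = \<lparr>carrier = hom B D \<inter> extensional (carrier B),
    monoid.mult = (\<lambda>g h. \<lambda>b\<in>carrier B. g b \<otimes>\<^bsub>D\<^esub> h b), one = (\<lambda>b\<in>carrier B. \<one>\<^bsub>D\<^esub>)\<rparr>"

lemma hom_group_memI:
  assumes "group B" "\<And>b. b \<in> carrier B \<Longrightarrow> g b \<in> carrier D"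
    "\<And>b c. b \<in> carrier B \<Longrightarrow> c \<in> carrier B \<Longrightarrow> g (b \<otimes>\<^bsub>B\<^esub> c) = g b \<otimes>\<^bsub>D\<^esub> g c"
  shows "restrict g (carrier B) \<in> carrier (hom_group B D)"
  using assms monoid.m_closed[OF group.is_monoid[OF assms(1)]] by (auto simp: hom_group_def hom_def)

lemma comm_group_hom_group:
  assumes "comm_group B" "comm_group D"
  shows "comm_group (hom_group B D)"
proof -
  interpret B: comm_group B by fact
  interpret D: comm_group D by fact
  have m: "g b \<in> carrier D" "b \<in> carrier B \<Longrightarrow> c \<in> carrier B \<Longrightarrow> g (b \<otimes>\<^bsub>B\<^esub> c) = g b \<otimes>\<^bsub>D\<^esub> g c"
    if "g \<in> carrier (hom_group B D)" "b \<in> carrier B" for g b c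
    using that by (auto simp: hom_group_def hom_def)
  have ext: "g = h" if "g \<in> carrier (hom_group B D)" "h \<in> carrier (hom_group B D)" "\<And>b. b \<in> carrier B \<Longrightarrow> g b = h b" for g h
    using that by (auto simp: hom_group_def intro: extensionalityI)
  have mult: "(g \<otimes>\<^bsub>hom_group B D\<^esub> h) b = g b \<otimes>\<^bsub>D\<^esub> h b" if "b \<in> carrier B" for g h b
    using that by (simp add: hom_group_def)
  have closed: "g \<otimes>\<^bsub>hom_group B D\<^esub> h \<in> carrier (hom_group B D)"
    if gh: "g \<in> carrier (hom_group B D)" "h \<in> carrier (hom_group B D)" for g h
  proof -
    have "restrict (\<lambda>b. g b \<otimes>\<^bsub>D\<^esub> h b) (carrier B) \<in> carrier (hom_group B D)"
      by (rule hom_group_memI[OF B.is_group]) (simp_all add: m[OF gh(1)] m[OF gh(2)] D.m_ac)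
    then show ?thesis by (simp add: hom_group_def)
  qed
  have one: "\<one>\<^bsub>hom_group B D\<^esub> \<in> carrier (hom_group B D)"
    using hom_group_memI[OF B.is_group, of "\<lambda>_. \<one>\<^bsub>D\<^esub>" D] by (simp add: hom_group_def)
  show ?thesis
  proof (rule comm_groupI)
    fix g assume g: "g \<in> carrier (hom_group B D)"
    have c: "restrict (\<lambda>b. inv\<^bsub>D\<^esub> g b) (carrier B) \<in> carrier (hom_group B D)"
      by (rule hom_group_memI[OF B.is_group]) (simp_all add: m[OF g] D.inv_mult)
    have "restrict (\<lambda>b. inv\<^bsub>D\<^esub> g b) (carrier B) \<otimes>\<^bsub>hom_group B D\<^esub> g = \<one>\<^bsub>hom_group B D\<^esub>"
      by (rule ext[OF closed[OF c g] one]) (use m[OF g] in \<open>simp add: hom_group_def\<close>)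
    then show "\<exists>h\<in>carrier (hom_group B D). h \<otimes>\<^bsub>hom_group B D\<^esub> g = \<one>\<^bsub>hom_group B D\<^esub>" using c by blast
    show "\<one>\<^bsub>hom_group B D\<^esub> \<otimes>\<^bsub>hom_group B D\<^esub> g = g"
      by (rule ext[OF closed[OF one g] g]) (use m[OF g] in \<open>simp add: hom_group_def\<close>)
  next
    fix g h assume gh: "g \<in> carrier (hom_group B D)" "h \<in> carrier (hom_group B D)"
    show "g \<otimes>\<^bsub>hom_group B D\<^esub> h \<in> carrier (hom_group B D)" by (rule closed[OF gh])
    show "g \<otimes>\<^bsub>hom_group B D\<^esub> h = h \<otimes>\<^bsub>hom_group B D\<^esub> g"
      by (rule ext[OF closed[OF gh] closed[OF gh(2,1)]]) (simp add: mult m(1)[OF gh(1)] m(1)[OF gh(2)] D.m_comm)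
    fix k assume k: "k \<in> carrier (hom_group B D)"
    show "g \<otimes>\<^bsub>hom_group B D\<^esub> h \<otimes>\<^bsub>hom_group B D\<^esub> k = g \<otimes>\<^bsub>hom_group B D\<^esub> (h \<otimes>\<^bsub>hom_group B D\<^esub> k)"
      by (rule ext[OF closed[OF closed[OF gh] k] closed[OF gh(1) closed[OF gh(2) k]]])
        (simp add: mult m(1)[OF gh(1)] m(1)[OF gh(2)] m(1)[OF k] D.m_assoc)
  qed (rule one)
qed

lemma hom_group_pow_apply:
  assumes "comm_group B" "comm_group D" "b \<in> carrier B"
  shows "(g [^]\<^bsub>hom_group B D\<^esub> (n::nat)) b = g b [^]\<^bsub>D\<^esub> n"
proof (induction n)
  case 0 show ?case by (simp only: nat_pow_0) (simp add: hom_group_def assms(3))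
next
  case (Suc n)
  have "(g [^]\<^bsub>hom_group B D\<^esub> Suc n) b = (g [^]\<^bsub>hom_group B D\<^esub> n) b \<otimes>\<^bsub>D\<^esub> g b"
    by (simp only: nat_pow_Suc) (simp add: hom_group_def assms(3))
  then show ?case by (simp only: Suc nat_pow_Suc)
qed

text \<open>An \<open>n\<close>-th root of \<open>g\<close> is a homomorphism that maps the \<open>n\<close>-th power of \<open>b\<close> to \<open>g b\<close>. On the group of
\<open>n\<close>-th powers this is well defined, as \<open>B\<close> has no torsion, and it extends to \<open>B\<close> because \<open>D\<close> is
divisible.\<close>

lemma divisible_hom_group:
  assumes "comm_group B" "torsion_free B" "divisible_group D"
  shows "divisible_group (hom_group B D)"
proof -
  have cD: "comm_group D" using assms(3) by (simp add: divisible_group_def)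
  interpret B: comm_group B by fact
  interpret D: comm_group D by fact
  show ?thesis unfolding divisible_group_def
  proof (intro conjI ballI allI impI)
    show "comm_group (hom_group B D)" by (rule comm_group_hom_group[OF assms(1) cD])
    fix g and n :: nat assume g: "g \<in> carrier (hom_group B D)" and n: "0 < n"
    have gh: "g \<in> hom B D" using g by (simp add: hom_group_def)
    define H where "H = (\<lambda>b. b [^]\<^bsub>B\<^esub> n) ` carrier B"
    have inj: "b = c" if "b \<in> carrier B" "c \<in> carrier B" "b [^]\<^bsub>B\<^esub> n = c [^]\<^bsub>B\<^esub> n" for b c
    proof -
      have "(b \<otimes>\<^bsub>B\<^esub> inv\<^bsub>B\<^esub> c) [^]\<^bsub>B\<^esub> n = \<one>\<^bsub>B\<^esub>"
        using that by (simp add: B.nat_pow_distrib B.nat_pow_inv)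
      then have "b \<otimes>\<^bsub>B\<^esub> inv\<^bsub>B\<^esub> c = \<one>\<^bsub>B\<^esub>"
        using assms(2) n that unfolding torsion_free_def by blast
      then have "b = inv\<^bsub>B\<^esub> (inv\<^bsub>B\<^esub> c)" using B.inv_equality[of b "inv\<^bsub>B\<^esub> c"] that by simp
      then show ?thesis using that by simp
    qed
    define f where "f = g \<circ> inv_into (carrier B) (\<lambda>b. b [^]\<^bsub>B\<^esub> n)"
    have f: "f (b [^]\<^bsub>B\<^esub> n) = g b" if "b \<in> carrier B" for b
      unfolding f_def comp_def using inv_into_f_f[of "\<lambda>b. b [^]\<^bsub>B\<^esub> n" "carrier B" b] inj that by (simp add: inj_on_def)
    have "subgroup H B"
    proof (rule B.subgroupI)
      show "H \<subseteq> carrier B" "H \<noteq> {}" unfolding H_def using B.one_closed by auto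
      show "inv\<^bsub>B\<^esub> a \<in> H" if "a \<in> H" for a
      proof -
        obtain b where b: "b \<in> carrier B" "a = b [^]\<^bsub>B\<^esub> n" using \<open>a \<in> H\<close> unfolding H_def by blast
        then have "inv\<^bsub>B\<^esub> a = (inv\<^bsub>B\<^esub> b) [^]\<^bsub>B\<^esub> n" by (simp add: B.nat_pow_inv)
        then show ?thesis unfolding H_def using b(1) by blast
      qed
      show "a \<otimes>\<^bsub>B\<^esub> c \<in> H" if a: "a \<in> H" "c \<in> H" for a c
      proof -
        obtain b d where b: "b \<in> carrier B" "a = b [^]\<^bsub>B\<^esub> n" "d \<in> carrier B" "c = d [^]\<^bsub>B\<^esub> n" using a unfolding H_def by blast
        then have "a \<otimes>\<^bsub>B\<^esub> c = (b \<otimes>\<^bsub>B\<^esub> d) [^]\<^bsub>B\<^esub> n" by (simp add: B.nat_pow_distrib)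
        then show ?thesis unfolding H_def using b by blast
      qed
    qed
    moreover have "f \<in> hom (B\<lparr>carrier := H\<rparr>) D"
    proof (rule homI)
      show "f a \<in> carrier D" if "a \<in> carrier (B\<lparr>carrier := H\<rparr>)" for a
        using that f hom_in_carrier[OF gh] unfolding H_def by auto
      fix a c assume "a \<in> carrier (B\<lparr>carrier := H\<rparr>)" "c \<in> carrier (B\<lparr>carrier := H\<rparr>)"
      then obtain b d where b: "b \<in> carrier B" "a = b [^]\<^bsub>B\<^esub> n" "d \<in> carrier B" "c = d [^]\<^bsub>B\<^esub> n" unfolding H_def by auto
      then have "a \<otimes>\<^bsub>B\<^esub> c = (b \<otimes>\<^bsub>B\<^esub> d) [^]\<^bsub>B\<^esub> n" by (simp add: B.nat_pow_distrib)
      then show "f (a \<otimes>\<^bsub>B\<lparr>carrier := H\<rparr>\<^esub> c) = f a \<otimes>\<^bsub>D\<^esub> f c"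
        using b f[of "b \<otimes>\<^bsub>B\<^esub> d"] f[of b] f[of d] hom_mult[OF gh, of b d] by simp
    qed
    ultimately obtain h where h: "h \<in> hom B D" "\<And>x. x \<in> H \<Longrightarrow> h x = f x"
      using hom_extends_to_divisible[OF assms(1,3)] by blast
    define e where "e = restrict h (carrier B)"
    have e: "e \<in> carrier (hom_group B D)" unfolding e_def
      by (rule hom_group_memI[OF B.is_group]) (use hom_in_carrier[OF h(1)] hom_mult[OF h(1)] in auto)
    have "e [^]\<^bsub>hom_group B D\<^esub> n = g"
    proof (rule extensionalityI[of _ "carrier B"])
      have "monoid (hom_group B D)" using comm_group_hom_group[OF assms(1) cD] by (simp add: comm_group_def comm_monoid_def)
      then show "e [^]\<^bsub>hom_group B D\<^esub> n \<in> extensional (carrier B)"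
        using monoid.nat_pow_closed[of "hom_group B D" e n] e by (simp add: hom_group_def)
      show "g \<in> extensional (carrier B)" using g by (simp add: hom_group_def)
      fix b assume b: "b \<in> carrier B"
      have gh': "group_hom B D h" using h(1) by (simp add: group_hom_def group_hom_axioms_def)
      have "(e [^]\<^bsub>hom_group B D\<^esub> n) b = h b [^]\<^bsub>D\<^esub> n"
        using hom_group_pow_apply[OF assms(1) cD b] b by (simp add: e_def)
      also have "\<dots> = h (b [^]\<^bsub>B\<^esub> n)" using group_hom.hom_nat_pow[OF gh' b] by simp
      also have "\<dots> = g b" using h(2)[of "b [^]\<^bsub>B\<^esub> n"] f[OF b] b by (simp add: H_def)
      finally show "(e [^]\<^bsub>hom_group B D\<^esub> n) b = g b" .
    qed
    then show "\<exists>e\<in>carrier (hom_group B D). e [^]\<^bsub>hom_group B D\<^esub> n = g" using e by blast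
  qed
qed

text \<open>A bilinear map is a homomorphism from its first factor to \<open>hom_group B D\<close>, which is divisible.\<close>

lemma bilinear_extends:
  assumes "comm_group N" "comm_group B" "torsion_free B" "divisible_group D" "subgroup H N"
    and \<beta>: "bilinear_on (N\<lparr>carrier := H\<rparr>) B D \<beta>"
  obtains \<gamma> where "bilinear_on N B D \<gamma>" "\<And>a b. a \<in> H \<Longrightarrow> b \<in> carrier B \<Longrightarrow> \<gamma> a b = \<beta> a b"
proof -
  interpret B: comm_group B by fact
  have "(\<lambda>a. \<lambda>b\<in>carrier B. \<beta> a b) \<in> hom (N\<lparr>carrier := H\<rparr>) (hom_group B D)"
  proof (rule homI)
    show "(\<lambda>b\<in>carrier B. \<beta> a b) \<in> carrier (hom_group B D)" if "a \<in> carrier (N\<lparr>carrier := H\<rparr>)" for a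
      by (rule hom_group_memI[OF B.is_group]) (use that \<beta> in \<open>auto simp: bilinear_on_def\<close>)
    show "(\<lambda>b\<in>carrier B. \<beta> (a \<otimes>\<^bsub>N\<lparr>carrier := H\<rparr>\<^esub> a') b) =
        (\<lambda>b\<in>carrier B. \<beta> a b) \<otimes>\<^bsub>hom_group B D\<^esub> (\<lambda>b\<in>carrier B. \<beta> a' b)"
      if "a \<in> carrier (N\<lparr>carrier := H\<rparr>)" "a' \<in> carrier (N\<lparr>carrier := H\<rparr>)" for a a'
      using that \<beta> by (auto simp: bilinear_on_def hom_group_def intro!: restrict_ext)
  qed
  then obtain h where h: "h \<in> hom N (hom_group B D)" "\<And>a. a \<in> H \<Longrightarrow> h a = (\<lambda>b\<in>carrier B. \<beta> a b)"
    using hom_extends_to_divisible[OF assms(1) divisible_hom_group[OF assms(2-4)] assms(5)] by blast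
  have hc: "h a \<in> hom B D" if "a \<in> carrier N" for a
    using hom_in_carrier[OF h(1) that] by (simp add: hom_group_def)
  have "bilinear_on N B D h" unfolding bilinear_on_def
    using hom_in_carrier[OF hc] hom_mult[OF hc] hom_mult[OF h(1)] by (simp add: hom_group_def)
  moreover have "h a b = \<beta> a b" if "a \<in> H" "b \<in> carrier B" for a b using h(2) that by simp
  ultimately show thesis by (rule that)
qed

lemma bilinear_extends_along_inclusion:
  assumes "comm_group N" "comm_group B" "torsion_free B" "divisible_group D" "subgroup H N"
    and \<beta>: "bilinear_on (N\<lparr>carrier := H\<rparr>) B D \<beta>"
  obtains \<phi> where "\<phi> \<in> hom (tensor N B) D"
    "\<And>a b. a \<in> H \<Longrightarrow> b \<in> carrier B \<Longrightarrow> \<phi> (pure_tensor N B a b) = \<beta> a b"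
proof -
  interpret tensor_factors N B using assms by (simp add: tensor_factors_def)
  obtain \<gamma> where \<gamma>: "bilinear_on N B D \<gamma>" "\<And>a b. a \<in> H \<Longrightarrow> b \<in> carrier B \<Longrightarrow> \<gamma> a b = \<beta> a b"
    by (rule bilinear_extends[OF assms], rule that)
  have "comm_group D" using assms(4) by (simp add: divisible_group_def)
  then obtain \<phi> where "\<phi> \<in> hom (tensor N B) D"
    "\<And>a b. a \<in> carrier N \<Longrightarrow> b \<in> carrier B \<Longrightarrow> \<phi> (pure_tensor N B a b) = \<gamma> a b"
    using tensor_universal[OF _ \<gamma>(1)] by blast
  then show thesis using that \<gamma>(2) subgroup.mem_carrier[OF assms(5)] by simp
qed

text \<open>The tensor product with a torsion-free group commutes with kernels. A nonzero element of the tensor product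
of the kernel with \<open>B\<close> is seen by a character, which extends to the tensor product of \<open>N\<close> with \<open>B\<close>; so
the map is injective. If an element \<open>t\<close> is not in its image, some character is trivial on the image but not
at \<open>t\<close>. As a bilinear map it only depends on the value of \<open>f\<close> at the first argument, hence it is a
bilinear map on the image of \<open>f\<close>, which extends to \<open>N\<close> and shows that \<open>f\<close> does not kill \<open>t\<close>.\<close>

lemma tensor_kernel_torsion_free:
  assumes N: "comm_group N" and B: "comm_group B" "torsion_free B" and f: "f \<in> hom N N"
  shows "bij_betw (tensor_map N B (\<lambda>x. x)) (carrier (tensor (N\<lparr>carrier := kernel N N f\<rparr>) B))
    {t \<in> carrier (tensor N B). tensor_map N B f t = \<one>\<^bsub>tensor N B\<^esub>}"
proof -
  define A where "A = N\<lparr>carrier := kernel N N f\<rparr>"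
  interpret N: comm_group N by fact
  interpret B: comm_group B by fact
  interpret f: group_hom N N f using f by (simp add: group_hom_def group_hom_axioms_def)
  have kerN: "subgroup (kernel N N f) N" by (rule f.subgroup_kernel)
  have A: "comm_group A" unfolding A_def 
    using group.group_comm_groupI[OF N.subgroup_imp_group[OF kerN]] subgroup.mem_carrier[OF kerN] N.m_comm by simp
  interpret TA: tensor_factors A B using A B by (simp add: tensor_factors_def)
  interpret TN: tensor_factors N B using N B by (simp add: tensor_factors_def)
  interpret GA: comm_group "tensor A B" by (rule TA.comm_group_tensor)
  interpret GN: comm_group "tensor N B" by (rule TN.comm_group_tensor)
  note div = divisible_circle_group and S1 = comm_group_circle_group
  have S1g: "group circle_group" using S1 by (simp add: comm_group_def)
  define \<iota> where "\<iota> = tensor_map N B (\<lambda>x. x)"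
  define F where "F = tensor_map N B f"
  have incl: "(\<lambda>x. x) \<in> hom A N" using subgroup.mem_carrier[OF kerN] by (auto simp: A_def hom_def)
  have \<iota>h: "\<iota> \<in> hom (tensor A B) (tensor N B)" unfolding \<iota>_def by (rule tensor_map_hom[OF A N B(1) incl])
  have \<iota>p: "\<iota> (pure_tensor A B a b) = pure_tensor N B a b" if "a \<in> carrier A" "b \<in> carrier B" for a b
    unfolding \<iota>_def by (rule tensor_map_pure[OF A N B(1) incl that])
  have Fh: "F \<in> hom (tensor N B) (tensor N B)" unfolding F_def by (rule tensor_map_hom[OF N N B(1) f])
  have Fp: "F (pure_tensor N B a b) = pure_tensor N B (f a) b" if "a \<in> carrier N" "b \<in> carrier B" for a b
    unfolding F_def by (rule tensor_map_pure[OF N N B(1) f that])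
  interpret \<iota>: group_hom "tensor A B" "tensor N B" \<iota>
    using \<iota>h by (simp add: group_hom_def group_hom_axioms_def)
  interpret F: group_hom "tensor N B" "tensor N B" F
    using Fh by (simp add: group_hom_def group_hom_axioms_def)
  have AN: "a \<in> carrier N" "f a = \<one>\<^bsub>N\<^esub>" if "a \<in> carrier A" for a
    using that by (auto simp: A_def kernel_def)
  have ker: "t = \<one>\<^bsub>tensor A B\<^esub>" if t: "t \<in> carrier (tensor A B)" "\<iota> t = \<one>\<^bsub>tensor N B\<^esub>" for t
  proof (rule ccontr)
    assume "t \<noteq> \<one>\<^bsub>tensor A B\<^esub>"
    then have tn: "t \<notin> {\<one>\<^bsub>tensor A B\<^esub>}" by simp
    obtain \<phi> where \<phi>: "\<phi> \<in> hom (tensor A B) circle_group" "\<phi> t \<noteq> 1"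
      by (rule character_separates_subgroup[OF TA.comm_group_tensor GA.triv_subgroup t(1) tn])
    have "bilinear_on (N\<lparr>carrier := kernel N N f\<rparr>) B circle_group (\<lambda>a b. \<phi> (pure_tensor A B a b))"
      using TA.bilinear_on_hom[OF \<phi>(1)] by (simp add: A_def)
    then obtain \<psi> where \<psi>: "\<psi> \<in> hom (tensor N B) circle_group"
      "\<And>a b. a \<in> kernel N N f \<Longrightarrow> b \<in> carrier B \<Longrightarrow> \<psi> (pure_tensor N B a b) = \<phi> (pure_tensor A B a b)"
      using bilinear_extends_along_inclusion[OF N B div kerN] by blast
    have "(\<lambda>t. \<psi> (\<iota> t)) \<in> hom (tensor A B) circle_group"
      using hom_compose[OF \<iota>h \<psi>(1)] by (simp add: comp_def)
    then have "\<psi> (\<iota> t) = \<phi> t"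
      by (rule TA.hom_tensor_cong[OF S1g _ \<phi>(1) _ t(1)]) (use \<iota>p \<psi>(2) in \<open>simp add: A_def\<close>)
    moreover have "\<psi> (\<iota> t) = 1"
      using group_hom.hom_one[of "tensor N B" circle_group \<psi>] \<psi>(1) S1g t(2)
      by (simp add: group_hom_def group_hom_axioms_def circle_group_def)
    ultimately show False using \<phi>(2) by simp
  qed
  have inj: "inj_on \<iota> (carrier (tensor A B))" unfolding \<iota>.inj_on_one_iff using ker by blast
  have sub1: "F (\<iota> t) = \<one>\<^bsub>tensor N B\<^esub>" if "t \<in> carrier (tensor A B)" for t
    using that
  proof (induction rule: TA.tensor_induct)
    case (pure a b)
    have "pure_tensor N B \<one>\<^bsub>N\<^esub> b \<otimes>\<^bsub>tensor N B\<^esub> pure_tensor N B \<one>\<^bsub>N\<^esub> b = pure_tensor N B \<one>\<^bsub>N\<^esub> b"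
      using TN.bilinear_pure_tensor pure(2) N.l_one[OF N.one_closed] unfolding bilinear_on_def by (metis N.one_closed)
    then have "pure_tensor N B \<one>\<^bsub>N\<^esub> b = \<one>\<^bsub>tensor N B\<^esub>"
      using TN.pure_tensor_closed[OF N.one_closed pure(2)] by simp
    then show ?case using \<iota>p[OF pure] Fp AN pure by simp
  next
    case (diff s t) then show ?case by simp
  qed
  have sub2: "t \<in> \<iota> ` carrier (tensor A B)" if t: "t \<in> carrier (tensor N B)" "F t = \<one>\<^bsub>tensor N B\<^esub>" for t
  proof (rule ccontr)
    assume tn: "t \<notin> \<iota> ` carrier (tensor A B)"
    obtain \<phi> where \<phi>: "\<phi> \<in> hom (tensor N B) circle_group" "\<And>s. s \<in> \<iota> ` carrier (tensor A B) \<Longrightarrow> \<phi> s = 1" "\<phi> t \<noteq> 1"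
      by (rule character_separates_subgroup[OF TN.comm_group_tensor \<iota>.img_is_subgroup t(1) tn], rule that)
    interpret \<phi>: group_hom "tensor N B" circle_group \<phi>
      using \<phi>(1) S1g by (simp add: group_hom_def group_hom_axioms_def)
    define \<beta> where "\<beta> a b = \<phi> (pure_tensor N B a b)" for a b
    have \<beta>: "bilinear_on N B circle_group \<beta>"
      unfolding \<beta>_def using TN.bilinear_on_hom[OF \<phi>(1)] by simp
    have \<beta>ker: "\<beta> a b = 1" if "a \<in> kernel N N f" "b \<in> carrier B" for a b
      using \<phi>(2)[of "pure_tensor N B a b"] \<iota>p[of a b] TA.pure_tensor_closed[of a b] that
      by (metis A_def \<beta>_def image_eqI partial_object.select_convs(1) partial_object.surjective partial_object.update_convs(1))
    have \<beta>eq: "\<beta> a b = \<beta> a' b" if h: "a \<in> carrier N" "a' \<in> carrier N" "b \<in> carrier B" "f a = f a'" for a a' b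
    proof -
      have k: "a \<otimes>\<^bsub>N\<^esub> inv\<^bsub>N\<^esub> a' \<in> kernel N N f" using h by (simp add: kernel_def)
      have "\<beta> ((a \<otimes>\<^bsub>N\<^esub> inv\<^bsub>N\<^esub> a') \<otimes>\<^bsub>N\<^esub> a') b = \<beta> (a \<otimes>\<^bsub>N\<^esub> inv\<^bsub>N\<^esub> a') b \<otimes>\<^bsub>circle_group\<^esub> \<beta> a' b"
        using \<beta> h unfolding bilinear_on_def by blast
      then show ?thesis using \<beta>ker[OF k h(3)] h by (simp add: N.m_assoc circle_group_def)
    qed
    \<comment> \<open>By \<open>\<beta>eq\<close>, the bilinear map \<open>\<beta>\<close> factors through \<open>f\<close>; \<open>\<gamma>\<close> is the map on the image of \<open>f\<close>.\<close>
    define g where "g = inv_into (carrier N) f"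
    have g: "g x \<in> carrier N" "f (g x) = x" if "x \<in> f ` carrier N" for x
      unfolding g_def using that by (simp_all add: inv_into_into f_inv_into_f)
    define \<gamma> where "\<gamma> x b = \<beta> (g x) b" for x b
    have \<gamma>f: "\<gamma> (f a) b = \<beta> a b" if "a \<in> carrier N" "b \<in> carrier B" for a b
      unfolding \<gamma>_def using that g[of "f a"] by (intro \<beta>eq) auto
    have "bilinear_on (N\<lparr>carrier := f ` carrier N\<rparr>) B circle_group \<gamma>"
      unfolding bilinear_on_def
    proof (intro conjI ballI)
      fix x b assume x: "x \<in> carrier (N\<lparr>carrier := f ` carrier N\<rparr>)" and b: "b \<in> carrier B"
      then obtain a where a: "a \<in> carrier N" "x = f a" by auto
      show "\<gamma> x b \<in> carrier circle_group" using \<gamma>f[OF a(1) b] a b \<beta> by (simp add: bilinear_on_def)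
      show "\<gamma> x (b \<otimes>\<^bsub>B\<^esub> b') = \<gamma> x b \<otimes>\<^bsub>circle_group\<^esub> \<gamma> x b'" if "b' \<in> carrier B" for b'
        using \<gamma>f[OF a(1)] a b that \<beta> by (simp add: bilinear_on_def)
    next
      fix x x' b assume x: "x \<in> carrier (N\<lparr>carrier := f ` carrier N\<rparr>)" "x' \<in> carrier (N\<lparr>carrier := f ` carrier N\<rparr>)" and b: "b \<in> carrier B"
      then obtain a a' where a: "a \<in> carrier N" "x = f a" "a' \<in> carrier N" "x' = f a'" by auto
      have "\<gamma> (f (a \<otimes>\<^bsub>N\<^esub> a')) b = \<gamma> (f a) b \<otimes>\<^bsub>circle_group\<^esub> \<gamma> (f a') b"
        using \<gamma>f[of a b] \<gamma>f[of a' b] \<gamma>f[of "a \<otimes>\<^bsub>N\<^esub> a'" b] a b \<beta> by (simp add: bilinear_on_def del: f.hom_mult)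
      then show "\<gamma> (x \<otimes>\<^bsub>N\<lparr>carrier := f ` carrier N\<rparr>\<^esub> x') b = \<gamma> x b \<otimes>\<^bsub>circle_group\<^esub> \<gamma> x' b"
        using a by simp
    qed
    then obtain \<psi> where \<psi>: "\<psi> \<in> hom (tensor N B) circle_group"
      "\<And>x b. x \<in> f ` carrier N \<Longrightarrow> b \<in> carrier B \<Longrightarrow> \<psi> (pure_tensor N B x b) = \<gamma> x b"
      using bilinear_extends_along_inclusion[OF N B div f.img_is_subgroup] by blast
    have "(\<lambda>t. \<psi> (F t)) \<in> hom (tensor N B) circle_group"
      using hom_compose[OF Fh \<psi>(1)] by (simp add: comp_def)
    then have "\<psi> (F t) = \<phi> t"
      by (rule TN.hom_tensor_cong[OF S1g _ \<phi>(1) _ t(1)]) (use Fp \<psi>(2) \<gamma>f in \<open>simp add: \<beta>_def\<close>)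
    moreover have "\<psi> (F t) = 1"
      using group_hom.hom_one[of "tensor N B" circle_group \<psi>] \<psi>(1) S1g t(2)
      by (simp add: group_hom_def group_hom_axioms_def circle_group_def)
    ultimately show False using \<phi>(3) by simp
  qed
  have "\<iota> ` carrier (tensor A B) = {t \<in> carrier (tensor N B). F t = \<one>\<^bsub>tensor N B\<^esub>}"
    using sub1 sub2 \<iota>.hom_closed by blast
  then show ?thesis using inj unfolding bij_betw_def \<iota>_def F_def A_def by blast
qed

section \<open>The additive group of p-adic integers\<close>

lemma padic_int_add_monoid:
  "carrier (add_monoid (padic_int p)) = {x. \<forall>n. x n \<in> {0..<int p ^ n} \<and> x (Suc n) mod int p ^ n = x n}"
  "x \<otimes>\<^bsub>add_monoid (padic_int p)\<^esub> y = (\<lambda>n. (x n + y n) mod int p ^ n)"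
  "\<one>\<^bsub>add_monoid (padic_int p)\<^esub> = (\<lambda>n. 0)"
  by (simp_all add: padic_int_def)

lemma comm_group_padic_int:
  assumes "0 < p" shows "comm_group (add_monoid (padic_int p))"
proof (rule comm_groupI)
  have pp: "0 < int p ^ n" for n using assms by simp
  have red: "a mod int p ^ Suc n mod int p ^ n = a mod int p ^ n" for a n
    by (rule mod_mod_cancel) (rule le_imp_power_dvd, simp)
  have closed: "(\<lambda>n. a n mod int p ^ n) \<in> carrier (add_monoid (padic_int p))"
    if "\<And>n. a (Suc n) mod int p ^ n = a n mod int p ^ n" for a :: "nat \<Rightarrow> int"
    unfolding padic_int_add_monoid using pp that red by simp
  fix x assume x: "x \<in> carrier (add_monoid (padic_int p))"
  have xm: "x n mod int p ^ n = x n" "x (Suc n) mod int p ^ n = x n" for n using x unfolding padic_int_add_monoid by auto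
  show "\<one>\<^bsub>add_monoid (padic_int p)\<^esub> \<otimes>\<^bsub>add_monoid (padic_int p)\<^esub> x = x" using xm unfolding padic_int_add_monoid by simp
  have "(- x (Suc n)) mod int p ^ n = (- x n) mod int p ^ n" for n
    using xm(2)[of n] by (metis mod_minus_eq)
  from closed[OF this] show "\<exists>y\<in>carrier (add_monoid (padic_int p)).
      y \<otimes>\<^bsub>add_monoid (padic_int p)\<^esub> x = \<one>\<^bsub>add_monoid (padic_int p)\<^esub>"
    by (rule rev_bexI) (unfold padic_int_add_monoid, simp add: mod_simps)
  fix y assume y: "y \<in> carrier (add_monoid (padic_int p))"
  have ym: "y (Suc n) mod int p ^ n = y n" for n using y unfolding padic_int_add_monoid by auto
  have "(x (Suc n) + y (Suc n)) mod int p ^ n = (x n + y n) mod int p ^ n" for n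
    using xm(2)[of n] ym[of n] by (metis mod_add_eq)
  from closed[OF this] show "x \<otimes>\<^bsub>add_monoid (padic_int p)\<^esub> y \<in> carrier (add_monoid (padic_int p))" unfolding padic_int_add_monoid(2) .
  show "x \<otimes>\<^bsub>add_monoid (padic_int p)\<^esub> y = y \<otimes>\<^bsub>add_monoid (padic_int p)\<^esub> x" unfolding padic_int_add_monoid by (simp add: add.commute)
  fix z
  show "x \<otimes>\<^bsub>add_monoid (padic_int p)\<^esub> y \<otimes>\<^bsub>add_monoid (padic_int p)\<^esub> z =
      x \<otimes>\<^bsub>add_monoid (padic_int p)\<^esub> (y \<otimes>\<^bsub>add_monoid (padic_int p)\<^esub> z)"
    unfolding padic_int_add_monoid by (simp add: mod_simps add.assoc)
qed (use assms in \<open>unfold padic_int_add_monoid, simp\<close>)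

text \<open>Write \<open>n = p^a m\<close> with \<open>m\<close> prime to \<open>p\<close>. If \<open>n\<close> kills \<open>b\<close>, then \<open>p^(i + a)\<close> divides \<open>n b_(i + a)\<close>,
so \<open>p^i\<close> divides \<open>b_(i + a)\<close>, whose residue modulo \<open>p^i\<close> is \<open>b_i\<close>.\<close>

lemma torsion_free_padic_int:
  assumes "prime p" shows "torsion_free (add_monoid (padic_int p))"
  unfolding torsion_free_def
proof (intro ballI allI impI)
  fix b and n :: nat
  assume b: "b \<in> carrier (add_monoid (padic_int p))" and n: "0 < n"
    and z: "b [^]\<^bsub>add_monoid (padic_int p)\<^esub> n = \<one>\<^bsub>add_monoid (padic_int p)\<^esub>"
  have p: "prime (int p)" using assms by simp
  have step: "b (Suc i) mod int p ^ i = b i" and range: "0 \<le> b i" "b i < int p ^ i" for i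
    using b unfolding padic_int_add_monoid by auto
  have pow: "b [^]\<^bsub>add_monoid (padic_int p)\<^esub> m = (\<lambda>i. (int m * b i) mod int p ^ i)" for m
  proof (induction m)
    case 0 show ?case by (simp only: nat_pow_0) (simp add: padic_int_def)
  next
    case (Suc m) show ?case
      by (simp only: nat_pow_Suc Suc padic_int_add_monoid(2)) (simp add: mod_simps algebra_simps)
  qed
  have dvd: "int p ^ i dvd int n * b i" for i
    using fun_cong[OF z[unfolded pow padic_int_add_monoid(3)], of i] by auto
  have mod: "b (i + j) mod int p ^ i = b i" for i j
  proof (induction j)
    case 0 show ?case using range[of i] by simp
  next
    case (Suc j)
    have "b (i + Suc j) mod int p ^ (i + j) mod int p ^ i = b (i + Suc j) mod int p ^ i"
      by (rule mod_mod_cancel) (simp add: le_imp_power_dvd)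
    then show ?case using step[of "i + j"] Suc by simp
  qed
  obtain a m where nm: "int n = int p ^ a * m" "\<not> int p dvd m"
    using multiplicity_decompose'[of "int n" "int p"] n p by (metis of_nat_0_less_iff less_irrefl not_prime_unit)
  have "b i = 0" for i
  proof -
    have "int p ^ a * int p ^ i dvd int p ^ a * (m * b (i + a))"
      using dvd[of "i + a"] by (simp add: nm(1) power_add mult.commute mult.left_commute)
    then have "int p ^ i dvd m * b (i + a)" using p by (simp add: prime_gt_0_int)
    moreover have "coprime (int p ^ i) m" using nm(2) p by (simp add: prime_imp_coprime)
    ultimately have "int p ^ i dvd b (i + a)" by (simp add: coprime_dvd_mult_right_iff)
    then show ?thesis using mod[of i a] by auto
  qed
  then show "b = \<one>\<^bsub>add_monoid (padic_int p)\<^esub>" unfolding padic_int_add_monoid by auto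
qed

section \<open>Cyclotomic polynomials over the integers\<close>

abbreviation ipoly_complex :: "int poly \<Rightarrow> complex poly"
  where "ipoly_complex \<equiv> map_poly of_int"

lemma ipoly_complex_mult: "ipoly_complex (p * q) = ipoly_complex p * ipoly_complex q"
  by (rule poly_eqI) (simp add: coeff_map_poly coeff_mult)

lemma ipoly_complex_add: "ipoly_complex (p + q) = ipoly_complex p + ipoly_complex q"
  by (rule poly_eqI) (simp add: coeff_map_poly)

lemma ipoly_complex_diff: "ipoly_complex (p - q) = ipoly_complex p - ipoly_complex q"
  by (rule poly_eqI) (simp add: coeff_map_poly)

lemma ipoly_complex_one: "ipoly_complex 1 = 1"
  by (rule poly_eqI) (simp add: coeff_map_poly)

lemma ipoly_complex_prod: "ipoly_complex (\<Prod>x\<in>S. f x) = (\<Prod>x\<in>S. ipoly_complex (f x))"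
  by (induction S rule: infinite_finite_induct) (simp_all add: ipoly_complex_one ipoly_complex_mult)

lemma ipoly_complex_inj: "ipoly_complex p = ipoly_complex q \<Longrightarrow> p = q"
  by (rule poly_eqI) (metis coeff_map_poly of_int_0 of_int_eq_iff)

lemma degree_ipoly_complex: "degree (ipoly_complex p) = degree p"
  by (rule degree_map_poly) simp

lemma lead_coeff_ipoly_complex: "lead_coeff (ipoly_complex p) = of_int (lead_coeff p)"
  by (simp add: degree_ipoly_complex coeff_map_poly)

definition primitive_roots_of_unity :: "nat \<Rightarrow> complex set"
  where "primitive_roots_of_unity n = {\<zeta>. \<zeta> ^ n = 1 \<and> (\<forall>m. 0 < m \<and> m < n \<longrightarrow> \<zeta> ^ m \<noteq> 1)}"

definition X_pow_minus_1 :: "nat \<Rightarrow> 'a::comm_ring_1 poly"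
  where "X_pow_minus_1 n = monom 1 n - 1"

lemma roots_of_unity_eq_UN_primitive:
  assumes "0 < n"
  shows "{z::complex. z ^ n = 1} = (\<Union>d\<in>{d. d dvd n}. primitive_roots_of_unity d)"
proof (intro equalityI subsetI)
  fix z :: complex assume "z \<in> {z. z ^ n = 1}"
  then have z: "z ^ n = 1" by simp
  define d where "d = (LEAST m. 0 < m \<and> z ^ m = 1)"
  have d: "0 < d" "z ^ d = 1" using LeastI[of "\<lambda>m. 0 < m \<and> z ^ m = 1" n] assms z unfolding d_def by auto
  have least: "\<not> (0 < m \<and> z ^ m = 1)" if "m < d" for m using not_less_Least that unfolding d_def by blast
  have "z ^ n = (z ^ d) ^ (n div d) * z ^ (n mod d)"
    by (simp flip: power_mult power_add)
  then have "z ^ (n mod d) = 1" using z d by simp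
  then have "n mod d = 0" using least[of "n mod d"] d by auto
  then have "d dvd n" by auto
  moreover have "z \<in> primitive_roots_of_unity d"
    using d least unfolding primitive_roots_of_unity_def by auto
  ultimately show "z \<in> (\<Union>d\<in>{d. d dvd n}. primitive_roots_of_unity d)" by blast
next
  fix z :: complex assume "z \<in> (\<Union>d\<in>{d. d dvd n}. primitive_roots_of_unity d)"
  then show "z \<in> {z. z ^ n = 1}" by (auto simp: primitive_roots_of_unity_def dvd_def power_mult)
qed

lemma finite_primitive_roots: "0 < n \<Longrightarrow> finite (primitive_roots_of_unity n)"
  by (rule finite_subset[OF _ finite_roots_unity[of n]]) (auto simp: primitive_roots_of_unity_def)

lemma primitive_roots_disjoint:
  assumes "0 < d" "0 < e" "d \<noteq> e" shows "primitive_roots_of_unity d \<inter> primitive_roots_of_unity e = {}"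
  using assms unfolding primitive_roots_of_unity_def by (auto dest: linorder_neqE_nat)

lemma X_pow_minus_1_eq_prod_roots:
  assumes "0 < n"
  shows "(X_pow_minus_1 n :: complex poly) = (\<Prod>z\<in>{z. z ^ n = 1}. [:- z, 1:])"
proof -
  have p: "poly (X_pow_minus_1 n) z = z ^ n - 1" for z :: complex
    by (simp add: X_pow_minus_1_def poly_monom)
  have "rsquarefree (X_pow_minus_1 n :: complex poly)"
    unfolding rsquarefree_roots p
  proof (intro allI notI, elim conjE)
    fix a :: complex assume a: "a ^ n - 1 = 0" "poly (pderiv (X_pow_minus_1 n)) a = 0"
    then have "of_nat n * a ^ (n - 1) = 0"
      by (simp add: X_pow_minus_1_def pderiv_diff pderiv_monom poly_monom)
    then have "a = 0" using assms by simp
    then show False using a(1) assms by (simp add: power_0_left)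
  qed
  moreover have "lead_coeff (X_pow_minus_1 n :: complex poly) = 1"
  proof -
    have "degree (X_pow_minus_1 n :: complex poly) = n"
      unfolding X_pow_minus_1_def using assms degree_add_eq_left[of "- 1 :: complex poly" "monom 1 n"]
      by (simp add: degree_monom_eq)
    then show ?thesis unfolding X_pow_minus_1_def using assms by (simp add: coeff_eq_0)
  qed
  ultimately show ?thesis using complex_poly_decompose_rsquarefree[of "X_pow_minus_1 n"] p by simp
qed

lemma X_pow_minus_1_eq_prod_primitive:
  assumes "0 < n"
  shows "(X_pow_minus_1 n :: complex poly) = (\<Prod>d\<in>{d. d dvd n}. \<Prod>z\<in>primitive_roots_of_unity d. [:- z, 1:])"
  unfolding X_pow_minus_1_eq_prod_roots[OF assms] roots_of_unity_eq_UN_primitive[OF assms]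
proof (rule prod.UNION_disjoint)
  have pos: "0 < d" if "d dvd n" for d using that assms by (rule dvd_pos_nat[rotated])
  show "finite {d. d dvd n}" using assms by simp
  show "\<forall>i\<in>{d. d dvd n}. finite (primitive_roots_of_unity i)" using pos finite_primitive_roots by blast
  show "\<forall>i\<in>{d. d dvd n}. \<forall>j\<in>{d. d dvd n}. i \<noteq> j \<longrightarrow> primitive_roots_of_unity i \<inter> primitive_roots_of_unity j = {}"
    using pos primitive_roots_disjoint by blast
qed

lemma ipoly_complex_X_pow_minus_1: "ipoly_complex (X_pow_minus_1 n) = X_pow_minus_1 n"
  unfolding X_pow_minus_1_def ipoly_complex_diff by (simp add: map_poly_monom ipoly_complex_one)

lemma lead_coeff_prod_linear: "lead_coeff (\<Prod>z\<in>S. [:- z, 1:]) = (1::complex)"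
  by (simp add: lead_coeff_prod)

text \<open>By induction, the product \<open>Q\<close> of the cyclotomic polynomials of the proper divisors of \<open>n\<close> has integer
coefficients and leading coefficient \<open>1\<close>. So \<open>X^n - 1\<close> can be divided by \<open>Q\<close> over the integers. Over the
complex numbers the remainder of this division is zero, and the quotient is the product of the linear factors.\<close>

lemma cyclotomic_exists:
  "0 < n \<Longrightarrow> \<exists>P. ipoly_complex P = (\<Prod>z\<in>primitive_roots_of_unity n. [:- z, 1:])"
proof (induction n rule: less_induct)
  case (less n)
  define D where "D = {d. d dvd n \<and> d \<noteq> n}"
  have fin: "finite D" unfolding D_def using less(2) by simp
  have "\<forall>d\<in>D. \<exists>P. ipoly_complex P = (\<Prod>z\<in>primitive_roots_of_unity d. [:- z, 1:])"
  proof
    fix d assume "d \<in> D"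
    then have "0 < d" "d < n" using less(2) dvd_imp_le[of d n] dvd_pos_nat unfolding D_def by auto
    then show "\<exists>P. ipoly_complex P = (\<Prod>z\<in>primitive_roots_of_unity d. [:- z, 1:])" using less(1) by blast
  qed
  then obtain P where P: "\<And>d. d \<in> D \<Longrightarrow> ipoly_complex (P d) = (\<Prod>z\<in>primitive_roots_of_unity d. [:- z, 1:])"
    by metis
  define Q where "Q = (\<Prod>d\<in>D. P d)"
  define C where "C = (\<Prod>z\<in>primitive_roots_of_unity n. [:- z, 1:])"
  have Q: "ipoly_complex Q = (\<Prod>d\<in>D. \<Prod>z\<in>primitive_roots_of_unity d. [:- z, 1:])"
    unfolding Q_def ipoly_complex_prod using P by simp
  have "lead_coeff (ipoly_complex Q) = 1" unfolding Q lead_coeff_prod lead_coeff_prod_linear by simp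
  then have monic: "lead_coeff Q = 1" unfolding lead_coeff_ipoly_complex by simp
  have "{d. d dvd n} = insert n D" "n \<notin> D" unfolding D_def by auto
  then have eq: "X_pow_minus_1 n = C * ipoly_complex Q"
    unfolding X_pow_minus_1_eq_prod_primitive[OF less(2)] C_def Q using fin by simp
  obtain S R where SR: "pseudo_divmod (X_pow_minus_1 n) Q = (S, R)" by fastforce
  have "Q \<noteq> 0" using monic by auto
  from pseudo_divmod[OF this SR] have div: "X_pow_minus_1 n = Q * S + R" "R = 0 \<or> degree R < degree Q"
    using monic by simp_all
  have "C * ipoly_complex Q = ipoly_complex Q * ipoly_complex S + ipoly_complex R"
    using arg_cong[OF div(1), of ipoly_complex] eq
    by (simp add: ipoly_complex_X_pow_minus_1 ipoly_complex_add ipoly_complex_mult)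
  then have "ipoly_complex Q * (C - ipoly_complex S) = ipoly_complex R" by (simp add: algebra_simps)
  then have *: "C - ipoly_complex S = 0 \<or> degree (ipoly_complex R) \<ge> degree (ipoly_complex Q) \<and> ipoly_complex R \<noteq> 0"
    using \<open>Q \<noteq> 0\<close> degree_mult_eq[of "ipoly_complex Q" "C - ipoly_complex S"]
    by (metis (no_types, lifting) ipoly_complex_inj le_add1 map_poly_0 mult_eq_0_iff)
  have "C = ipoly_complex S" using * div(2) by (auto simp: degree_ipoly_complex)
  then show ?case unfolding C_def by metis
qed

lemma ipoly_complex_cyclotomic:
  assumes "0 < n"
  shows "ipoly_complex (cyclotomic n) = (\<Prod>z\<in>primitive_roots_of_unity n. [:- z, 1:])"
proof -
  obtain P where P: "ipoly_complex P = (\<Prod>z\<in>primitive_roots_of_unity n. [:- z, 1:])"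
    using cyclotomic_exists[OF assms] by blast
  then have "cyclotomic n = P"
    unfolding cyclotomic_def primitive_roots_of_unity_def[symmetric]
    by (rule the_equality) (use P ipoly_complex_inj in metis)
  then show ?thesis using P by simp
qed

lemma prod_cyclotomic:
  assumes "0 < n" shows "(\<Prod>d\<in>{d. d dvd n}. cyclotomic d) = X_pow_minus_1 n"
proof (rule ipoly_complex_inj)
  have "ipoly_complex (\<Prod>d\<in>{d. d dvd n}. cyclotomic d) = (\<Prod>d\<in>{d. d dvd n}. \<Prod>z\<in>primitive_roots_of_unity d. [:- z, 1:])"
    unfolding ipoly_complex_prod using assms by (intro prod.cong refl ipoly_complex_cyclotomic) (auto dest: dvd_pos_nat)
  then show "ipoly_complex (\<Prod>d\<in>{d. d dvd n}. cyclotomic d) = ipoly_complex (X_pow_minus_1 n)"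
    by (simp add: X_pow_minus_1_eq_prod_primitive[OF assms] ipoly_complex_X_pow_minus_1)
qed

section \<open>Ideals that contain a cyclotomic polynomial\<close>

definition comaximal :: "'a::comm_ring_1 \<Rightarrow> 'a \<Rightarrow> bool"
  where "comaximal a b \<longleftrightarrow> (\<exists>u v. u * a + v * b = 1)"

lemma comaximal_sym: "comaximal a b \<Longrightarrow> comaximal b a"
  unfolding comaximal_def by (metis add.commute)

lemma comaximal_dvd: "comaximal a b \<Longrightarrow> a' dvd a \<Longrightarrow> b' dvd b \<Longrightarrow> comaximal a' b'"
  unfolding comaximal_def dvd_def by (metis mult.assoc mult.commute)

lemma comaximal_mult:
  assumes "comaximal a c" "comaximal b c" shows "comaximal (a * b) c"
proof -
  obtain u v u' v' where "u * a + v * c = 1" "u' * b + v' * c = 1" using assms unfolding comaximal_def by blast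
  then have "(u * a + v * c) * (u' * b + v' * c) = 1" by simp
  then have "(u * u') * (a * b) + (u * a * v' + v * u' * b + v * c * v') * c = 1" by (simp add: algebra_simps)
  then show ?thesis unfolding comaximal_def by blast
qed

lemma comaximal_one: "comaximal 1 c"
  unfolding comaximal_def by (rule exI[of _ 1], rule exI[of _ 0]) simp

lemma comaximal_prod_left:
  "(\<And>x. x \<in> S \<Longrightarrow> comaximal (f x) c) \<Longrightarrow> comaximal (\<Prod>x\<in>S. f x) c"
proof (induction S rule: infinite_finite_induct)
  case (insert x S) then show ?case by (simp add: comaximal_mult)
qed (simp_all add: comaximal_one)

lemma comaximal_prod:
  assumes "\<And>x y. x \<in> S \<Longrightarrow> y \<in> T \<Longrightarrow> comaximal (f x) (g y)"
  shows "comaximal (\<Prod>x\<in>S. f x) (\<Prod>y\<in>T. g y)"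
  by (intro comaximal_prod_left comaximal_sym[OF comaximal_prod_left] comaximal_sym[OF assms])

lemma X_pow_minus_1_geometric:
  "X_pow_minus_1 (m * k) = (\<Sum>i<m. monom 1 (i * k)) * (X_pow_minus_1 k :: int poly)"
proof -
  have m: "monom (1::int) (i * k) = (monom 1 k) ^ i" for i by (simp add: monom_power mult.commute)
  show ?thesis unfolding X_pow_minus_1_def m
    using power_diff_1_eq[of "monom (1::int) k" m] by (simp add: mult.commute)
qed

text \<open>Euclid's algorithm for exponents: with \<open>r = m mod n\<close>, the polynomial \<open>X^r - 1\<close> differs from \<open>X^m - 1\<close> by
a multiple of \<open>X^n - 1\<close>.\<close>

lemma X_pow_minus_1_gcd:
  "\<exists>u v. u * X_pow_minus_1 a + v * X_pow_minus_1 b = (X_pow_minus_1 (gcd a b) :: int poly)"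
proof (induction a b rule: gcd_nat_induct)
  case (base m)
  show ?case by (rule exI[of _ 1]) (simp add: X_pow_minus_1_def)
next
  case (step m n)
  then obtain u v where uv: "u * X_pow_minus_1 n + v * X_pow_minus_1 (m mod n) = (X_pow_minus_1 (gcd m n) :: int poly)"
    by (metis gcd_red_nat)
  define s where "s = (\<Sum>i<m div n. monom (1::int) (i * n))"
  have "X_pow_minus_1 (m mod n) = X_pow_minus_1 m - monom (1::int) (m mod n) * X_pow_minus_1 (m div n * n)"
  proof -
    have "monom (1::int) m = monom 1 (m mod n) * monom 1 (m div n * n)" by (simp add: mult_monom)
    then show ?thesis unfolding X_pow_minus_1_def by (simp only: right_diff_distrib mult_1_right diff_diff_eq2 add_diff_cancel_left' diff_add_cancel)
  qed
  then have "X_pow_minus_1 (m mod n) = X_pow_minus_1 m - monom 1 (m mod n) * (s * X_pow_minus_1 n)"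
    unfolding s_def X_pow_minus_1_geometric by blast
  then have "u * X_pow_minus_1 n + v * (X_pow_minus_1 m - monom 1 (m mod n) * (s * X_pow_minus_1 n)) = X_pow_minus_1 (gcd m n)"
    using uv by (simp only:)
  then have "v * X_pow_minus_1 m + (u - v * monom 1 (m mod n) * s) * X_pow_minus_1 n = X_pow_minus_1 (gcd m n)"
    by (simp add: algebra_simps)
  then show ?case by blast
qed

lemma X_pow_minus_1_nonzero:
  assumes "0 < n" shows "(X_pow_minus_1 n :: int poly) \<noteq> 0"
proof
  assume "(X_pow_minus_1 n :: int poly) = 0"
  then have "coeff (X_pow_minus_1 n :: int poly) 0 = 0" by simp
  then show False using assms by (simp add: X_pow_minus_1_def)
qed

lemma X_pow_minus_1_split:
  assumes "0 < n" "h dvd n"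
  shows "X_pow_minus_1 n = X_pow_minus_1 h * (\<Prod>k\<in>{k. k dvd n \<and> \<not> k dvd h}. cyclotomic k)"
proof -
  have h: "0 < h" using assms by (rule dvd_pos_nat)
  have fin: "finite {k. k dvd h}" "finite {k. k dvd n \<and> \<not> k dvd h}"
    using h assms(1) by (auto intro: finite_subset[of _ "{k. k dvd n}"])
  have "{k. k dvd n} = {k. k dvd h} \<union> {k. k dvd n \<and> \<not> k dvd h}" using assms(2) by auto
  then have "(\<Prod>k\<in>{k. k dvd n}. cyclotomic k) = (\<Prod>k\<in>{k. k dvd h}. cyclotomic k) * (\<Prod>k\<in>{k. k dvd n \<and> \<not> k dvd h}. cyclotomic k)"
    using prod.union_disjoint[OF fin, of cyclotomic] by auto
  then show ?thesis by (simp only: prod_cyclotomic[OF h] prod_cyclotomic[OF assms(1)])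
qed

lemma not_dvd_div:
  fixes g m :: nat
  assumes "0 < g" "m dvd g" "1 < m" shows "\<not> g dvd g div m"
proof
  assume "g dvd g div m"
  moreover have "0 < g div m" using assms by (auto elim: dvdE)
  ultimately have "g \<le> g div m" by (rule dvd_imp_le)
  then show False using div_less_dividend[of m g] assms by linarith
qed

text \<open>With \<open>h = gcd d e\<close>, the polynomials \<open>X^d - 1\<close> and \<open>X^e - 1\<close> generate the same ideal as \<open>X^h - 1\<close>.
Dividing by \<open>X^h - 1\<close> gives two comaximal polynomials, and since \<open>d\<close> and \<open>e\<close> do not divide \<open>h\<close>, these
still have the cyclotomic polynomials of \<open>d\<close> and of \<open>e\<close> as factors.\<close>

lemma cyclotomic_comaximal:
  assumes "0 < d" "0 < e" "\<not> d dvd e" "\<not> e dvd d"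
  shows "comaximal (cyclotomic d) (cyclotomic e)"
proof -
  define h where "h = gcd d e"
  have h: "0 < h" "h dvd d" "h dvd e" using assms by (simp_all add: h_def)
  define A where "A = (\<Prod>k\<in>{k. k dvd d \<and> \<not> k dvd h}. cyclotomic k)"
  define B where "B = (\<Prod>k\<in>{k. k dvd e \<and> \<not> k dvd h}. cyclotomic k)"
  obtain u v where "u * X_pow_minus_1 d + v * X_pow_minus_1 e = (X_pow_minus_1 h :: int poly)"
    using X_pow_minus_1_gcd h_def by blast
  then have "X_pow_minus_1 h * (u * A + v * B) = X_pow_minus_1 h * 1"
    using X_pow_minus_1_split[OF assms(1) h(2)] X_pow_minus_1_split[OF assms(2) h(3)] by (simp add: A_def B_def algebra_simps)
  then have "u * A + v * B = 1" using X_pow_minus_1_nonzero[OF h(1)] by (simp only: mult_cancel_left) simp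
  then have "comaximal A B" unfolding comaximal_def by blast
  moreover have "cyclotomic d dvd A" unfolding A_def
    by (rule dvd_prodI) (use assms in \<open>auto simp: h_def\<close>)
  moreover have "cyclotomic e dvd B" unfolding B_def
    by (rule dvd_prodI) (use assms in \<open>auto simp: h_def\<close>)
  ultimately show ?thesis by (rule comaximal_dvd)
qed

definition poly_ideal :: "int poly set \<Rightarrow> bool"
  where "poly_ideal J \<longleftrightarrow> 0 \<in> J \<and> (\<forall>p\<in>J. \<forall>q\<in>J. p + q \<in> J) \<and> (\<forall>p\<in>J. \<forall>r. r * p \<in> J)"

text \<open>For \<open>d\<close> in \<open>S - T\<close> and \<open>e\<close> in \<open>T - S\<close>, neither divides the other, since otherwise one of them would
belong to both sets. So the products over \<open>S - T\<close> and over \<open>T - S\<close> are comaximal; multiplying a relation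
between them by the product over \<open>S \<inter> T\<close> gives the claim.\<close>

lemma cyclotomic_upset_inter:
  assumes J: "poly_ideal J" and g: "0 < g" and S: "S \<subseteq> {d. d dvd g}" "T \<subseteq> {d. d dvd g}"
    and up: "\<And>d e. d \<in> S \<Longrightarrow> d dvd e \<Longrightarrow> e dvd g \<Longrightarrow> e \<in> S" "\<And>d e. d \<in> T \<Longrightarrow> d dvd e \<Longrightarrow> e dvd g \<Longrightarrow> e \<in> T"
    and mem: "(\<Prod>d\<in>S. cyclotomic d) \<in> J" "(\<Prod>d\<in>T. cyclotomic d) \<in> J"
  shows "(\<Prod>d\<in>S \<inter> T. cyclotomic d) \<in> J"
proof -
  have fin: "finite S" "finite T" using finite_subset[OF S(1)] finite_subset[OF S(2)] g by simp_all
  have "comaximal (\<Prod>d\<in>S - T. cyclotomic d) (\<Prod>d\<in>T - S. cyclotomic d)"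
  proof (rule comaximal_prod)
    fix d e assume de: "d \<in> S - T" "e \<in> T - S"
    then have "d dvd g" "e dvd g" using S by auto
    then have "0 < d" "0 < e" using g dvd_pos_nat by blast+
    moreover have "\<not> d dvd e" "\<not> e dvd d" using de up \<open>d dvd g\<close> \<open>e dvd g\<close> by blast+
    ultimately show "comaximal (cyclotomic d) (cyclotomic e)" by (rule cyclotomic_comaximal)
  qed
  then obtain u v where uv: "u * (\<Prod>d\<in>S - T. cyclotomic d) + v * (\<Prod>d\<in>T - S. cyclotomic d) = 1"
    unfolding comaximal_def by blast
  have s: "(\<Prod>d\<in>S. cyclotomic d) = (\<Prod>d\<in>S \<inter> T. cyclotomic d) * (\<Prod>d\<in>S - T. cyclotomic d)"
    using prod.Int_Diff[OF fin(1)] by blast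
  have t: "(\<Prod>d\<in>T. cyclotomic d) = (\<Prod>d\<in>S \<inter> T. cyclotomic d) * (\<Prod>d\<in>T - S. cyclotomic d)"
    using prod.Int_Diff[OF fin(2), of _ S] by (simp add: Int_commute)
  have "u * (\<Prod>d\<in>S. cyclotomic d) + v * (\<Prod>d\<in>T. cyclotomic d) =
      (\<Prod>d\<in>S \<inter> T. cyclotomic d) * (u * (\<Prod>d\<in>S - T. cyclotomic d) + v * (\<Prod>d\<in>T - S. cyclotomic d))"
    unfolding s t by (simp add: algebra_simps)
  also have "\<dots> = (\<Prod>d\<in>S \<inter> T. cyclotomic d)" by (simp add: uv)
  finally show ?thesis using J mem unfolding poly_ideal_def by metis
qed

text \<open>For a divisor \<open>m\<close> of \<open>g\<close>, the polynomial \<open>(X^g - 1) / (X^(g/m) - 1)\<close>. In a cyclic group of order \<open>g\<close> with generator \<open>\<sigma>\<close>, its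
value at \<open>\<sigma>\<close> is the sum of the elements of the subgroup of order \<open>m\<close>.\<close>

definition geometric_norm :: "nat \<Rightarrow> nat \<Rightarrow> int poly"
  where "geometric_norm g m = (\<Sum>i<m. monom 1 (i * (g div m)))"

lemma geometric_norm_eq_prod_cyclotomic:
  assumes "0 < g" "m dvd g"
  shows "geometric_norm g m = (\<Prod>d\<in>{d. d dvd g \<and> \<not> d dvd g div m}. cyclotomic d)"
proof -
  define k where "k = g div m"
  have k: "g = m * k" "0 < k" using assms by (auto simp: k_def)
  have "X_pow_minus_1 g = X_pow_minus_1 k * (\<Prod>d\<in>{d. d dvd g \<and> \<not> d dvd k}. cyclotomic d)"
    using X_pow_minus_1_split[of g k] assms(1) k(1) by simp
  moreover have "X_pow_minus_1 g = X_pow_minus_1 k * geometric_norm g m"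
    using X_pow_minus_1_geometric[of m k] unfolding geometric_norm_def k_def[symmetric] k(1)[symmetric] by (simp add: mult.commute)
  ultimately have "X_pow_minus_1 k * geometric_norm g m = X_pow_minus_1 k * (\<Prod>d\<in>{d. d dvd g \<and> \<not> d dvd k}. cyclotomic d)"
    by simp
  then show ?thesis using X_pow_minus_1_nonzero[OF k(2)] unfolding k_def[symmetric] by (simp only: mult_cancel_left) simp
qed

lemma geometric_norm_mem_ideal:
  assumes "poly_ideal J" "0 < g" "m dvd g" "1 < m" "cyclotomic g \<in> J"
  shows "geometric_norm g m \<in> J"
proof -
  have "\<not> g dvd g div m" by (rule not_dvd_div) (use assms in auto)
  then have "cyclotomic g dvd geometric_norm g m"
    unfolding geometric_norm_eq_prod_cyclotomic[OF assms(2,3)] using assms(2) by (intro dvd_prodI) auto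
  then show ?thesis using assms(1,5) unfolding poly_ideal_def by (metis dvd_def mult.commute)
qed

text \<open>The divisors \<open>d\<close> of \<open>g\<close> that divide none of the numbers \<open>g/l\<close>, for \<open>l\<close> in a set \<open>L\<close> of primes, are
closed under multiples. Enlarging \<open>L\<close> by one prime at a time, \<open>cyclotomic_upset_inter\<close> puts the product
over these divisors into the ideal. If \<open>L\<close> consists of all prime divisors of \<open>g\<close>, only \<open>d = g\<close> remains.
Starting from \<open>X^g - 1\<close>, which belongs to the empty set \<open>L\<close>, covers the case \<open>g = 1\<close>, where there is no
prime.\<close>

lemma cyclotomic_mem_ideal:
  assumes J: "poly_ideal J" and g: "0 < g" and X: "X_pow_minus_1 g \<in> J"
    and norms: "\<And>l. prime l \<Longrightarrow> l dvd g \<Longrightarrow> geometric_norm g l \<in> J"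
  shows "cyclotomic g \<in> J"
proof -
  have *: "(\<Prod>d\<in>{d. d dvd g \<and> (\<forall>l\<in>L. \<not> d dvd g div l)}. cyclotomic d) \<in> J"
    if "finite L" "L \<subseteq> {l. prime l \<and> l dvd g}" for L
    using that
  proof (induction L rule: finite_induct)
    case empty then show ?case using X prod_cyclotomic[OF g] by simp
  next
    case (insert l L)
    have "{d. d dvd g \<and> (\<forall>l\<in>insert l L. \<not> d dvd g div l)} =
        {d. d dvd g \<and> \<not> d dvd g div l} \<inter> {d. d dvd g \<and> (\<forall>l\<in>L. \<not> d dvd g div l)}" by auto
    moreover have "(\<Prod>d\<in>{d. d dvd g \<and> \<not> d dvd g div l}. cyclotomic d) \<in> J"
      using norms[of l] insert(4) geometric_norm_eq_prod_cyclotomic[OF g, of l] by auto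
    ultimately show ?case
      using insert by (auto intro!: cyclotomic_upset_inter[OF J g] intro: dvd_trans)
  qed
  have "finite {l. prime l \<and> l dvd g}" by (rule finite_subset[of _ "{d. d dvd g}"]) (use g in auto)
  from *[OF this subset_refl]
  have "(\<Prod>d\<in>{d. d dvd g \<and> (\<forall>l\<in>{l. prime l \<and> l dvd g}. \<not> d dvd g div l)}. cyclotomic d) \<in> J" .
  moreover have "{d. d dvd g \<and> (\<forall>l\<in>{l. prime l \<and> l dvd g}. \<not> d dvd g div l)} = {g}"
  proof (intro equalityI subsetI)
    fix d assume "d \<in> {d. d dvd g \<and> (\<forall>l\<in>{l. prime l \<and> l dvd g}. \<not> d dvd g div l)}"
    then have d: "d dvd g" "\<And>l. prime l \<Longrightarrow> l dvd g \<Longrightarrow> \<not> d dvd g div l" by auto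
    obtain k where k: "g = d * k" using d(1) by (auto simp: dvd_def)
    have "k = 1"
    proof (rule ccontr)
      assume "k \<noteq> 1"
      then obtain l where l: "prime l" "l dvd k" using prime_factor_nat by blast
      then have "l dvd g" using k by simp
      moreover have "d dvd g div l" using l k by (metis div_mult_swap dvd_triv_left)
      ultimately show False using d(2) l(1) by blast
    qed
    then show "d \<in> {g}" using k by simp
  next
    fix d assume "d \<in> {g}"
    moreover have "\<not> g dvd g div l" if "prime l" "l dvd g" for l
      by (rule not_dvd_div[OF g that(2) prime_gt_1_nat[OF that(1)]])
    ultimately show "d \<in> {d. d dvd g \<and> (\<forall>l\<in>{l. prime l \<and> l dvd g}. \<not> d dvd g div l)}" by auto
  qed
  ultimately show ?thesis by simp
qed

section \<open>Subfields of the complex numbers and their embeddings\<close>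

lemma CC_simps [simp]:
  "carrier CC = UNIV" "x \<otimes>\<^bsub>CC\<^esub> y = x * y" "x \<oplus>\<^bsub>CC\<^esub> y = x + y" "\<one>\<^bsub>CC\<^esub> = 1" "\<zero>\<^bsub>CC\<^esub> = 0"
  by (simp_all add: ring_of_type_algebra_def)

lemma field_CC: "field CC" by (rule field_from_type_algebra)

lemma CC_uminus: "\<ominus>\<^bsub>CC\<^esub> x = - x"
proof -
  interpret CC: field CC by (rule field_CC)
  show ?thesis by (rule CC.minus_equality) simp_all
qed

lemma CC_inv: "x \<noteq> 0 \<Longrightarrow> inv\<^bsub>CC\<^esub> x = inverse x"
proof -
  assume "x \<noteq> 0"
  interpret CC: field CC by (rule field_CC)
  show ?thesis by (rule CC.inv_char) (use \<open>x \<noteq> 0\<close> in simp_all)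
qed

lemma CC_nat_pow: "x [^]\<^bsub>CC\<^esub> (n::nat) = x ^ n"
proof (induction n)
  case 0 show ?case by (simp only: nat_pow_0) simp
next
  case (Suc n) show ?case by (simp only: nat_pow_Suc Suc) (simp add: mult.commute)
qed

lemma subfield_CC_I:
  assumes "1 \<in> K" "\<And>x y. x \<in> K \<Longrightarrow> y \<in> K \<Longrightarrow> x - y \<in> K" "\<And>x y. x \<in> K \<Longrightarrow> y \<in> K \<Longrightarrow> x * y \<in> K"
    "\<And>x. x \<in> K \<Longrightarrow> x \<noteq> 0 \<Longrightarrow> inverse x \<in> K"
  shows "subfield K CC"
proof -
  interpret CC: field CC by (rule field_CC)
  have 0: "0 \<in> K" using assms(2)[OF assms(1,1)] by simp
  have n: "- x \<in> K" if "x \<in> K" for x using assms(2)[OF 0 that] by simp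
  have a: "x + y \<in> K" if "x \<in> K" "y \<in> K" for x y using assms(2)[OF that(1) n[OF that(2)]] by simp
  show ?thesis
    by (rule CC.subfieldI'[OF CC.subringI]) (use assms a n CC_uminus CC_inv in auto)
qed

context
  fixes K :: "complex set"
  assumes K: "subfield K CC"
begin

lemma subfield_one: "1 \<in> K" using subringE(3)[OF subfieldE(1)[OF K]] by simp
lemma subfield_zero: "0 \<in> K" using subringE(2)[OF subfieldE(1)[OF K]] by simp
lemma subfield_uminus: "x \<in> K \<Longrightarrow> - x \<in> K" using subringE(5)[OF subfieldE(1)[OF K]] by (simp add: CC_uminus)
lemma subfield_mult: "x \<in> K \<Longrightarrow> y \<in> K \<Longrightarrow> x * y \<in> K" using subringE(6)[OF subfieldE(1)[OF K]] by simp
lemma subfield_add: "x \<in> K \<Longrightarrow> y \<in> K \<Longrightarrow> x + y \<in> K" using subringE(7)[OF subfieldE(1)[OF K]] by simp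
lemma subfield_diff: "x \<in> K \<Longrightarrow> y \<in> K \<Longrightarrow> x - y \<in> K" using subfield_add[of x "- y"] subfield_uminus by simp
lemma subfield_inverse: "x \<in> K \<Longrightarrow> inverse x \<in> K"
proof (cases "x = 0")
  case False
  assume "x \<in> K"
  interpret CC: field CC by (rule field_CC)
  show ?thesis using CC.subfield_m_inv(1)[OF K, of x] \<open>x \<in> K\<close> False by (simp add: CC_inv)
qed simp
lemma subfield_sum: "(\<And>i. i \<in> I \<Longrightarrow> f i \<in> K) \<Longrightarrow> sum f I \<in> K"
  by (induction I rule: infinite_finite_induct) (simp_all add: subfield_zero subfield_add)
lemma subfield_power: "x \<in> K \<Longrightarrow> x ^ n \<in> K"
  by (induction n) (simp_all add: subfield_one subfield_mult)
lemma subfield_of_nat: "of_nat n \<in> K"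
  by (induction n) (simp_all add: subfield_one subfield_zero subfield_add)
lemma subfield_of_int: "of_int n \<in> K"
  by (cases n rule: int_cases2) (simp_all add: subfield_of_nat subfield_uminus)
lemma subfield_Rats: "\<rat> \<subseteq> K"
proof
  fix q :: complex assume "q \<in> \<rat>"
  then obtain r where "q = of_rat r" by (auto elim: Rats_cases)
  obtain a b where "quotient_of r = (a, b)" by fastforce
  then have "r = of_int a / of_int b" by (rule quotient_of_div)
  then have "q = of_int a * inverse (of_int b)" using \<open>q = of_rat r\<close> by (simp add: of_rat_divide flip: divide_inverse)
  then show "q \<in> K" by (simp add: subfield_mult subfield_inverse subfield_of_int)
qed

end

lemma subfield_Rats_CC: "subfield \<rat> CC"
  by (rule subfield_CC_I) auto

definition polys_over :: "complex set \<Rightarrow> complex poly set"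
  where "polys_over K = {p. \<forall>i. coeff p i \<in> K}"

lemma polys_over_closed:
  assumes "subfield K CC"
  shows "0 \<in> polys_over K" "1 \<in> polys_over K"
    "p \<in> polys_over K \<Longrightarrow> q \<in> polys_over K \<Longrightarrow> p + q \<in> polys_over K"
    "p \<in> polys_over K \<Longrightarrow> q \<in> polys_over K \<Longrightarrow> p - q \<in> polys_over K"
    "p \<in> polys_over K \<Longrightarrow> q \<in> polys_over K \<Longrightarrow> p * q \<in> polys_over K"
    "c \<in> K \<Longrightarrow> monom c n \<in> polys_over K"
    "p \<in> polys_over K \<Longrightarrow> pderiv p \<in> polys_over K"
    "c \<in> K \<Longrightarrow> p \<in> polys_over K \<Longrightarrow> smult c p \<in> polys_over K"
  using assms
  by (auto simp: polys_over_def coeff_mult coeff_pderiv subfield_zero subfield_one subfield_add subfield_diff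
      intro!: subfield_sum subfield_mult subfield_add subfield_one subfield_of_nat)

lemma polys_over_prod_linear:
  assumes "subfield K CC" "S \<subseteq> K" shows "(\<Prod>y\<in>S. [:- y, 1:]) \<in> polys_over K"
  using assms(2)
proof (induction S rule: infinite_finite_induct)
  case (insert y S)
  have "[:- y, 1:] \<in> polys_over K"
    using insert(4) assms(1) by (auto simp: polys_over_def coeff_pCons subfield_uminus subfield_one subfield_zero split: nat.splits)
  then show ?case using insert by (simp add: polys_over_closed(5)[OF assms(1)] del: mult_pCons_left)
qed (simp_all add: polys_over_closed(2)[OF assms(1)])

lemma poly_in_subfield:
  assumes "subfield K CC" "p \<in> polys_over K" "x \<in> K" shows "poly p x \<in> K"
  unfolding poly_altdef using assms
  by (intro subfield_sum[OF assms(1)] subfield_mult[OF assms(1)] subfield_power[OF assms(1)]) (auto simp: polys_over_def)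

definition field_hom :: "complex set \<Rightarrow> (complex \<Rightarrow> complex) \<Rightarrow> bool"
  where "field_hom L f \<longleftrightarrow> f 1 = 1 \<and> (\<forall>x\<in>L. \<forall>y\<in>L. f (x + y) = f x + f y \<and> f (x * y) = f x * f y)"

context
  fixes L :: "complex set" and f :: "complex \<Rightarrow> complex"
  assumes L: "subfield L CC" and f: "field_hom L f"
begin

lemma field_hom_one: "f 1 = 1" using f by (simp add: field_hom_def)
lemma field_hom_add: "x \<in> L \<Longrightarrow> y \<in> L \<Longrightarrow> f (x + y) = f x + f y" using f by (simp add: field_hom_def)
lemma field_hom_mult: "x \<in> L \<Longrightarrow> y \<in> L \<Longrightarrow> f (x * y) = f x * f y" using f by (simp add: field_hom_def)
lemma field_hom_zero: "f 0 = 0" using field_hom_add[of 0 0] subfield_zero[OF L] by simp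
lemma field_hom_uminus: "x \<in> L \<Longrightarrow> f (- x) = - f x"
  using field_hom_add[of x "- x"] subfield_uminus[OF L] field_hom_zero by (simp add: eq_neg_iff_add_eq_0 add.commute)
lemma field_hom_diff: "x \<in> L \<Longrightarrow> y \<in> L \<Longrightarrow> f (x - y) = f x - f y"
  using field_hom_add[of x "- y"] field_hom_uminus[of y] subfield_uminus[OF L] by simp
lemma field_hom_eq_0: "x \<in> L \<Longrightarrow> f x = 0 \<Longrightarrow> x = 0"
  using field_hom_mult[of x "inverse x"] subfield_inverse[OF L] field_hom_one by (cases "x = 0") auto
lemma field_hom_inj: "inj_on f L"
  by (rule inj_onI) (metis field_hom_diff field_hom_eq_0 subfield_diff[OF L] right_minus_eq)
lemma field_hom_inverse: "x \<in> L \<Longrightarrow> f (inverse x) = inverse (f x)"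
proof (cases "x = 0")
  case False
  assume "x \<in> L"
  then have "f x * f (inverse x) = 1"
    using field_hom_mult[of x "inverse x"] subfield_inverse[OF L] field_hom_one False by simp
  then show ?thesis by (simp add: inverse_unique)
qed (simp add: field_hom_zero)
lemma field_hom_sum: "(\<And>i. i \<in> I \<Longrightarrow> g i \<in> L) \<Longrightarrow> f (sum g I) = (\<Sum>i\<in>I. f (g i))"
  by (induction I rule: infinite_finite_induct) (simp_all add: field_hom_zero field_hom_add subfield_sum[OF L])
lemma field_hom_power: "x \<in> L \<Longrightarrow> f (x ^ n) = f x ^ n"
  by (induction n) (simp_all add: field_hom_one field_hom_mult subfield_power[OF L])
lemma field_hom_of_nat: "f (of_nat n) = of_nat n"
  by (induction n) (simp_all add: field_hom_zero field_hom_one field_hom_add subfield_one[OF L] subfield_of_nat[OF L])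
lemma field_hom_of_int: "f (of_int n) = of_int n"
  by (cases n rule: int_cases2) (simp_all add: field_hom_of_nat field_hom_uminus subfield_of_nat[OF L])
lemma field_hom_Rats: "q \<in> \<rat> \<Longrightarrow> f q = q"
proof -
  assume "q \<in> \<rat>"
  then obtain r where "q = of_rat r" by (auto elim: Rats_cases)
  obtain a b where "quotient_of r = (a, b)" by fastforce
  then have "r = of_int a / of_int b" by (rule quotient_of_div)
  then have "q = of_int a * inverse (of_int b)" using \<open>q = of_rat r\<close> by (simp add: of_rat_divide flip: divide_inverse)
  then show ?thesis
    by (simp add: field_hom_mult field_hom_inverse field_hom_of_int subfield_of_int[OF L] subfield_inverse[OF L])
qed

lemma field_hom_poly:
  assumes "p \<in> polys_over L" "x \<in> L" shows "f (poly p x) = poly (map_poly f p) (f x)"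
proof -
  have d: "degree (map_poly f p) = degree p"
  proof (cases "p = 0")
    case False
    then show ?thesis
      by (intro map_poly_degree_eq) (use field_hom_eq_0[of "lead_coeff p"] assms in \<open>auto simp: polys_over_def\<close>)
  qed simp
  have c: "coeff p i \<in> L" for i using assms by (simp add: polys_over_def)
  show ?thesis unfolding poly_altdef d
    using c assms(2) by (simp add: field_hom_sum field_hom_mult field_hom_power subfield_mult[OF L] subfield_power[OF L] coeff_map_poly field_hom_zero)
qed

lemma map_poly_field_hom_diff:
  "p \<in> polys_over L \<Longrightarrow> q \<in> polys_over L \<Longrightarrow> map_poly f (p - q) = map_poly f p - map_poly f q"
  by (rule poly_eqI) (simp add: coeff_map_poly field_hom_zero field_hom_diff polys_over_def)

lemma map_poly_field_hom_mult:
  "p \<in> polys_over L \<Longrightarrow> q \<in> polys_over L \<Longrightarrow> map_poly f (p * q) = map_poly f p * map_poly f q"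
  by (rule poly_eqI)
    (simp add: coeff_map_poly field_hom_zero coeff_mult field_hom_sum field_hom_mult polys_over_def subfield_mult[OF L])

lemma map_poly_field_hom_prod_linear:
  assumes "S \<subseteq> L" shows "map_poly f (\<Prod>y\<in>S. [:- y, 1:]) = (\<Prod>y\<in>S. [:- f y, 1:])"
  using assms
proof (induction S rule: infinite_finite_induct)
  case (insert y S)
  have "[:- y, 1:] = (\<Prod>y\<in>{y}. [:- y, 1:])" by simp
  then have "[:- y, 1:] \<in> polys_over L" using insert(4) polys_over_prod_linear[OF L, of "{y}"] by simp
  moreover have "(\<Prod>y\<in>S. [:- y, 1:]) \<in> polys_over L" using insert(4) by (simp add: polys_over_prod_linear[OF L])
  moreover have "map_poly f [:- y, 1:] = [:- f y, 1:]"
    using insert(4) by (simp add: map_poly_pCons field_hom_zero field_hom_one field_hom_uminus)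
  ultimately show ?case using insert by (simp add: map_poly_field_hom_mult del: mult_pCons_left)
qed (simp_all add: field_hom_one)

text \<open>The embedding permutes the roots of this polynomial.\<close>

lemma field_hom_fixes_orbit_poly:
  assumes "S \<subseteq> L" "finite S" "f ` S \<subseteq> S"
  shows "f (coeff (\<Prod>y\<in>S. [:- y, 1:]) i) = coeff (\<Prod>y\<in>S. [:- y, 1:]) i"
proof -
  have inj: "inj_on f S" using field_hom_inj assms(1) by (rule inj_on_subset)
  then have "f ` S = S" using assms by (simp add: endo_inj_surj)
  then have "(\<Prod>y\<in>S. [:- f y, 1:]) = (\<Prod>y\<in>S. [:- y, 1:])"
    using prod.reindex[OF inj, of "\<lambda>y. [:- y, 1:]"] by (simp add: comp_def)
  then have "map_poly f (\<Prod>y\<in>S. [:- y, 1:]) = (\<Prod>y\<in>S. [:- y, 1:])"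
    using map_poly_field_hom_prod_linear[OF assms(1)] by simp
  then show ?thesis using coeff_map_poly[of f "\<Prod>y\<in>S. [:- y, 1:]" i] field_hom_zero by simp
qed

end

lemma eval_CC: "ring.eval CC p x = poly (Poly (rev p)) x"
proof (induction p)
  case Nil
  interpret CC: field CC by (rule field_CC)
  show ?case by simp
next
  case (Cons a p)
  interpret CC: field CC by (rule field_CC)
  show ?case using Cons by (simp add: CC_nat_pow Poly_snoc poly_monom)
qed

lemma ring_algebraic_CC_iff: "(ring.algebraic CC over \<rat>) x \<longleftrightarrow> algebraic x"
proof
  interpret CC: field CC by (rule field_CC)
  assume "(CC.algebraic over \<rat>) x"
  then obtain p where p: "p \<in> carrier (univ_poly CC \<rat>)" "p \<noteq> []" "ring.eval CC p x = 0"
    using CC.algebraicE[OF subfieldE(1)[OF subfield_Rats_CC], of x] by auto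
  then have pr: "set p \<subseteq> \<rat>" "hd p \<noteq> 0" by (auto simp: univ_poly_def polynomial_def)
  show "algebraic x"
  proof (rule algebraicI')
    show "coeff (Poly (rev p)) i \<in> \<rat>" for i
      using pr(1) by (auto simp: nth_default_def) (metis length_rev nth_mem set_rev subsetD)
    show "Poly (rev p) \<noteq> 0"
    proof
      assume "Poly (rev p) = 0"
      then obtain n where "rev p = replicate n 0" by (auto simp: Poly_eq_0)
      then have "p = replicate n 0" by (metis rev_replicate rev_rev_ident)
      then show False using p(2) pr(2) by (cases n) auto
    qed
    show "poly (Poly (rev p)) x = 0" using p(3) by (simp add: eval_CC)
  qed
next
  interpret CC: field CC by (rule field_CC)
  assume "algebraic x"
  then obtain p where p: "\<And>i. coeff p i \<in> \<rat>" "p \<noteq> 0" "poly p x = 0" unfolding algebraic_altdef by blast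
  show "(CC.algebraic over \<rat>) x"
  proof (rule CC.algebraicI)
    show "rev (coeffs p) \<in> carrier (univ_poly CC \<rat>)"
      using p by (auto simp: univ_poly_def polynomial_def hd_rev last_coeffs_eq_coeff_degree coeffs_def)
    show "rev (coeffs p) \<noteq> []" using p by simp
    show "ring.eval CC (rev (coeffs p)) x = \<zero>\<^bsub>CC\<^esub>" using p by (simp add: eval_CC)
  qed
qed

lemma subfield_Qbar: "subfield Qbar CC"
proof -
  interpret CC: field CC by (rule field_CC)
  have "Qbar = {x \<in> carrier CC. (CC.algebraic over \<rat>) x}" by (simp add: Qbar_def ring_algebraic_CC_iff)
  then show ?thesis using CC.subfield_of_algebraics[OF subfield_Rats_CC] by simp
qed

lemma number_field_subset_Qbar:
  assumes "number_field F" shows "F \<subseteq> Qbar"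
proof
  interpret CC: field CC by (rule field_CC)
  fix x assume "x \<in> F"
  then have "(CC.algebraic over \<rat>) x"
    using CC.finite_dimension_imp_algebraic[OF subfield_Rats_CC, of F] assms subfieldE(1)[of F CC]
    by (simp add: number_field_def)
  then show "x \<in> Qbar" by (simp add: Qbar_def ring_algebraic_CC_iff)
qed

section \<open>Extension of embeddings to the algebraic numbers\<close>

text \<open>An embedding of a field of algebraic numbers into the complex numbers, given by its graph, so that unions of
chains make sense. Its domain is only required to be a ring; being a ring of algebraic numbers that contains
the rationals, it is a field by \<open>subring_Qbar_subfield\<close>.\<close>

definition ring_graph :: "(complex \<times> complex) set \<Rightarrow> bool"
  where "ring_graph \<Gamma> \<longleftrightarrow> (\<forall>q\<in>\<rat>. (q, q) \<in> \<Gamma>) \<and>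
    (\<forall>x a y b. (x, a) \<in> \<Gamma> \<longrightarrow> (y, b) \<in> \<Gamma> \<longrightarrow> (x - y, a - b) \<in> \<Gamma> \<and> (x * y, a * b) \<in> \<Gamma>) \<and>
    (\<forall>a. (0, a) \<in> \<Gamma> \<longrightarrow> a = 0) \<and> Domain \<Gamma> \<subseteq> Qbar"

text \<open>If \<open>x\<close> is a root of \<open>a + X q(X)\<close> with rational coefficients and nonzero \<open>a\<close>, then the inverse of \<open>x\<close>
is \<open>- q(x) / a\<close>.\<close>

lemma subring_Qbar_subfield:
  assumes "\<rat> \<subseteq> L" "L \<subseteq> Qbar" "\<And>x y. x \<in> L \<Longrightarrow> y \<in> L \<Longrightarrow> x - y \<in> L" "\<And>x y. x \<in> L \<Longrightarrow> y \<in> L \<Longrightarrow> x * y \<in> L"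
  shows "subfield L CC"
proof (rule subfield_CC_I)
  show one: "1 \<in> L" using assms(1) by auto
  have 0: "0 \<in> L" using assms(1) by auto
  have add: "x + y \<in> L" if "x \<in> L" "y \<in> L" for x y
    using assms(3)[OF that(1) assms(3)[OF 0 that(2)]] by simp
  fix x assume x: "x \<in> L" "x \<noteq> 0"
  then have "algebraic x" using assms(2) by (auto simp: Qbar_def)
  then obtain r where r: "coeff r 0 \<noteq> 0" "poly (map_poly of_int r) x = 0"
    using x(2) algebraicE'_nonzero[of x] by metis
  define p where "p = map_poly complex_of_int r"
  have p: "\<And>i. coeff p i \<in> \<int>" "poly p x = 0" "coeff p 0 \<noteq> 0"
    using r by (simp_all add: p_def coeff_map_poly)
  obtain a q where pq: "p = pCons a q" by (cases p)
  have rat: "coeff p i \<in> \<rat>" for i using p(1) Ints_subset_Rats by auto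
  have "coeff q i \<in> \<rat>" for i using rat[of "Suc i"] pq by simp
  moreover have "poly q x \<in> L" if "\<And>i. coeff q i \<in> \<rat>" for q
    using that
  proof (induction q)
    case (pCons c q)
    have "c \<in> L" using pCons.prems[of 0] assms(1) by auto
    moreover have "poly q x \<in> L" by (rule pCons.IH) (use pCons.prems[of "Suc _"] in simp)
    ultimately show ?case using add assms(4) x by simp
  qed (simp add: 0)
  ultimately have q: "poly q x \<in> L" by blast
  have a: "a \<in> \<rat>" "a \<noteq> 0" using rat[of 0] p(3) pq by simp_all
  have "x * poly q x = - a" using p(2) pq by (simp add: add_eq_0_iff)
  then have "x * (- inverse a * poly q x) = 1" using a(2) by (simp add: field_simps)
  then have "inverse x = - inverse a * poly q x" by (metis inverse_unique)
  moreover have "- inverse a \<in> L" using a(1) assms(1) by auto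
  ultimately show "inverse x \<in> L" using assms(4) q by metis
qed (use assms in blast)+

lemma ring_graph_hom:
  assumes "ring_graph \<Gamma>"
  obtains f where "subfield (Domain \<Gamma>) CC" "field_hom (Domain \<Gamma>) f" "\<Gamma> = {(x, f x) |x. x \<in> Domain \<Gamma>}"
proof -
  have G: "\<And>q. q \<in> \<rat> \<Longrightarrow> (q, q) \<in> \<Gamma>"
    "\<And>x a y b. (x, a) \<in> \<Gamma> \<Longrightarrow> (y, b) \<in> \<Gamma> \<Longrightarrow> (x - y, a - b) \<in> \<Gamma>"
    "\<And>x a y b. (x, a) \<in> \<Gamma> \<Longrightarrow> (y, b) \<in> \<Gamma> \<Longrightarrow> (x * y, a * b) \<in> \<Gamma>"
    "\<And>a. (0, a) \<in> \<Gamma> \<Longrightarrow> a = 0" "Domain \<Gamma> \<subseteq> Qbar"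
    using assms unfolding ring_graph_def by blast+
  have uniq: "a = b" if "(x, a) \<in> \<Gamma>" "(x, b) \<in> \<Gamma>" for x a b
    using G(4)[of "a - b"] G(2)[OF that] by simp
  have sf: "subfield (Domain \<Gamma>) CC"
  proof (rule subring_Qbar_subfield)
    show "\<rat> \<subseteq> Domain \<Gamma>" using G(1) by blast
    show "Domain \<Gamma> \<subseteq> Qbar" by (rule G(5))
    fix x y assume "x \<in> Domain \<Gamma>" "y \<in> Domain \<Gamma>"
    then obtain a b where "(x, a) \<in> \<Gamma>" "(y, b) \<in> \<Gamma>" by blast
    from G(2)[OF this] G(3)[OF this] show "x - y \<in> Domain \<Gamma>" "x * y \<in> Domain \<Gamma>" by blast+
  qed
  define f where "f x = (THE a. (x, a) \<in> \<Gamma>)" for x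
  have f: "f x = a" if "(x, a) \<in> \<Gamma>" for x a
    unfolding f_def using that uniq by blast
  have fm: "(x, f x) \<in> \<Gamma>" if "x \<in> Domain \<Gamma>" for x using that f by auto
  have "field_hom (Domain \<Gamma>) f" unfolding field_hom_def
  proof (intro conjI ballI)
    show "f 1 = 1" using G(1)[of 1] by (intro f) simp
    fix x y assume xy: "x \<in> Domain \<Gamma>" "y \<in> Domain \<Gamma>"
    have "(0 - y, 0 - f y) \<in> \<Gamma>" using G(2)[OF G(1)[of 0] fm[OF xy(2)]] by simp
    from G(2)[OF fm[OF xy(1)] this] show "f (x + y) = f x + f y" by (intro f) simp
    show "f (x * y) = f x * f y" using G(3)[OF fm[OF xy(1)] fm[OF xy(2)]] by (rule f)
  qed
  moreover have "\<Gamma> = {(x, f x) |x. x \<in> Domain \<Gamma>}" using f fm by auto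
  ultimately show thesis using that sf by blast
qed

lemma min_poly_exists:
  assumes L: "subfield L CC" and x: "x \<in> Qbar"
  obtains m where "m \<in> polys_over L" "lead_coeff m = 1" "poly m x = 0"
    "\<And>p. p \<in> polys_over L \<Longrightarrow> p \<noteq> 0 \<Longrightarrow> poly p x = 0 \<Longrightarrow> degree m \<le> degree p"
proof -
  obtain p where p: "\<And>i. coeff p i \<in> \<rat>" "p \<noteq> 0" "poly p x = 0"
    using x unfolding Qbar_def algebraic_altdef by blast
  define Q where "Q n \<longleftrightarrow> (\<exists>p\<in>polys_over L. p \<noteq> 0 \<and> poly p x = 0 \<and> degree p = n)" for n
  have "Q (degree p)" unfolding Q_def using p subfield_Rats[OF L] by (auto simp: polys_over_def)
  then have "Q (LEAST n. Q n)" by (rule LeastI)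
  then obtain m where m: "m \<in> polys_over L" "m \<noteq> 0" "poly m x = 0" "degree m = (LEAST n. Q n)" unfolding Q_def by blast
  define m' where "m' = smult (inverse (lead_coeff m)) m"
  show thesis
  proof (rule that)
    show "m' \<in> polys_over L" unfolding m'_def
      using m(1) by (intro polys_over_closed(8)[OF L] subfield_inverse[OF L]) (auto simp: polys_over_def)
    show "lead_coeff m' = 1" "poly m' x = 0" using m(2,3) by (simp_all add: m'_def)
    fix p assume "p \<in> polys_over L" "p \<noteq> 0" "poly p x = 0"
    then have "Q (degree p)" unfolding Q_def by blast
    then have "(LEAST n. Q n) \<le> degree p" by (rule Least_le)
    then show "degree m' \<le> degree p" using m(2,4) by (simp add: m'_def)
  qed
qed

lemma degree_reduce:
  assumes "lead_coeff m = (1::complex)" "p \<noteq> 0" "degree m \<le> degree p"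
  defines "q \<equiv> p - monom (lead_coeff p) (degree p - degree m) * m"
  shows "q = 0 \<or> degree q < degree p"
proof -
  have d: "degree (monom (lead_coeff p) (degree p - degree m) * m) \<le> degree p"
    using degree_mult_le[of "monom (lead_coeff p) (degree p - degree m)" m] degree_monom_le[of "lead_coeff p" "degree p - degree m"] assms(3) by linarith
  have c: "coeff q (degree p) = 0"
    unfolding q_def using assms(1,3) by (simp add: coeff_monom_mult)
  have "degree q \<le> degree p" unfolding q_def using d by (simp add: degree_diff_le)
  then show ?thesis using c by (metis le_neq_implies_less leading_coeff_0_iff)
qed

text \<open>A root \<open>\<beta>\<close> of the conjugate of the minimal polynomial \<open>m\<close> of \<open>x\<close> defines an extension of \<open>f\<close> to the
ring generated by \<open>x\<close>. It is well defined because division by \<open>m\<close> shows that a polynomial that vanishes at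
\<open>x\<close> has a conjugate that vanishes at \<open>\<beta>\<close>.\<close>

lemma simple_extension_graph:
  assumes L: "subfield L CC" "L \<subseteq> Qbar" and f: "field_hom L f" and x: "x \<in> Qbar"
    and m: "m \<in> polys_over L" "lead_coeff m = 1" "poly m x = 0"
    and min: "\<And>p. p \<in> polys_over L \<Longrightarrow> p \<noteq> 0 \<Longrightarrow> poly p x = 0 \<Longrightarrow> degree m \<le> degree p"
    and \<beta>: "poly (map_poly f m) \<beta> = 0"
  shows "ring_graph {(poly p x, poly (map_poly f p) \<beta>) |p. p \<in> polys_over L}" (is "ring_graph ?\<Gamma>")
proof -
  have key: "poly (map_poly f p) \<beta> = 0" if "p \<in> polys_over L" "poly p x = 0" for p
    using that
  proof (induction "degree p" arbitrary: p rule: less_induct)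
    case less
    show ?case
    proof (cases "p = 0")
      case False
      define c where "c = monom (lead_coeff p) (degree p - degree m)"
      have c: "c \<in> polys_over L" unfolding c_def
        using less(2) by (intro polys_over_closed(6)[OF L(1)]) (simp add: polys_over_def)
      have q: "p - c * m \<in> polys_over L" using less(2) c m(1) by (intro polys_over_closed[OF L(1)])
      have "poly (map_poly f (p - c * m)) \<beta> = 0"
      proof (cases "p - c * m = 0")
        case False
        then have "degree (p - c * m) < degree p"
          using degree_reduce[OF m(2) \<open>p \<noteq> 0\<close> min[OF less(2) \<open>p \<noteq> 0\<close> less(3)]] by (simp add: c_def)
        then show ?thesis using less(1) q less(3) m(3) by simp
      qed simp
      then show ?thesis
        using \<beta> by (simp add: map_poly_field_hom_diff[OF L(1) f less(2) polys_over_closed(5)[OF L(1) c m(1)]]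
            map_poly_field_hom_mult[OF L(1) f c m(1)])
    qed simp
  qed
  show ?thesis unfolding ring_graph_def
  proof (intro conjI allI impI ballI)
    fix q :: complex assume q: "q \<in> \<rat>"
    have "monom q 0 \<in> polys_over L" using q subfield_Rats[OF L(1)] by (intro polys_over_closed(6)[OF L(1)]) auto
    moreover have "poly (map_poly f (monom q 0)) \<beta> = q"
      using field_hom_Rats[OF L(1) f q] by (simp add: map_poly_monom field_hom_zero[OF L(1) f] poly_monom)
    moreover have "poly (monom q 0) x = q" by (simp add: poly_monom)
    ultimately show "(q, q) \<in> ?\<Gamma>" by (metis (mono_tags, lifting) mem_Collect_eq)
  next
    fix y a z b assume "(y, a) \<in> ?\<Gamma>" "(z, b) \<in> ?\<Gamma>"
    then obtain p q where pq: "p \<in> polys_over L" "q \<in> polys_over L" "y = poly p x" "a = poly (map_poly f p) \<beta>"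
      "z = poly q x" "b = poly (map_poly f q) \<beta>" by auto
    show "(y - z, a - b) \<in> ?\<Gamma>"
      using pq polys_over_closed(4)[OF L(1) pq(1,2)] map_poly_field_hom_diff[OF L(1) f pq(1,2)]
      by (intro CollectI exI[of _ "p - q"]) simp
    show "(y * z, a * b) \<in> ?\<Gamma>"
      using pq polys_over_closed(5)[OF L(1) pq(1,2)] map_poly_field_hom_mult[OF L(1) f pq(1,2)]
      by (intro CollectI exI[of _ "p * q"]) simp
  next
    show "a = 0" if "(0, a) \<in> ?\<Gamma>" for a using that key by auto
    show "Domain ?\<Gamma> \<subseteq> Qbar"
    proof
      fix y assume "y \<in> Domain ?\<Gamma>"
      then obtain p where "p \<in> polys_over L" "y = poly p x" by auto
      moreover then have "p \<in> polys_over Qbar" using L(2) by (auto simp: polys_over_def)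
      ultimately show "y \<in> Qbar" using poly_in_subfield[OF subfield_Qbar _ x] by simp
    qed
  qed
qed

lemma polys_over_const_var:
  assumes "subfield L CC" "field_hom L f"
  shows "c \<in> L \<Longrightarrow> monom c 0 \<in> polys_over L \<and> poly (monom c 0) x = c \<and> poly (map_poly f (monom c 0)) \<beta> = f c"
    "monom 1 1 \<in> polys_over L \<and> poly (monom 1 1) x = x \<and> poly (map_poly f (monom 1 1)) \<beta> = \<beta>"
  using polys_over_closed(6)[OF assms(1)] subfield_one[OF assms(1)]
  by (simp_all add: map_poly_monom field_hom_zero[OF assms] field_hom_one[OF assms] poly_monom)

lemma ring_graph_extends_to_Qbar:
  assumes "ring_graph \<Gamma>"
  obtains \<omega> where "field_hom Qbar \<omega>" "\<And>x a. (x, a) \<in> \<Gamma> \<Longrightarrow> \<omega> x = a"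
proof -
  define \<A> where "\<A> = {\<Delta>. ring_graph \<Delta> \<and> \<Gamma> \<subseteq> \<Delta>}"
  have "\<exists>M\<in>\<A>. \<forall>\<Delta>\<in>\<A>. M \<subseteq> \<Delta> \<longrightarrow> \<Delta> = M"
  proof (rule subset_Zorn_nonempty)
    show "\<A> \<noteq> {}" using assms by (auto simp: \<A>_def)
  next
    fix C assume C: "C \<noteq> {}" "subset.chain \<A> C"
    then have CA: "C \<subseteq> \<A>" by (auto simp: subset.chain_def)
    have two: "\<exists>\<Delta>\<in>C. p \<in> \<Delta> \<and> q \<in> \<Delta>" if "p \<in> \<Union>C" "q \<in> \<Union>C" for p q
      using that C(2) unfolding subset_chain_def by blast
    have g: "ring_graph \<Delta>" if "\<Delta> \<in> C" for \<Delta> using that CA by (auto simp: \<A>_def)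
    have "ring_graph (\<Union>C)" unfolding ring_graph_def
    proof (intro conjI allI impI ballI)
      show "(q, q) \<in> \<Union>C" if "q \<in> \<rat>" for q using g C(1) that unfolding ring_graph_def by blast
      show "a = 0" if "(0, a) \<in> \<Union>C" for a using g that unfolding ring_graph_def by blast
      show "Domain (\<Union>C) \<subseteq> Qbar" using g unfolding ring_graph_def by blast
      fix x a y b assume xy: "(x, a) \<in> \<Union>C" "(y, b) \<in> \<Union>C"
      obtain \<Delta> where \<Delta>: "\<Delta> \<in> C" "(x, a) \<in> \<Delta>" "(y, b) \<in> \<Delta>" using two[OF xy] by auto
      then have "(x - y, a - b) \<in> \<Delta>" "(x * y, a * b) \<in> \<Delta>" using g[OF \<Delta>(1)] unfolding ring_graph_def by blast+
      then show "(x - y, a - b) \<in> \<Union>C" "(x * y, a * b) \<in> \<Union>C" using \<Delta>(1) by auto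
    qed
    then show "\<Union>C \<in> \<A>" using CA C(1) by (auto simp: \<A>_def)
  qed
  then obtain M where "M \<in> \<A>" and maxA: "\<And>\<Delta>. \<Delta> \<in> \<A> \<Longrightarrow> M \<subseteq> \<Delta> \<Longrightarrow> \<Delta> = M" by auto
  then have M: "ring_graph M" "\<Gamma> \<subseteq> M" by (simp_all add: \<A>_def)
  obtain f where f: "subfield (Domain M) CC" "field_hom (Domain M) f" "M = {(x, f x) |x. x \<in> Domain M}"
    using ring_graph_hom[OF M(1)] by blast
  have dom: "Domain M \<subseteq> Qbar" using M(1) by (simp add: ring_graph_def)
  have "x \<in> Domain M" if x: "x \<in> Qbar" for x
  proof -
    obtain m where m: "m \<in> polys_over (Domain M)" "lead_coeff m = 1" "poly m x = 0"
      "\<And>p. p \<in> polys_over (Domain M) \<Longrightarrow> p \<noteq> 0 \<Longrightarrow> poly p x = 0 \<Longrightarrow> degree m \<le> degree p"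
      using min_poly_exists[OF f(1) x] by blast
    have "degree m > 0"
    proof (rule ccontr)
      assume "\<not> degree m > 0"
      then have "m = 1" using m(2) by (metis degree_0_id gr0I of_nat_0 one_pCons degree_eq_zeroE lead_coeff_pCons(2) pCons_0_0 coeff_pCons_0)
      then show False using m(3) by simp
    qed
    moreover have "degree (map_poly f m) = degree m"
      by (rule map_poly_degree_eq) (use m(2) field_hom_one[OF f(1,2)] in simp)
    ultimately obtain \<beta> where \<beta>: "poly (map_poly f m) \<beta> = 0"
      using alg_closed_imp_poly_has_root[of "map_poly f m"] by auto
    define \<Delta> where "\<Delta> = {(poly p x, poly (map_poly f p) \<beta>) |p. p \<in> polys_over (Domain M)}"
    have "ring_graph \<Delta>" unfolding \<Delta>_def by (rule simple_extension_graph[OF f(1) dom f(2) x m \<beta>])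
    moreover have sub: "M \<subseteq> \<Delta>"
    proof
      fix z assume "z \<in> M"
      then obtain c where c: "z = (c, f c)" "c \<in> Domain M" using f(3) by blast
      show "z \<in> \<Delta>" unfolding \<Delta>_def
        using polys_over_const_var(1)[OF f(1,2) c(2), of x \<beta>] c(1) by (intro CollectI exI[of _ "monom c 0"]) simp
    qed
    ultimately have "\<Delta> = M" using maxA[of \<Delta>] M(2) by (simp add: \<A>_def)
    moreover have "(x, \<beta>) \<in> \<Delta>" unfolding \<Delta>_def
      using polys_over_const_var(2)[OF f(1,2), of x \<beta>] by (intro CollectI exI[of _ "monom 1 1"]) simp
    ultimately show ?thesis by auto
  qed
  then have "Domain M = Qbar" using dom by blast
  moreover have "f x = a" if "(x, a) \<in> \<Gamma>" for x a
  proof -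
    have "(x, a) \<in> {(x, f x) |x. x \<in> Domain M}" unfolding f(3)[symmetric] using that M(2) by blast
    then show ?thesis by auto
  qed
  ultimately show thesis using that[of f] f(2) by simp
qed

section \<open>Galois groups of normal fields\<close>

lemma Gal_mem_iff:
  "\<sigma> \<in> carrier (Gal L k) \<longleftrightarrow> \<sigma> \<in> extensional L \<and> bij_betw \<sigma> L L \<and> field_hom L \<sigma> \<and> (\<forall>x\<in>k. \<sigma> x = x)"
  by (auto simp: Gal_def Bij_def ring_hom_def field_hom_def dest: bij_betwE)

lemma Gal_memD:
  assumes "\<sigma> \<in> carrier (Gal L k)"
  shows "field_hom L \<sigma>" "x \<in> L \<Longrightarrow> \<sigma> x \<in> L" "x \<in> k \<Longrightarrow> \<sigma> x = x" "bij_betw \<sigma> L L" "\<sigma> \<in> extensional L"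
  using assms by (auto simp: Gal_mem_iff dest: bij_betwE)

lemma Gal_eqI:
  assumes "\<sigma> \<in> carrier (Gal L k)" "\<tau> \<in> carrier (Gal L k')" "\<And>x. x \<in> L \<Longrightarrow> \<sigma> x = \<tau> x"
  shows "\<sigma> = \<tau>"
  using assms by (auto simp: Gal_mem_iff intro: extensionalityI)

lemma Gal_mono: "k \<subseteq> k' \<Longrightarrow> carrier (Gal L k') \<subseteq> carrier (Gal L k)"
  unfolding subset_iff Gal_mem_iff by blast

context
  fixes L k :: "complex set"
  assumes L: "subfield L CC" and kL: "k \<subseteq> L"
begin

lemma Gal_subgroup: "subgroup (carrier (Gal L k)) (BijGroup L)"
proof (rule group.subgroupI[OF group_BijGroup])
  have 1: "1 \<in> L" by (rule subfield_one[OF L])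
  show "carrier (Gal L k) \<subseteq> carrier (BijGroup L)" by (auto simp: Gal_def BijGroup_def)
  have "(\<lambda>x\<in>L. x) \<in> carrier (Gal L k)"
    unfolding Gal_mem_iff using kL 1
    by (auto simp: field_hom_def bij_betw_def inj_on_def subfield_add[OF L] subfield_mult[OF L])
  then show "carrier (Gal L k) \<noteq> {}" by blast
next
  fix \<sigma> assume s: "\<sigma> \<in> carrier (Gal L k)"
  have sB: "\<sigma> \<in> Bij L" using s by (simp add: Gal_def)
  have img: "\<sigma> ` L = L" and inj: "inj_on \<sigma> L" using Gal_memD(4)[OF s] by (simp_all add: bij_betw_def)
  define \<rho> where "\<rho> = (\<lambda>x\<in>L. inv_into L \<sigma> x)"
  have \<rho>: "\<rho> \<in> Bij L" unfolding \<rho>_def by (rule restrict_inv_into_Bij[OF sB])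
  have r: "\<rho> (\<sigma> x) = x" if "x \<in> L" for x
    using that inv_into_f_f[OF inj that] Gal_memD(2)[OF s that] by (simp add: \<rho>_def)
  have ex: "\<exists>u\<in>L. \<sigma> u = x" if "x \<in> L" for x using that img by force
  have "field_hom L \<rho>" unfolding field_hom_def
  proof (intro conjI ballI)
    show "\<rho> 1 = 1" using r[OF subfield_one[OF L]] field_hom_one[OF L Gal_memD(1)[OF s]] by simp
    fix x y assume "x \<in> L" "y \<in> L"
    then obtain u v where uv: "u \<in> L" "\<sigma> u = x" "v \<in> L" "\<sigma> v = y" using ex by blast
    have "\<rho> (x + y) = u + v"
      using r[OF subfield_add[OF L uv(1,3)]] field_hom_add[OF L Gal_memD(1)[OF s] uv(1,3)] uv by simp
    then show "\<rho> (x + y) = \<rho> x + \<rho> y" using r uv by auto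
    have "\<rho> (x * y) = u * v"
      using r[OF subfield_mult[OF L uv(1,3)]] field_hom_mult[OF L Gal_memD(1)[OF s] uv(1,3)] uv by simp
    then show "\<rho> (x * y) = \<rho> x * \<rho> y" using r uv by auto
  qed
  moreover have "\<rho> x = x" if "x \<in> k" for x using r[of x] Gal_memD(3)[OF s that] that kL by auto
  ultimately have "\<rho> \<in> carrier (Gal L k)" using \<rho> by (auto simp: Gal_mem_iff Bij_def)
  then show "inv\<^bsub>BijGroup L\<^esub> \<sigma> \<in> carrier (Gal L k)" using inv_BijGroup[OF sB] by (simp add: \<rho>_def)
  fix \<tau> assume t: "\<tau> \<in> carrier (Gal L k)"
  have tB: "\<tau> \<in> Bij L" using t by (simp add: Gal_def)
  have "compose L \<sigma> \<tau> \<in> Bij L" by (rule compose_Bij[OF sB tB])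
  moreover have "field_hom L (compose L \<sigma> \<tau>)"
    unfolding field_hom_def using Gal_memD(2)[OF s] Gal_memD(2)[OF t]
    by (simp add: compose_def subfield_one[OF L] subfield_add[OF L] subfield_mult[OF L] field_hom_one[OF L Gal_memD(1)[OF s]]
        field_hom_one[OF L Gal_memD(1)[OF t]] field_hom_add[OF L Gal_memD(1)[OF s]] field_hom_add[OF L Gal_memD(1)[OF t]]
        field_hom_mult[OF L Gal_memD(1)[OF s]] field_hom_mult[OF L Gal_memD(1)[OF t]])
  moreover have "compose L \<sigma> \<tau> x = x" if "x \<in> k" for x
    using that kL Gal_memD(3)[OF s that] Gal_memD(3)[OF t that] by (auto simp: compose_def)
  ultimately have "compose L \<sigma> \<tau> \<in> carrier (Gal L k)" by (auto simp: Gal_mem_iff Bij_def)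
  then show "\<sigma> \<otimes>\<^bsub>BijGroup L\<^esub> \<tau> \<in> carrier (Gal L k)" using sB tB by (simp add: BijGroup_def)
qed

lemma group_Gal: "group (Gal L k)"
proof -
  have "Gal L k = (BijGroup L)\<lparr>carrier := carrier (Gal L k)\<rparr>" by (simp add: Gal_def)
  then show ?thesis using group.subgroup_imp_group[OF group_BijGroup Gal_subgroup] by simp
qed

lemma Gal_mult_apply:
  assumes "\<sigma> \<in> carrier (Gal L k)" "\<tau> \<in> carrier (Gal L k)" "x \<in> L"
  shows "(\<sigma> \<otimes>\<^bsub>Gal L k\<^esub> \<tau>) x = \<sigma> (\<tau> x)"
proof -
  have "\<sigma> \<in> Bij L" "\<tau> \<in> Bij L" using assms by (simp_all add: Gal_def)
  then show ?thesis using assms(3) by (simp add: Gal_def BijGroup_def compose_def)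
qed

lemma Gal_one_apply: "x \<in> L \<Longrightarrow> \<one>\<^bsub>Gal L k\<^esub> x = x"
  by (simp add: Gal_def BijGroup_def)

lemma Gal_inv_apply:
  assumes "\<sigma> \<in> carrier (Gal L k)" "x \<in> L"
  shows "(inv\<^bsub>Gal L k\<^esub> \<sigma>) (\<sigma> x) = x" "\<sigma> ((inv\<^bsub>Gal L k\<^esub> \<sigma>) x) = x"
proof -
  interpret G: group "Gal L k" by (rule group_Gal)
  show "(inv\<^bsub>Gal L k\<^esub> \<sigma>) (\<sigma> x) = x"
    using Gal_mult_apply[of "inv\<^bsub>Gal L k\<^esub> \<sigma>" \<sigma> x] assms by (simp add: Gal_one_apply)
  show "\<sigma> ((inv\<^bsub>Gal L k\<^esub> \<sigma>) x) = x"
    using Gal_mult_apply[of \<sigma> "inv\<^bsub>Gal L k\<^esub> \<sigma>" x] assms by (simp add: Gal_one_apply)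
qed

end

lemma subfield_fixed_field:
  assumes "subfield L CC" "\<And>\<sigma>. \<sigma> \<in> H \<Longrightarrow> field_hom L \<sigma>"
  shows "subfield (fixed_field L H) CC"
  by (rule subfield_CC_I)
    (auto simp: fixed_field_def subfield_one[OF assms(1)] subfield_diff[OF assms(1)] subfield_mult[OF assms(1)]
      subfield_inverse[OF assms(1)] field_hom_one[OF assms(1) assms(2)] field_hom_diff[OF assms(1) assms(2)]
      field_hom_mult[OF assms(1) assms(2)] field_hom_inverse[OF assms(1) assms(2)])

text \<open>An embedding maps the finite set of roots of a rational polynomial injectively into itself, hence onto
itself. This gives surjectivity.\<close>

lemma field_hom_Qbar_in_Gal:
  assumes "field_hom Qbar \<omega>"
  shows "restrict \<omega> Qbar \<in> carrier (Gal Qbar \<rat>)"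
proof -
  have conj: "poly (map_poly of_int p) (\<omega> x) = 0" if "poly (map_poly of_int p) x = 0" "x \<in> Qbar" for p :: "int poly" and x
  proof -
    have "map_poly of_int p \<in> polys_over Qbar"
      by (simp add: polys_over_def coeff_map_poly subfield_of_int[OF subfield_Qbar])
    moreover have "map_poly \<omega> (map_poly of_int p) = map_poly of_int p"
      by (rule poly_eqI) (simp add: coeff_map_poly field_hom_zero[OF subfield_Qbar assms] field_hom_of_int[OF subfield_Qbar assms])
    ultimately show ?thesis
      using field_hom_poly[OF subfield_Qbar assms, of "map_poly of_int p" x] that by (simp add: field_hom_zero[OF subfield_Qbar assms])
  qed
  have alg: "\<exists>p::int poly. p \<noteq> 0 \<and> poly (map_poly of_int p) x = 0" if "x \<in> Qbar" for x
    using that unfolding Qbar_def by (auto elim: algebraicE')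
  have root: "x \<in> Qbar" if "p \<noteq> 0" "poly (map_poly of_int p) x = 0" for p :: "int poly" and x
    unfolding Qbar_def using that
    by (auto intro!: algebraicI[of "map_poly of_int p"] simp: coeff_map_poly map_poly_eq_0_iff)
  have into: "\<omega> x \<in> Qbar" if "x \<in> Qbar" for x using alg[OF that] conj root that by blast
  have onto: "x \<in> \<omega> ` Qbar" if x: "x \<in> Qbar" for x
  proof -
    obtain p :: "int poly" where p: "p \<noteq> 0" "poly (map_poly of_int p) x = 0" using alg[OF x] by blast
    define R where "R = {z. poly (map_poly complex_of_int p) z = 0}"
    have R: "finite R" "R \<subseteq> Qbar" unfolding R_def
      using p(1) root by (auto intro!: poly_roots_finite simp: map_poly_eq_0_iff)
    have "\<omega> ` R \<subseteq> R" using conj R(2) by (auto simp: R_def)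
    then have "\<omega> ` R = R"
      by (intro endo_inj_surj R(1) inj_on_subset[OF field_hom_inj[OF subfield_Qbar assms] R(2)])
    moreover have "x \<in> R" using p by (simp add: R_def)
    ultimately show ?thesis using R(2) by blast
  qed
  have "bij_betw \<omega> Qbar Qbar"
    unfolding bij_betw_def using field_hom_inj[OF subfield_Qbar assms] into onto by blast
  moreover have "field_hom Qbar (restrict \<omega> Qbar)"
    using assms by (simp add: field_hom_def subfield_one[OF subfield_Qbar] subfield_add[OF subfield_Qbar] subfield_mult[OF subfield_Qbar])
  ultimately show ?thesis
    using field_hom_Rats[OF subfield_Qbar assms] subfield_Rats[OF subfield_Qbar]
    by (auto simp: Gal_mem_iff cong: bij_betw_cong)
qed

lemma ring_graph_extends_to_Gal:
  assumes "ring_graph \<Gamma>"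
  obtains \<omega> where "\<omega> \<in> carrier (Gal Qbar \<rat>)" "\<And>x a. (x, a) \<in> \<Gamma> \<Longrightarrow> \<omega> x = a"
proof -
  obtain f where f: "field_hom Qbar f" "\<And>x a. (x, a) \<in> \<Gamma> \<Longrightarrow> f x = a"
    using ring_graph_extends_to_Qbar[OF assms] by blast
  have "x \<in> Qbar" if "(x, a) \<in> \<Gamma>" for x a using assms that by (auto simp: ring_graph_def)
  then show thesis using that[OF field_hom_Qbar_in_Gal[OF f(1)]] f(2) by simp
qed

lemma field_hom_extends:
  assumes "subfield L CC" "L \<subseteq> Qbar" "field_hom L f"
  obtains \<omega> where "\<omega> \<in> carrier (Gal Qbar \<rat>)" "\<And>x. x \<in> L \<Longrightarrow> \<omega> x = f x"
proof -
  have "ring_graph {(x, f x) |x. x \<in> L}"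
    unfolding ring_graph_def using assms(2) subfield_Rats[OF assms(1)] field_hom_Rats[OF assms(1,3)]
    by (auto simp: field_hom_diff[OF assms(1,3)] field_hom_mult[OF assms(1,3)] subfield_diff[OF assms(1)]
        subfield_mult[OF assms(1)] field_hom_zero[OF assms(1,3)])
  then show thesis using ring_graph_extends_to_Gal that by (smt (verit) mem_Collect_eq)
qed

text \<open>The minimal polynomial of \<open>x\<close> over \<open>k\<close> has degree at least two and, as its derivative does not vanish at
\<open>x\<close>, a simple root at \<open>x\<close>. So it has another root \<open>\<beta>\<close>, and mapping \<open>x\<close> to \<open>\<beta>\<close> defines an embedding.\<close>

lemma moved_by_Gal:
  assumes k: "subfield k CC" "k \<subseteq> Qbar" and x: "x \<in> Qbar" "x \<notin> k"
  obtains \<omega> where "\<omega> \<in> carrier (Gal Qbar \<rat>)" "\<And>y. y \<in> k \<Longrightarrow> \<omega> y = y" "\<omega> x \<noteq> x"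
proof -
  obtain m where m: "m \<in> polys_over k" "lead_coeff m = 1" "poly m x = 0"
    "\<And>p. p \<in> polys_over k \<Longrightarrow> p \<noteq> 0 \<Longrightarrow> poly p x = 0 \<Longrightarrow> degree m \<le> degree p"
    using min_poly_exists[OF k(1) x(1)] by blast
  have idh: "field_hom k (\<lambda>x. x)" by (simp add: field_hom_def)
  obtain q where q: "m = [:- x, 1:] * q" using m(3) by (auto simp: poly_eq_0_iff_dvd dvd_def)
  have "lead_coeff m = lead_coeff q" unfolding q lead_coeff_mult by simp
  then have "lead_coeff q = 1" using m(2) by simp
  then have "q \<noteq> 0" by auto
  have "degree q > 0"
  proof (rule ccontr)
    assume "\<not> degree q > 0"
    then have "q = 1" using \<open>lead_coeff q = 1\<close> by (auto elim!: degree_eq_zeroE simp: one_pCons)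
    then have "coeff m 0 = - x" using q by simp
    then have "- x \<in> k" using m(1) by (metis (mono_tags) polys_over_def mem_Collect_eq)
    then show False using x(2) subfield_uminus[OF k(1)] by fastforce
  qed
  then obtain \<beta> where \<beta>: "poly q \<beta> = 0" using alg_closed_imp_poly_has_root[of q] by auto
  have "\<beta> \<noteq> x"
  proof
    assume "\<beta> = x"
    then have "poly (pderiv m) x = 0" using \<beta> by (simp add: q pderiv_mult pderiv_pCons del: mult_pCons_left)
    moreover have "degree m = Suc (degree q)" using q \<open>q \<noteq> 0\<close> by (simp add: degree_mult_eq del: mult_pCons_left)
    moreover from this have "pderiv m \<noteq> 0" by (simp add: pderiv_eq_0_iff)
    ultimately show False using m(4)[OF polys_over_closed(7)[OF k(1) m(1)]] by (simp add: degree_pderiv)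
  qed
  have m\<beta>: "poly (map_poly (\<lambda>x. x) m) \<beta> = 0" using q \<beta> by simp
  have g: "ring_graph {(poly p x, poly (map_poly (\<lambda>x. x) p) \<beta>) |p. p \<in> polys_over k}"
    by (rule simple_extension_graph[OF k idh x(1) m m\<beta>])
  obtain \<omega> where \<omega>: "\<omega> \<in> carrier (Gal Qbar \<rat>)"
    "\<And>y a. (y, a) \<in> {(poly p x, poly (map_poly (\<lambda>x. x) p) \<beta>) |p. p \<in> polys_over k} \<Longrightarrow> \<omega> y = a"
    by (rule ring_graph_extends_to_Gal[OF g], rule that)
  show thesis
  proof (rule that[OF \<omega>(1)])
    show "\<omega> y = y" if "y \<in> k" for y
      using polys_over_const_var(1)[OF k(1) idh that, of x \<beta>] by (intro \<omega>(2) CollectI exI[of _ "monom y 0"]) simp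
    have "\<omega> x = \<beta>"
      using polys_over_const_var(2)[OF k(1) idh, of x \<beta>] by (intro \<omega>(2) CollectI exI[of _ "monom 1 1"]) simp
    then show "\<omega> x \<noteq> x" using \<open>\<beta> \<noteq> x\<close> by simp
  qed
qed

lemma finite_conjugates:
  assumes "x \<in> Qbar"
  shows "finite {f x |f L. subfield L CC \<and> x \<in> L \<and> field_hom L f}"
proof -
  obtain p :: "int poly" where p: "p \<noteq> 0" "poly (map_poly of_int p) x = 0"
    using assms unfolding Qbar_def by (auto elim: algebraicE')
  have "poly (map_poly of_int p) (f x) = 0" if "subfield L CC" "x \<in> L" "field_hom L f" for f L
  proof -
    have "map_poly of_int p \<in> polys_over L"
      by (simp add: polys_over_def coeff_map_poly subfield_of_int[OF that(1)])
    moreover have "map_poly f (map_poly of_int p) = map_poly of_int p"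
      by (rule poly_eqI) (simp add: coeff_map_poly field_hom_zero[OF that(1,3)] field_hom_of_int[OF that(1,3)])
    ultimately show ?thesis
      using field_hom_poly[OF that(1,3), of "map_poly of_int p" x] that p by (simp add: field_hom_zero[OF that(1,3)])
  qed
  then have "{f x |f L. subfield L CC \<and> x \<in> L \<and> field_hom L f} \<subseteq> {z. poly (map_poly complex_of_int p) z = 0}" by auto
  moreover have "finite {z. poly (map_poly complex_of_int p) z = 0}"
    using p(1) by (intro poly_roots_finite) (simp add: map_poly_eq_0_iff)
  ultimately show ?thesis by (rule finite_subset)
qed

definition normal_field :: "complex set \<Rightarrow> bool"
  where "normal_field L \<longleftrightarrow> subfield L CC \<and> L \<subseteq> Qbar \<and> (\<forall>\<omega>\<in>carrier (Gal Qbar \<rat>). \<omega> ` L \<subseteq> L)"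

lemma Qbar_Gal_hom: "\<omega> \<in> carrier (Gal Qbar \<rat>) \<Longrightarrow> L \<subseteq> Qbar \<Longrightarrow> field_hom L \<omega>"
  using Gal_memD(1)[of \<omega> Qbar \<rat>] by (auto simp: field_hom_def)

lemma group_Gal_Qbar: "group (Gal Qbar \<rat>)"
  by (rule group_Gal[OF subfield_Qbar subfield_Rats[OF subfield_Qbar]])

lemmas Gal_Qbar_mult = Gal_mult_apply[OF subfield_Qbar subfield_Rats[OF subfield_Qbar]]
lemmas Gal_Qbar_inv = Gal_inv_apply[OF subfield_Qbar subfield_Rats[OF subfield_Qbar]]

lemma normal_field_restrict:
  assumes L: "normal_field L" and \<omega>: "\<omega> \<in> carrier (Gal Qbar \<rat>)" "\<And>x. x \<in> k \<Longrightarrow> \<omega> x = x" and k: "k \<subseteq> L"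
  shows "restrict \<omega> L \<in> carrier (Gal L k)"
proof -
  have sL: "subfield L CC" "L \<subseteq> Qbar" and nL: "\<And>\<omega> x. \<omega> \<in> carrier (Gal Qbar \<rat>) \<Longrightarrow> x \<in> L \<Longrightarrow> \<omega> x \<in> L"
    using L by (auto simp: normal_field_def)
  have inv: "inv\<^bsub>Gal Qbar \<rat>\<^esub> \<omega> \<in> carrier (Gal Qbar \<rat>)" using group.inv_closed[OF group_Gal_Qbar \<omega>(1)] .
  have "x \<in> \<omega> ` L" if x: "x \<in> L" for x
    using Gal_Qbar_inv(2)[OF \<omega>(1), of x] nL[OF inv x] sL(2) x by (metis image_eqI subsetD)
  moreover have "inj_on \<omega> L" by (rule field_hom_inj[OF sL(1) Qbar_Gal_hom[OF \<omega>(1) sL(2)]])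
  ultimately have "bij_betw \<omega> L L" using nL[OF \<omega>(1)] by (auto simp: bij_betw_def)
  moreover have "field_hom L (restrict \<omega> L)"
    using Qbar_Gal_hom[OF \<omega>(1) sL(2)] by (simp add: field_hom_def subfield_one[OF sL(1)] subfield_add[OF sL(1)] subfield_mult[OF sL(1)])
  ultimately show ?thesis using \<omega>(2) k by (auto simp: Gal_mem_iff cong: bij_betw_cong)
qed

lemma Gal_lift:
  assumes "subfield L CC" "L \<subseteq> Qbar" "\<tau> \<in> carrier (Gal L k)"
  obtains \<omega> where "\<omega> \<in> carrier (Gal Qbar \<rat>)" "\<And>x. x \<in> L \<Longrightarrow> \<omega> x = \<tau> x"
  using field_hom_extends[OF assms(1,2) Gal_memD(1)[OF assms(3)]] by blast

lemma normal_field_fixed: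
  assumes L: "normal_field L" and k: "subfield k CC" "k \<subseteq> L"
  shows "fixed_field L (carrier (Gal L k)) = k"
proof (intro equalityI subsetI)
  fix x assume "x \<in> k" then show "x \<in> fixed_field L (carrier (Gal L k))"
    using k(2) by (auto simp: fixed_field_def Gal_mem_iff)
next
  fix x assume x: "x \<in> fixed_field L (carrier (Gal L k))"
  then have xL: "x \<in> L" by (simp add: fixed_field_def)
  have LQ: "L \<subseteq> Qbar" using L by (simp add: normal_field_def)
  show "x \<in> k"
  proof (rule ccontr)
    assume "x \<notin> k"
    then obtain \<omega> where \<omega>: "\<omega> \<in> carrier (Gal Qbar \<rat>)" "\<And>y. y \<in> k \<Longrightarrow> \<omega> y = y" "\<omega> x \<noteq> x"
      using moved_by_Gal[OF k(1) _ _ \<open>x \<notin> k\<close>] k(2) LQ xL by blast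
    have "restrict \<omega> L x = x"
      using normal_field_restrict[OF L \<omega>(1,2) k(2)] x unfolding fixed_field_def by blast
    then show False using \<omega>(3) xL by simp
  qed
qed

text \<open>The group \<open>H\<close> permutes the orbit of \<open>\<theta>\<close>, so it fixes the coefficients of the polynomial with these roots.\<close>

lemma orbit_poly_over_fixed_field:
  assumes L: "subfield L CC" and \<theta>: "\<theta> \<in> L" and H: "subgroup H (Gal L k)" and k: "k \<subseteq> L"
    and fin: "finite ((\<lambda>\<tau>. \<tau> \<theta>) ` H)"
  shows "(\<Prod>y\<in>(\<lambda>\<tau>. \<tau> \<theta>) ` H. [:- y, 1:]) \<in> polys_over (fixed_field L H)"
proof -
  have HG: "\<tau> \<in> carrier (Gal L k)" if "\<tau> \<in> H" for \<tau> using subgroup.mem_carrier[OF H that] .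
  have sub: "(\<lambda>\<tau>. \<tau> \<theta>) ` H \<subseteq> L" using HG Gal_memD(2) \<theta> by blast
  have "f (coeff (\<Prod>y\<in>(\<lambda>\<tau>. \<tau> \<theta>) ` H. [:- y, 1:]) i) = coeff (\<Prod>y\<in>(\<lambda>\<tau>. \<tau> \<theta>) ` H. [:- y, 1:]) i" if f: "f \<in> H" for f i
  proof (rule field_hom_fixes_orbit_poly[OF L Gal_memD(1)[OF HG[OF f]] sub fin], safe)
    fix \<tau> assume "\<tau> \<in> H"
    then have "f (\<tau> \<theta>) = (f \<otimes>\<^bsub>Gal L k\<^esub> \<tau>) \<theta>" "f \<otimes>\<^bsub>Gal L k\<^esub> \<tau> \<in> H"
      using Gal_mult_apply[OF L k HG[OF f] HG _ ] \<theta> subgroup.m_closed[OF H f] by auto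
    then show "f (\<tau> \<theta>) \<in> (\<lambda>\<tau>. \<tau> \<theta>) ` H" by blast
  qed
  then show ?thesis
    using polys_over_prod_linear[OF L sub] by (auto simp: polys_over_def fixed_field_def)
qed

text \<open>The polynomial whose roots are the \<open>H\<close>-orbit of \<open>\<theta>\<close> has coefficients fixed by \<open>H\<close>, hence by \<open>\<sigma>\<close>.
So \<open>\<sigma>\<close> maps its root \<open>\<theta>\<close> to some \<open>\<tau> \<theta>\<close> with \<open>\<tau>\<close> in \<open>H\<close>, and \<open>\<sigma> = \<tau>\<close> because
elements of the Galois group are determined by their values at \<open>\<theta>\<close>.\<close>

lemma artin:
  assumes L: "subfield L CC" "L \<subseteq> Qbar" and k: "k \<subseteq> L" and \<theta>: "\<theta> \<in> L"
    and sep: "inj_on (\<lambda>\<tau>. \<tau> \<theta>) (carrier (Gal L k))" and H: "subgroup H (Gal L k)"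
    and \<sigma>: "\<sigma> \<in> carrier (Gal L k)" "\<And>x. x \<in> fixed_field L H \<Longrightarrow> \<sigma> x = x"
  shows "\<sigma> \<in> H"
proof -
  have HG: "\<tau> \<in> carrier (Gal L k)" if "\<tau> \<in> H" for \<tau> using subgroup.mem_carrier[OF H that] .
  have fin: "finite ((\<lambda>\<tau>. \<tau> \<theta>) ` H)"
    by (rule finite_subset[OF _ finite_conjugates[of \<theta>]]) (use HG Gal_memD(1) L \<theta> in blast)+
  define P where "P = (\<Prod>y\<in>(\<lambda>\<tau>. \<tau> \<theta>) ` H. [:- y, 1:])"
  have P: "P \<in> polys_over (fixed_field L H)" unfolding P_def by (rule orbit_poly_over_fixed_field[OF L(1) \<theta> H k fin])
  then have PL: "P \<in> polys_over L" by (auto simp: polys_over_def fixed_field_def)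
  have "\<one>\<^bsub>Gal L k\<^esub> \<in> H" "\<one>\<^bsub>Gal L k\<^esub> \<theta> = \<theta>" using subgroup.one_closed[OF H] Gal_one_apply[OF L(1) k \<theta>] by auto
  then have "\<theta> \<in> (\<lambda>\<tau>. \<tau> \<theta>) ` H" by (metis image_eqI)
  then have root: "poly P \<theta> = 0" unfolding P_def using fin by (auto simp: poly_prod)
  have "map_poly \<sigma> P = P"
    by (rule poly_eqI) (use \<sigma>(2) P in \<open>simp add: coeff_map_poly field_hom_zero[OF L(1) Gal_memD(1)[OF \<sigma>(1)]] polys_over_def\<close>)
  then have "poly P (\<sigma> \<theta>) = 0"
    using field_hom_poly[OF L(1) Gal_memD(1)[OF \<sigma>(1)] PL \<theta>] root field_hom_zero[OF L(1) Gal_memD(1)[OF \<sigma>(1)]] by simp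
  then obtain \<tau> where "\<tau> \<in> H" "\<sigma> \<theta> = \<tau> \<theta>" unfolding P_def using fin by (auto simp: poly_prod)
  then show ?thesis using inj_onD[OF sep, of \<sigma> \<tau>] \<sigma>(1) HG by simp
qed

text \<open>The powers of \<open>\<theta>\<close> below the order \<open>n\<close> of the Galois group form a basis. They are independent because a
polynomial over \<open>k\<close> that vanishes at \<open>\<theta>\<close> vanishes at its \<open>n\<close> conjugates. They span the ring
generated by \<open>\<theta>\<close> because \<open>\<theta>\<close> is a root of a polynomial of degree \<open>n\<close> over \<open>k\<close>. That ring is a
field, and it is all of \<open>K\<close>, as otherwise some nontrivial element of the Galois group would fix
\<open>\<theta>\<close>.\<close>

lemma dimension_eq_card_Gal:
  assumes K: "normal_field K" and k: "subfield k CC" "k \<subseteq> K" and \<theta>: "\<theta> \<in> K"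
    and sep: "inj_on (\<lambda>\<tau>. \<tau> \<theta>) (carrier (Gal K k))"
  shows "finite (carrier (Gal K k))" "ring.dimension CC (card (carrier (Gal K k))) k K"
proof -
  interpret CC: field CC by (rule field_CC)
  have sK: "subfield K CC" "K \<subseteq> Qbar" using K by (auto simp: normal_field_def)
  interpret G: group "Gal K k" by (rule group_Gal[OF sK(1) k(2)])
  define O\<theta> where "O\<theta> = (\<lambda>\<tau>. \<tau> \<theta>) ` carrier (Gal K k)"
  have finO: "finite O\<theta>" unfolding O\<theta>_def
    by (rule finite_subset[OF _ finite_conjugates[of \<theta>]]) (use Gal_memD(1) sK \<theta> in blast)+
  then show fin: "finite (carrier (Gal K k))" using finite_image_iff[OF sep] by (simp add: O\<theta>_def)
  define n where "n = card (carrier (Gal K k))"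
  have n: "card O\<theta> = n" using card_image[OF sep] by (simp add: O\<theta>_def n_def)
  define P where "P = (\<Prod>y\<in>O\<theta>. [:- y, 1:])"
  have Pk: "P \<in> polys_over k"
    using orbit_poly_over_fixed_field[OF sK(1) \<theta> G.subgroup_self k(2)] finO
    by (simp add: P_def O\<theta>_def normal_field_fixed[OF K k])
  have "degree P = n" using n by (simp add: P_def degree_prod_eq_sum_degree)
  moreover have "lead_coeff P = 1" unfolding P_def lead_coeff_prod by simp
  ultimately have Pdeg: "degree P = n" "lead_coeff P = 1" by blast+
  have "\<theta> \<in> O\<theta>" unfolding O\<theta>_def using Gal_one_apply[OF sK(1) k(2) \<theta>] G.one_closed by (metis image_eqI)
  then have root: "poly P \<theta> = 0" unfolding P_def using finO by (auto simp: poly_prod)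
  \<comment> \<open>The span of the powers of \<open>\<theta>\<close> with exponents below \<open>j\<close>.\<close>
  define E where "E j = {poly p \<theta> |p. p \<in> polys_over k \<and> (\<forall>i\<ge>j. coeff p i = 0)}" for j :: nat
  have E0: "E 0 = {0}"
  proof -
    have "p = 0" if "\<forall>i. coeff p i = 0" for p :: "complex poly" using that by (simp add: poly_eq_iff)
    then have "poly p \<theta> = 0" if "\<forall>i\<ge>0. coeff p i = 0" for p using that by (metis le0 poly_0)
    then have "E 0 \<subseteq> {0}" unfolding E_def by blast
    moreover have "poly 0 \<theta> \<in> E 0" unfolding E_def using polys_over_closed(1)[OF k(1)] by (intro CollectI exI[of _ 0]) simp
    ultimately show ?thesis by auto
  qed
  have Esuc: "E (Suc j) = CC.line_extension k (\<theta> ^ j) (E j)" for j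
  proof (intro equalityI subsetI)
    fix y assume "y \<in> E (Suc j)"
    then obtain p where p: "p \<in> polys_over k" "\<forall>i\<ge>Suc j. coeff p i = 0" "y = poly p \<theta>" by (auto simp: E_def)
    define q where "q = p - monom (coeff p j) j"
    have c: "coeff p j \<in> k" using p(1) by (simp add: polys_over_def)
    have "q \<in> polys_over k" unfolding q_def by (intro polys_over_closed(4,6)[OF k(1)] p(1) c)
    moreover have "\<forall>i\<ge>j. coeff q i = 0" using p(2) by (auto simp: q_def not_less_eq_eq)
    ultimately have "poly q \<theta> \<in> E j" by (auto simp: E_def)
    moreover have "y = coeff p j * \<theta> ^ j + poly q \<theta>" by (simp add: q_def p(3) poly_monom)
    ultimately show "y \<in> CC.line_extension k (\<theta> ^ j) (E j)" using c by (auto simp: CC.line_extension_mem_iff)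
  next
    fix y assume "y \<in> CC.line_extension k (\<theta> ^ j) (E j)"
    then obtain c q where q: "c \<in> k" "q \<in> polys_over k" "\<forall>i\<ge>j. coeff q i = 0" "y = c * \<theta> ^ j + poly q \<theta>"
      by (auto simp: CC.line_extension_mem_iff E_def)
    have "monom c j + q \<in> polys_over k" by (intro polys_over_closed(3,6)[OF k(1)] q)
    moreover have "\<forall>i\<ge>Suc j. coeff (monom c j + q) i = 0" using q(3) by simp
    moreover have "y = poly (monom c j + q) \<theta>" by (simp add: q(4) poly_monom)
    ultimately show "y \<in> E (Suc j)" unfolding E_def by blast
  qed
  have indep: "\<theta> ^ j \<notin> E j" if "j < n" for j
  proof
    assume "\<theta> ^ j \<in> E j"
    then obtain q where q: "q \<in> polys_over k" "\<forall>i\<ge>j. coeff q i = 0" "\<theta> ^ j = poly q \<theta>" by (auto simp: E_def)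
    define p where "p = monom 1 j - q"
    have p: "p \<in> polys_over k" unfolding p_def by (intro polys_over_closed(4,6)[OF k(1)] q subfield_one[OF k(1)])
    have "coeff p j = 1" using q(2) by (simp add: p_def)
    then have "p \<noteq> 0" by auto
    have "degree p \<le> j" by (rule degree_le) (use q(2) in \<open>auto simp: p_def\<close>)
    have pr: "poly p \<theta> = 0" using q(3) by (simp add: p_def poly_monom)
    have "O\<theta> \<subseteq> {z. poly p z = 0}"
    proof
      fix z assume "z \<in> O\<theta>"
      then obtain \<tau> where t: "\<tau> \<in> carrier (Gal K k)" "z = \<tau> \<theta>" by (auto simp: O\<theta>_def)
      have "map_poly \<tau> p = p"
        by (rule poly_eqI) (use p Gal_memD(3)[OF t(1)] in \<open>simp add: coeff_map_poly field_hom_zero[OF sK(1) Gal_memD(1)[OF t(1)]] polys_over_def\<close>)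
      moreover have "p \<in> polys_over K" using p k(2) by (auto simp: polys_over_def)
      ultimately show "z \<in> {z. poly p z = 0}"
        using field_hom_poly[OF sK(1) Gal_memD(1)[OF t(1)] _ \<theta>, of p] pr t(2)
        by (simp add: field_hom_zero[OF sK(1) Gal_memD(1)[OF t(1)]])
    qed
    then have "n \<le> card {z. poly p z = 0}" using n card_mono[OF poly_roots_finite[OF \<open>p \<noteq> 0\<close>]] by metis
    also have "\<dots> \<le> degree p" by (rule card_poly_roots_bound[OF \<open>p \<noteq> 0\<close>])
    finally show False using \<open>degree p \<le> j\<close> that by simp
  qed
  have dim: "j \<le> n \<Longrightarrow> CC.dimension j k (E j)" for j
  proof (induction j)
    case 0 show ?case unfolding E0 using CC.zero_dim[of k] by simp
  next
    case (Suc j) then show ?case unfolding Esuc using indep by (intro CC.Suc_dim) simp_all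
  qed
  have reduce: "poly p \<theta> \<in> E n" if "p \<in> polys_over k" for p
    using that
  proof (induction "degree p" arbitrary: p rule: less_induct)
    case less
    show ?case
    proof (cases "p = 0 \<or> degree p < n")
      case True
      then have "\<forall>i\<ge>n. coeff p i = 0" by (auto simp: coeff_eq_0)
      then show ?thesis using less(2) by (auto simp: E_def)
    next
      case False
      define c where "c = monom (lead_coeff p) (degree p - degree P)"
      have c: "c \<in> polys_over k" unfolding c_def
        using less(2) by (intro polys_over_closed(6)[OF k(1)]) (simp add: polys_over_def)
      have q: "p - c * P \<in> polys_over k" using less(2) c Pk by (intro polys_over_closed[OF k(1)])
      have "p - c * P = 0 \<or> degree (p - c * P) < degree p"
        unfolding c_def by (rule degree_reduce) (use False Pdeg in auto)
      then have "poly (p - c * P) \<theta> \<in> E n"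
      proof
        assume "p - c * P = 0"
        then show ?thesis using polys_over_closed(1)[OF k(1)] by (auto simp: E_def intro!: exI[of _ 0])
      qed (use less(1) q in blast)
      then show ?thesis using root by simp
    qed
  qed
  have "E n = K"
  proof (intro equalityI subsetI)
    fix y assume "y \<in> E n"
    then obtain p where "p \<in> polys_over k" "y = poly p \<theta>" by (auto simp: E_def)
    moreover from this have "p \<in> polys_over K" using k(2) by (auto simp: polys_over_def)
    ultimately show "y \<in> K" using poly_in_subfield[OF sK(1) _ \<theta>] by simp
  next
    fix y assume y: "y \<in> K"
    define F where "F = {poly p \<theta> |p. p \<in> polys_over k}"
    have \<theta>Q: "\<theta> \<in> Qbar" using \<theta> sK(2) by auto
    have FK: "F \<subseteq> K" unfolding F_def
      using poly_in_subfield[OF sK(1) _ \<theta>] k(2) by (force simp: polys_over_def)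
    have kF: "k \<subseteq> F"
    proof
      fix c assume "c \<in> k"
      then show "c \<in> F" unfolding F_def
        using polys_over_closed(6)[OF k(1), of c 0] by (intro CollectI exI[of _ "monom c 0"]) (simp add: poly_monom)
    qed
    have \<theta>F: "\<theta> \<in> F" unfolding F_def
      using polys_over_closed(6)[OF k(1) subfield_one[OF k(1)], of 1] by (intro CollectI exI[of _ "monom 1 1"]) (simp add: poly_monom)
    have sF: "subfield F CC"
    proof (rule subring_Qbar_subfield)
      show "\<rat> \<subseteq> F" using kF subfield_Rats[OF k(1)] by blast
      show "F \<subseteq> Qbar" using FK sK(2) by blast
      fix u v assume "u \<in> F" "v \<in> F"
      then obtain p q where pq: "p \<in> polys_over k" "q \<in> polys_over k" "u = poly p \<theta>" "v = poly q \<theta>" by (auto simp: F_def)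
      show "u - v \<in> F" unfolding F_def using pq polys_over_closed(4)[OF k(1) pq(1,2)]
        by (intro CollectI exI[of _ "p - q"]) simp
      show "u * v \<in> F" unfolding F_def using pq polys_over_closed(5)[OF k(1) pq(1,2)]
        by (intro CollectI exI[of _ "p * q"]) simp
    qed
    have "y \<in> F"
    proof (rule ccontr)
      assume yF: "y \<notin> F"
      have FQ: "F \<subseteq> Qbar" and yQ: "y \<in> Qbar" using FK sK(2) y by auto
      obtain \<omega> where \<omega>: "\<omega> \<in> carrier (Gal Qbar \<rat>)" "\<And>y. y \<in> F \<Longrightarrow> \<omega> y = y" "\<omega> y \<noteq> y"
        using moved_by_Gal[OF sF FQ yQ yF] by blast
      have r: "restrict \<omega> K \<in> carrier (Gal K k)"
        by (rule normal_field_restrict[OF K \<omega>(1) _ k(2)]) (use \<omega>(2) kF in blast)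
      have "restrict \<omega> K = \<one>\<^bsub>Gal K k\<^esub>"
        by (rule inj_onD[OF sep _ r G.one_closed]) (use \<theta> \<omega>(2)[OF \<theta>F] Gal_one_apply[OF sK(1) k(2)] in simp)
      then have "\<omega> y = y" using Gal_one_apply[OF sK(1) k(2) y] y by (metis restrict_apply')
      then show False using \<omega>(3) by simp
    qed
    then show "y \<in> E n" using reduce by (auto simp: F_def)
  qed
  then show "CC.dimension (card (carrier (Gal K k))) k K" using dim[of n] by (simp add: n_def)
qed

text \<open>A primitive element. If \<open>\<theta>\<close> separates finitely many pairs of automorphisms and \<open>y\<close> separates one more
pair, then \<open>\<theta> + n y\<close> separates all of these pairs, for all but finitely many natural numbers \<open>n\<close>.\<close>

lemma exists_separating_element:
  assumes K: "normal_field K" and k: "k \<subseteq> K" and fin: "finite (carrier (Gal K k))"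
  obtains \<theta> where "\<theta> \<in> K" "inj_on (\<lambda>\<tau>. \<tau> \<theta>) (carrier (Gal K k))"
proof -
  have sK: "subfield K CC" using K by (simp add: normal_field_def)
  define D where "D = {(\<sigma>, \<tau>). \<sigma> \<in> carrier (Gal K k) \<and> \<tau> \<in> carrier (Gal K k) \<and> \<sigma> \<noteq> \<tau>}"
  have "finite D" by (rule finite_subset[of _ "carrier (Gal K k) \<times> carrier (Gal K k)"]) (use fin in \<open>auto simp: D_def\<close>)
  have "\<exists>\<theta>\<in>K. \<forall>(\<sigma>, \<tau>)\<in>P. \<sigma> \<theta> \<noteq> \<tau> \<theta>" if "finite P" "P \<subseteq> D" for P
    using that
  proof (induction P rule: finite_induct)
    case empty then show ?case using subfield_one[OF sK] by blast
  next
    case (insert st P)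
    obtain \<sigma> \<tau> where st: "st = (\<sigma>, \<tau>)" by fastforce
    have h: "\<sigma> \<in> carrier (Gal K k)" "\<tau> \<in> carrier (Gal K k)" "\<sigma> \<noteq> \<tau>" using insert(4) st by (auto simp: D_def)
    obtain \<theta> where \<theta>: "\<theta> \<in> K" "\<forall>(\<sigma>, \<tau>)\<in>P. \<sigma> \<theta> \<noteq> \<tau> \<theta>" using insert by auto
    obtain y where y: "y \<in> K" "\<sigma> y \<noteq> \<tau> y" using Gal_eqI[OF h(1,2)] h(3) by blast
    \<comment> \<open>The multipliers \<open>n\<close> for which the pair \<open>st\<close> does not separate \<open>\<theta> + n y\<close>; there is at most one for each pair.\<close>
    define bad where "bad st = {n::nat. fst st \<theta> - snd st \<theta> + of_nat n * (fst st y - snd st y) = 0}" for st :: "(complex \<Rightarrow> complex) \<times> (complex \<Rightarrow> complex)"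
    have one: "finite (bad (\<rho>, \<upsilon>))" if "\<rho> \<theta> \<noteq> \<upsilon> \<theta> \<or> \<rho> y \<noteq> \<upsilon> y" for \<rho> \<upsilon>
    proof (cases "\<rho> y = \<upsilon> y")
      case True then show ?thesis using that by (simp add: bad_def)
    next
      case False
      have "m = n" if "m \<in> bad (\<rho>, \<upsilon>)" "n \<in> bad (\<rho>, \<upsilon>)" for m n
      proof -
        have z: "\<rho> \<theta> - \<upsilon> \<theta> + of_nat m * (\<rho> y - \<upsilon> y) = 0" "\<rho> \<theta> - \<upsilon> \<theta> + of_nat n * (\<rho> y - \<upsilon> y) = 0"
          using that by (simp_all add: bad_def)
        have "(of_nat m - of_nat n) * (\<rho> y - \<upsilon> y) =
            (\<rho> \<theta> - \<upsilon> \<theta> + of_nat m * (\<rho> y - \<upsilon> y)) - (\<rho> \<theta> - \<upsilon> \<theta> + of_nat n * (\<rho> y - \<upsilon> y))"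
          by (simp add: algebra_simps)
        then have "(of_nat m - of_nat n) * (\<rho> y - \<upsilon> y) = 0" by (simp only: z diff_self)
        then show ?thesis using False by simp
      qed
      then have "bad (\<rho>, \<upsilon>) \<subseteq> {SOME n. n \<in> bad (\<rho>, \<upsilon>)}" by (metis singletonI someI subsetI)
      then show ?thesis by (rule finite_subset) simp
    qed
    have "finite (\<Union>st\<in>insert (\<sigma>, \<tau>) P. bad st)"
      using insert(1) one \<theta>(2) y(2) by (intro finite_UN_I) auto
    then obtain n where n: "n \<notin> (\<Union>st\<in>insert (\<sigma>, \<tau>) P. bad st)" using ex_new_if_finite[OF infinite_UNIV_nat] by blast
    define z where "z = \<theta> + of_nat n * y"
    have ny: "of_nat n * y \<in> K" by (intro subfield_mult[OF sK] subfield_of_nat[OF sK] y(1))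
    have zK: "z \<in> K" unfolding z_def by (intro subfield_add[OF sK] \<theta>(1) ny)
    have val: "\<rho> z = \<rho> \<theta> + of_nat n * \<rho> y" if "\<rho> \<in> carrier (Gal K k)" for \<rho>
      using field_hom_add[OF sK Gal_memD(1)[OF that] \<theta>(1) ny] field_hom_mult[OF sK Gal_memD(1)[OF that] subfield_of_nat[OF sK] y(1)]
        field_hom_of_nat[OF sK Gal_memD(1)[OF that]] by (simp add: z_def)
    have "\<rho> z \<noteq> \<upsilon> z" if p: "(\<rho>, \<upsilon>) \<in> insert (\<sigma>, \<tau>) P" for \<rho> \<upsilon>
    proof -
      have "n \<notin> bad (\<rho>, \<upsilon>)" using n p by blast
      moreover have "\<rho> \<in> carrier (Gal K k)" "\<upsilon> \<in> carrier (Gal K k)" using p insert(4) st by (auto simp: D_def)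
      ultimately show ?thesis using val by (auto simp: bad_def algebra_simps)
    qed
    then show ?case using zK st by blast
  qed
  from this[OF \<open>finite D\<close> subset_refl] obtain \<theta> where "\<theta> \<in> K" "\<forall>(\<sigma>, \<tau>)\<in>D. \<sigma> \<theta> \<noteq> \<tau> \<theta>" by blast
  then show thesis using that[of \<theta>] unfolding D_def inj_on_def by blast
qed

section \<open>The maximal abelian extension\<close>

definition commuting_algebraics :: "complex set"
  where "commuting_algebraics = {x \<in> Qbar. \<forall>\<sigma>\<in>carrier (Gal Qbar \<rat>). \<forall>\<tau>\<in>carrier (Gal Qbar \<rat>). \<sigma> (\<tau> x) = \<tau> (\<sigma> x)}"

lemma subfield_commuting_algebraics: "subfield commuting_algebraics CC"
proof (rule subfield_CC_I)
  note h = Gal_memD(1)[of _ Qbar \<rat>] and m = Gal_memD(2)[of _ Qbar \<rat>] and Q = subfield_Qbar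
  show "1 \<in> commuting_algebraics"
    by (simp add: commuting_algebraics_def subfield_one[OF Q] field_hom_one[OF Q h])
  show "x - y \<in> commuting_algebraics" "x * y \<in> commuting_algebraics"
    if "x \<in> commuting_algebraics" "y \<in> commuting_algebraics" for x y
    using that by (simp_all add: commuting_algebraics_def subfield_diff[OF Q] subfield_mult[OF Q]
        field_hom_diff[OF Q h] field_hom_mult[OF Q h] m)
  show "inverse x \<in> commuting_algebraics" if "x \<in> commuting_algebraics" for x
    using that by (simp add: commuting_algebraics_def subfield_inverse[OF Q] field_hom_inverse[OF Q h] m)
qed

text \<open>If \<open>\<tau>\<close> fixes \<open>k\<close> and \<open>x\<close> is in \<open>k\<close>, then \<open>\<tau> (\<omega> x) = \<omega> (\<tau> x) = \<omega> x\<close>. So every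
automorphism that fixes \<open>k\<close> fixes \<open>\<omega> x\<close>, which therefore lies in \<open>k\<close>.\<close>

lemma normal_field_commuting:
  assumes "subfield k CC" "k \<subseteq> commuting_algebraics"
  shows "normal_field k"
  unfolding normal_field_def
proof (intro conjI ballI subsetI)
  show kQ: "x \<in> Qbar" if "x \<in> k" for x using that assms(2) by (auto simp: commuting_algebraics_def)
  fix \<omega> y assume \<omega>: "\<omega> \<in> carrier (Gal Qbar \<rat>)" and "y \<in> \<omega> ` k"
  then obtain x where x: "x \<in> k" "y = \<omega> x" by blast
  have yQ: "y \<in> Qbar" using Gal_memD(2)[OF \<omega> kQ[OF x(1)]] x(2) by simp
  show "y \<in> k"
  proof (rule ccontr)
    assume "y \<notin> k"
    then obtain \<tau> where \<tau>: "\<tau> \<in> carrier (Gal Qbar \<rat>)" "\<And>z. z \<in> k \<Longrightarrow> \<tau> z = z" "\<tau> y \<noteq> y"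
      using moved_by_Gal[OF assms(1) _ yQ] kQ by blast
    have "\<tau> (\<omega> x) = \<omega> (\<tau> x)" using x(1) assms(2) \<tau>(1) \<omega> unfolding commuting_algebraics_def by blast
    then show False using \<tau>(2)[OF x(1)] \<tau>(3) x(2) by simp
  qed
qed (rule assms(1))

text \<open>The orbit of \<open>x\<close> under the Galois group of \<open>F\<close> is the root set of a polynomial with rational coefficients,
since the rationals are the fixed field. So all conjugates of \<open>x\<close> lie in \<open>F\<close>.\<close>

lemma finite_abelian_ext_normal:
  assumes "finite_abelian_ext F" shows "normal_field F"
  unfolding normal_field_def
proof (intro conjI ballI subsetI)
  have nf: "number_field F" and fix_F: "fixed_field F (carrier (Gal F \<rat>)) = \<rat>"
    using assms by (auto simp: finite_abelian_ext_def)
  show sF: "subfield F CC" using nf by (simp add: number_field_def)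
  show FQ: "x \<in> Qbar" if "x \<in> F" for x using number_field_subset_Qbar[OF nf] that by blast
  fix \<omega> y assume \<omega>: "\<omega> \<in> carrier (Gal Qbar \<rat>)" and "y \<in> \<omega> ` F"
  then obtain x where x: "x \<in> F" "y = \<omega> x" by blast
  interpret G: group "Gal F \<rat>" by (rule group_Gal[OF sF subfield_Rats[OF sF]])
  have \<omega>F: "field_hom F \<omega>" using Qbar_Gal_hom[OF \<omega>] FQ by blast
  define S where "S = (\<lambda>\<tau>. \<tau> x) ` carrier (Gal F \<rat>)"
  have fin: "finite S" unfolding S_def
    by (rule finite_subset[OF _ finite_conjugates[OF FQ[OF x(1)]]]) (use Gal_memD(1) sF x in blast)
  define P where "P = (\<Prod>y\<in>S. [:- y, 1:])"
  have P: "P \<in> polys_over \<rat>"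
    using orbit_poly_over_fixed_field[OF sF x(1) G.subgroup_self subfield_Rats[OF sF]] fin by (simp add: P_def S_def fix_F)
  have "map_poly \<omega> P = P"
    by (rule poly_eqI) (use P field_hom_Rats[OF sF \<omega>F] in \<open>simp add: coeff_map_poly field_hom_zero[OF sF \<omega>F] polys_over_def\<close>)
  moreover have "x \<in> S" unfolding S_def using Gal_one_apply[OF sF subfield_Rats[OF sF] x(1)] G.one_closed by (metis image_eqI)
  then have "poly P x = 0" unfolding P_def using fin by (auto simp: poly_prod)
  moreover have "P \<in> polys_over F" using P subfield_Rats[OF sF] by (auto simp: polys_over_def)
  ultimately have "poly P (\<omega> x) = 0" using field_hom_poly[OF sF \<omega>F _ x(1), of P] field_hom_zero[OF sF \<omega>F] by simp
  then have "\<omega> x \<in> S" unfolding P_def using fin by (auto simp: poly_prod)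
  then show "y \<in> F" using x Gal_memD(2) by (auto simp: S_def)
qed

lemma number_field_if_normal_finite:
  assumes "normal_field K" "finite (carrier (Gal K \<rat>))"
  shows "number_field K"
proof -
  interpret CC: field CC by (rule field_CC)
  have sK: "subfield K CC" using assms(1) by (simp add: normal_field_def)
  obtain \<theta> where \<theta>: "\<theta> \<in> K" "inj_on (\<lambda>\<tau>. \<tau> \<theta>) (carrier (Gal K \<rat>))"
    using exists_separating_element[OF assms(1) subfield_Rats[OF sK] assms(2)] by blast
  show ?thesis using CC.finite_dimensionI[OF dimension_eq_card_Gal(2)[OF assms(1) subfield_Rats_CC subfield_Rats[OF sK] \<theta>]] sK
    by (simp add: number_field_def)
qed

text \<open>Automorphisms restrict to a finite abelian extension, as it is normal, and commute there. Conversely, for an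
algebraic number \<open>x\<close> on which they commute, the fixed field of the stabilizer of \<open>x\<close> is a finite abelian
extension that contains \<open>x\<close>: an automorphism of it is determined by its value at \<open>x\<close>.\<close>

lemma commuting_algebraics_eq_Qab: "Qab = commuting_algebraics"
proof (intro equalityI subsetI)
  fix x assume "x \<in> Qab"
  then obtain F where F: "finite_abelian_ext F" "x \<in> F" by (auto simp: Qab_def)
  have nF: "normal_field F" by (rule finite_abelian_ext_normal[OF F(1)])
  have sF: "subfield F CC" "F \<subseteq> Qbar" using nF by (auto simp: normal_field_def)
  interpret G: comm_group "Gal F \<rat>" using F(1) by (simp add: finite_abelian_ext_def)
  have "\<sigma> (\<tau> x) = \<tau> (\<sigma> x)" if "\<sigma> \<in> carrier (Gal Qbar \<rat>)" "\<tau> \<in> carrier (Gal Qbar \<rat>)" for \<sigma> \<tau>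
  proof -
    have r: "restrict \<sigma> F \<in> carrier (Gal F \<rat>)" if "\<sigma> \<in> carrier (Gal Qbar \<rat>)" for \<sigma>
      by (rule normal_field_restrict[OF nF that Gal_memD(3)[OF that] subfield_Rats[OF sF(1)]])
    have in_F: "\<sigma> x \<in> F" "\<tau> x \<in> F" using Gal_memD(2)[OF r[OF that(1)] F(2)] Gal_memD(2)[OF r[OF that(2)] F(2)] F(2) by simp_all
    have "(restrict \<sigma> F \<otimes>\<^bsub>Gal F \<rat>\<^esub> restrict \<tau> F) x = (restrict \<tau> F \<otimes>\<^bsub>Gal F \<rat>\<^esub> restrict \<sigma> F) x"
      using G.m_comm[OF r[OF that(1)] r[OF that(2)]] by simp
    then show ?thesis
      using Gal_mult_apply[OF sF(1) subfield_Rats[OF sF(1)]] r that F(2) in_F by simp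
  qed
  then show "x \<in> commuting_algebraics" using F(2) sF(2) by (auto simp: commuting_algebraics_def)
next
  fix x assume x: "x \<in> commuting_algebraics"
  define U where "U = {\<omega> \<in> carrier (Gal Qbar \<rat>). \<omega> x = x}"
  define F where "F = fixed_field Qbar U"
  have sF: "subfield F CC" unfolding F_def
    by (rule subfield_fixed_field[OF subfield_Qbar]) (use Gal_memD(1) in \<open>auto simp: U_def\<close>)
  have xF: "x \<in> F" using x by (auto simp: F_def fixed_field_def U_def commuting_algebraics_def)
  interpret Q: group "Gal Qbar \<rat>" by (rule group_Gal_Qbar)
  have agree: "\<sigma> y = \<tau> y" if h: "\<sigma> \<in> carrier (Gal Qbar \<rat>)" "\<tau> \<in> carrier (Gal Qbar \<rat>)" "\<sigma> x = \<tau> x" "y \<in> F" for \<sigma> \<tau> y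
  proof -
    let ?\<rho> = "inv\<^bsub>Gal Qbar \<rat>\<^esub> \<tau> \<otimes>\<^bsub>Gal Qbar \<rat>\<^esub> \<sigma>"
    have y: "y \<in> Qbar" "x \<in> Qbar" using h(4) x by (auto simp: F_def fixed_field_def commuting_algebraics_def)
    have iv: "inv\<^bsub>Gal Qbar \<rat>\<^esub> \<tau> \<in> carrier (Gal Qbar \<rat>)" using h(2) by simp
    have val: "?\<rho> z = (inv\<^bsub>Gal Qbar \<rat>\<^esub> \<tau>) (\<sigma> z)" if "z \<in> Qbar" for z
      by (rule Gal_Qbar_mult[OF iv h(1) that])
    have "?\<rho> x = x" using val[OF y(2)] Gal_Qbar_inv(1)[OF h(2) y(2)] h(3) by simp
    then have "?\<rho> \<in> U" using iv h(1) by (simp add: U_def)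
    then have "?\<rho> y = y" using h(4) unfolding F_def fixed_field_def by blast
    then have "\<tau> ((inv\<^bsub>Gal Qbar \<rat>\<^esub> \<tau>) (\<sigma> y)) = \<tau> y" using val[OF y(1)] by simp
    then show ?thesis using Gal_Qbar_inv(2)[OF h(2) Gal_memD(2)[OF h(1) y(1)]] by simp
  qed
  have FA: "F \<subseteq> commuting_algebraics"
  proof
    fix y assume y: "y \<in> F"
    have yQ: "y \<in> Qbar" using y by (simp add: F_def fixed_field_def)
    have xQ: "x \<in> Qbar" using x by (simp add: commuting_algebraics_def)
    have "\<sigma> (\<tau> y) = \<tau> (\<sigma> y)" if "\<sigma> \<in> carrier (Gal Qbar \<rat>)" "\<tau> \<in> carrier (Gal Qbar \<rat>)" for \<sigma> \<tau>
    proof -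
      have "(\<sigma> \<otimes>\<^bsub>Gal Qbar \<rat>\<^esub> \<tau>) x = (\<tau> \<otimes>\<^bsub>Gal Qbar \<rat>\<^esub> \<sigma>) x"
        using x that Gal_Qbar_mult[OF that xQ] Gal_Qbar_mult[OF that(2,1) xQ] by (simp add: commuting_algebraics_def)
      from agree[OF Q.m_closed[OF that] Q.m_closed[OF that(2,1)] this y] show ?thesis
        using that Gal_Qbar_mult[OF that yQ] Gal_Qbar_mult[OF that(2,1) yQ] by simp
    qed
    then show "y \<in> commuting_algebraics" using yQ by (simp add: commuting_algebraics_def)
  qed
  have nF: "normal_field F" by (rule normal_field_commuting[OF sF FA])
  have FQ: "F \<subseteq> Qbar" by (auto simp: F_def fixed_field_def)
  have sep: "inj_on (\<lambda>\<tau>. \<tau> x) (carrier (Gal F \<rat>))"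
  proof (rule inj_onI)
    fix \<sigma> \<tau> assume st: "\<sigma> \<in> carrier (Gal F \<rat>)" "\<tau> \<in> carrier (Gal F \<rat>)" "\<sigma> x = \<tau> x"
    obtain \<sigma>' where s: "\<sigma>' \<in> carrier (Gal Qbar \<rat>)" "\<And>x. x \<in> F \<Longrightarrow> \<sigma>' x = \<sigma> x" using Gal_lift[OF sF FQ st(1)] by blast
    obtain \<tau>' where t: "\<tau>' \<in> carrier (Gal Qbar \<rat>)" "\<And>x. x \<in> F \<Longrightarrow> \<tau>' x = \<tau> x" using Gal_lift[OF sF FQ st(2)] by blast
    have "\<sigma>' x = \<tau>' x" using s(2) t(2) xF st(3) by simp
    then show "\<sigma> = \<tau>" using Gal_eqI[OF st(1,2)] agree[OF s(1) t(1)] s(2) t(2) by metis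
  qed
  have nfF: "number_field F"
    by (rule number_field_if_normal_finite[OF nF dimension_eq_card_Gal(1)[OF nF subfield_Rats_CC subfield_Rats[OF sF] xF sep]])
  have "comm_group (Gal F \<rat>)"
  proof (rule group.group_comm_groupI[OF group_Gal[OF sF subfield_Rats[OF sF]]])
    fix \<sigma> \<tau> assume st: "\<sigma> \<in> carrier (Gal F \<rat>)" "\<tau> \<in> carrier (Gal F \<rat>)"
    interpret G: group "Gal F \<rat>" by (rule group_Gal[OF sF subfield_Rats[OF sF]])
    obtain \<sigma>' where s: "\<sigma>' \<in> carrier (Gal Qbar \<rat>)" "\<And>x. x \<in> F \<Longrightarrow> \<sigma>' x = \<sigma> x" using Gal_lift[OF sF FQ st(1)] by blast
    obtain \<tau>' where t: "\<tau>' \<in> carrier (Gal Qbar \<rat>)" "\<And>x. x \<in> F \<Longrightarrow> \<tau>' x = \<tau> x" using Gal_lift[OF sF FQ st(2)] by blast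
    show "\<sigma> \<otimes>\<^bsub>Gal F \<rat>\<^esub> \<tau> = \<tau> \<otimes>\<^bsub>Gal F \<rat>\<^esub> \<sigma>"
    proof (rule Gal_eqI[OF G.m_closed[OF st] G.m_closed[OF st(2,1)]])
      fix y assume y: "y \<in> F"
      have "\<sigma>' (\<tau>' y) = \<tau>' (\<sigma>' y)" using FA y s(1) t(1) unfolding commuting_algebraics_def by blast
      then have "\<sigma> (\<tau> y) = \<tau> (\<sigma> y)" using s(2) t(2) y Gal_memD(2)[OF st(1) y] Gal_memD(2)[OF st(2) y] by metis
      then show "(\<sigma> \<otimes>\<^bsub>Gal F \<rat>\<^esub> \<tau>) y = (\<tau> \<otimes>\<^bsub>Gal F \<rat>\<^esub> \<sigma>) y"
        using Gal_mult_apply[OF sF subfield_Rats[OF sF] st y] Gal_mult_apply[OF sF subfield_Rats[OF sF] st(2,1) y] by simp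
    qed
  qed
  then have "finite_abelian_ext F"
    using nfF normal_field_fixed[OF nF subfield_Rats_CC subfield_Rats[OF sF]] by (simp add: finite_abelian_ext_def)
  then show "x \<in> Qab" using xF by (auto simp: Qab_def)
qed

lemma subfield_Qab: "subfield Qab CC"
  by (simp add: commuting_algebraics_eq_Qab subfield_commuting_algebraics)

lemma normal_field_Qab: "subfield k CC \<Longrightarrow> k \<subseteq> Qab \<Longrightarrow> normal_field k"
  by (simp add: commuting_algebraics_eq_Qab normal_field_commuting)

lemma Qab_subset_Qbar: "Qab \<subseteq> Qbar"
  by (auto simp: commuting_algebraics_eq_Qab commuting_algebraics_def)

lemma group_GG: "group GG"
  unfolding GG_def by (rule group_Gal[OF subfield_Qab subfield_Rats[OF subfield_Qab]])

lemmas GG_mult_apply = Gal_mult_apply[OF subfield_Qab subfield_Rats[OF subfield_Qab], folded GG_def]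
lemmas GG_one_apply = Gal_one_apply[OF subfield_Qab subfield_Rats[OF subfield_Qab], folded GG_def]
lemmas GG_inv_apply = Gal_inv_apply[OF subfield_Qab subfield_Rats[OF subfield_Qab], folded GG_def]

lemma GG_restrict:
  assumes L: "subfield L CC" "L \<subseteq> Qab" and \<sigma>: "\<sigma> \<in> carrier GG" and k: "k \<subseteq> L" "\<And>x. x \<in> k \<Longrightarrow> \<sigma> x = x"
  shows "restrict \<sigma> L \<in> carrier (Gal L k)"
proof -
  obtain \<omega> where \<omega>: "\<omega> \<in> carrier (Gal Qbar \<rat>)" "\<And>x. x \<in> Qab \<Longrightarrow> \<omega> x = \<sigma> x"
    using Gal_lift[OF subfield_Qab Qab_subset_Qbar, of \<sigma> \<rat>] \<sigma> unfolding GG_def by blast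
  have "\<omega> x = x" if "x \<in> k" for x
    using \<omega>(2)[of x] k that L(2) by auto
  moreover have "restrict \<omega> L = restrict \<sigma> L" by (rule restrict_ext) (use \<omega>(2) L(2) in blast)
  ultimately show ?thesis using normal_field_restrict[OF normal_field_Qab[OF L] \<omega>(1) _ k(1)] by simp
qed

lemma GG_lift:
  assumes L: "subfield L CC" "L \<subseteq> Qab" and \<tau>: "\<tau> \<in> carrier (Gal L k)"
  obtains \<sigma> where "\<sigma> \<in> carrier GG" "restrict \<sigma> L = \<tau>"
proof -
  obtain \<omega> where \<omega>: "\<omega> \<in> carrier (Gal Qbar \<rat>)" "\<And>x. x \<in> L \<Longrightarrow> \<omega> x = \<tau> x"
    using Gal_lift[OF L(1) _ \<tau>] L(2) Qab_subset_Qbar by blast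
  have "restrict \<omega> Qab \<in> carrier GG" unfolding GG_def
    by (rule normal_field_restrict[OF normal_field_Qab[OF subfield_Qab subset_refl] \<omega>(1) Gal_memD(3)[OF \<omega>(1)] subfield_Rats[OF subfield_Qab]])
  moreover have "restrict (restrict \<omega> Qab) L = \<tau>"
    using \<omega>(2) L(2) Gal_memD(5)[OF \<tau>] by (auto simp: restrict_def extensional_def fun_eq_iff)
  ultimately show thesis by (rule that)
qed

text \<open>The field that corresponds to the open subgroup of all automorphisms fixing \<open>S\<close> pointwise. Its
automorphisms are determined by their values on \<open>S\<close>, which are conjugates of elements of \<open>S\<close>.\<close>

lemma fixing_finite_set:
  assumes S: "finite S" "S \<subseteq> Qab"
  defines "V \<equiv> fixed_field Qab {\<sigma> \<in> carrier GG. \<forall>s\<in>S. \<sigma> s = s}"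
  shows "subfield V CC" "V \<subseteq> Qab" "S \<subseteq> V" "finite (carrier (Gal V \<rat>))"
proof -
  interpret GG: group GG by (rule group_GG)
  show sV: "subfield V CC" unfolding V_def
    by (rule subfield_fixed_field[OF subfield_Qab]) (use Gal_memD(1) in \<open>auto simp: GG_def\<close>)
  show VQ: "V \<subseteq> Qab" and SV: "S \<subseteq> V" using S(2) by (auto simp: V_def fixed_field_def)
  have "inj_on (\<lambda>\<tau>. restrict \<tau> S) (carrier (Gal V \<rat>))"
  proof (rule inj_onI)
    fix \<sigma> \<tau> assume st: "\<sigma> \<in> carrier (Gal V \<rat>)" "\<tau> \<in> carrier (Gal V \<rat>)" "restrict \<sigma> S = restrict \<tau> S"
    obtain \<sigma>' where s: "\<sigma>' \<in> carrier GG" "restrict \<sigma>' V = \<sigma>" using GG_lift[OF sV VQ st(1)] by blast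
    obtain \<tau>' where t: "\<tau>' \<in> carrier GG" "restrict \<tau>' V = \<tau>" using GG_lift[OF sV VQ st(2)] by blast
    let ?\<rho> = "inv\<^bsub>GG\<^esub> \<tau>' \<otimes>\<^bsub>GG\<^esub> \<sigma>'"
    have val: "?\<rho> z = (inv\<^bsub>GG\<^esub> \<tau>') (\<sigma>' z)" if "z \<in> Qab" for z
      using GG_mult_apply[OF _ s(1) that] t(1) by simp
    have "?\<rho> z = z" if z: "z \<in> S" for z
    proof -
      have "\<sigma>' z = \<tau>' z" using z SV s(2) t(2) st(3) by (metis restrict_apply' subsetD)
      then show ?thesis using val[of z] GG_inv_apply(1)[OF t(1), of z] z S(2) by auto
    qed
    then have \<rho>: "?\<rho> \<in> {\<sigma> \<in> carrier GG. \<forall>s\<in>S. \<sigma> s = s}" using s(1) t(1) by simp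
    show "\<sigma> = \<tau>"
    proof (rule Gal_eqI[OF st(1,2)])
      fix y assume y: "y \<in> V"
      then have yQ: "y \<in> Qab" using VQ by blast
      have "?\<rho> y = y" using y \<rho> unfolding V_def fixed_field_def by blast
      then have "\<tau>' ((inv\<^bsub>GG\<^esub> \<tau>') (\<sigma>' y)) = \<tau>' y" using val[OF yQ] by simp
      moreover have "\<sigma>' y \<in> Qab" using s(1) yQ Gal_memD(2) by (simp add: GG_def)
      ultimately have "\<sigma>' y = \<tau>' y" using GG_inv_apply(2)[OF t(1)] by simp
      then show "\<sigma> y = \<tau> y" using s(2) t(2) y by auto
    qed
  qed
  moreover have "finite ((\<lambda>\<tau>. restrict \<tau> S) ` carrier (Gal V \<rat>))"
  proof (rule finite_subset)
    let ?C = "\<lambda>s. {f s |f L. subfield L CC \<and> s \<in> L \<and> field_hom L f}"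
    show "(\<lambda>\<tau>. restrict \<tau> S) ` carrier (Gal V \<rat>) \<subseteq> PiE S ?C"
      using Gal_memD(1) sV SV by (fastforce simp: PiE_iff)
    show "finite (PiE S ?C)"
      using S Qab_subset_Qbar by (intro finite_PiE finite_conjugates) auto
  qed
  ultimately show "finite (carrier (Gal V \<rat>))" using finite_imageD by blast
qed

lemma finite_Gal_subfield:
  assumes V: "subfield V CC" "V \<subseteq> Qab" "finite (carrier (Gal V \<rat>))" and K: "subfield K CC" "K \<subseteq> V"
  shows "finite (carrier (Gal K \<rat>))"
proof (rule finite_subset)
  show "carrier (Gal K \<rat>) \<subseteq> (\<lambda>\<tau>. restrict \<tau> K) ` carrier (Gal V \<rat>)"
  proof
    fix \<tau> assume \<tau>: "\<tau> \<in> carrier (Gal K \<rat>)"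
    obtain \<sigma> where \<sigma>: "\<sigma> \<in> carrier GG" "restrict \<sigma> K = \<tau>" using GG_lift[OF K(1) _ \<tau>] K(2) V(2) by blast
    have "restrict \<sigma> V \<in> carrier (Gal V \<rat>)"
      by (rule GG_restrict[OF V(1,2) \<sigma>(1) subfield_Rats[OF V(1)]]) (use \<sigma>(1) Gal_memD(3) in \<open>auto simp: GG_def\<close>)
    moreover have "restrict (restrict \<sigma> V) K = \<tau>" using \<sigma>(2) K(2) by (simp add: Int_absorb1)
    ultimately show "\<tau> \<in> (\<lambda>\<tau>. restrict \<tau> K) ` carrier (Gal V \<rat>)" by (metis image_eqI)
  qed
  show "finite ((\<lambda>\<tau>. restrict \<tau> K) ` carrier (Gal V \<rat>))" using V(3) by simp
qed

lemma field_degree_eq_card_Gal: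
  assumes K: "subfield K CC" "K \<subseteq> Qab" "finite (carrier (Gal K \<rat>))" and k: "subfield k CC" "k \<subseteq> K"
  shows "field_degree K k = card (carrier (Gal K k))"
proof -
  interpret CC: field CC by (rule field_CC)
  have nK: "normal_field K" by (rule normal_field_Qab[OF K(1,2)])
  have "finite (carrier (Gal K k))"
    by (rule finite_subset[OF Gal_mono[OF subfield_Rats[OF k(1)]] K(3)])
  then obtain \<theta> where \<theta>: "\<theta> \<in> K" "inj_on (\<lambda>\<tau>. \<tau> \<theta>) (carrier (Gal K k))"
    using exists_separating_element[OF nK k(2)] by blast
  show ?thesis using CC.dimI[OF k(1) dimension_eq_card_Gal(2)[OF nK k \<theta>]] by (simp add: field_degree_def over_def)
qed

lemma dimension_finite_determining_set:
  assumes "ring.dimension CC n \<rat> E" "E \<subseteq> V" "subfield V CC"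
  shows "0 \<in> E \<and> (\<exists>S\<subseteq>E. finite S \<and> (\<forall>f g. field_hom V f \<longrightarrow> field_hom V g \<longrightarrow> (\<forall>s\<in>S. f s = g s) \<longrightarrow> (\<forall>x\<in>E. f x = g x)))"
proof -
  interpret CC: field CC by (rule field_CC)
  show ?thesis using assms(1,2)
  proof (induction n "\<rat> :: complex set" E rule: CC.dimension.induct)
    case zero_dim
    have "f 0 = g 0" if "field_hom V f" "field_hom V g" for f g
      using field_hom_zero[OF assms(3) that(1)] field_hom_zero[OF assms(3) that(2)] by simp
    then show ?case by (intro conjI exI[of _ "{}"]) auto
  next
    case (Suc_dim v E n)
    have mem: "u \<in> CC.line_extension \<rat> v E \<longleftrightarrow> (\<exists>q\<in>\<rat>. \<exists>e\<in>E. u = q * v + e)" for u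
      by (simp add: CC.line_extension_mem_iff)
    have sub: "E \<subseteq> CC.line_extension \<rat> v E"
    proof
      fix e assume "e \<in> E"
      moreover have "e = 0 * v + e" by simp
      ultimately show "e \<in> CC.line_extension \<rat> v E" unfolding mem using Rats_0 by blast
    qed
    then obtain S where S: "0 \<in> E" "S \<subseteq> E" "finite S"
      "\<And>f g. field_hom V f \<Longrightarrow> field_hom V g \<Longrightarrow> \<forall>s\<in>S. f s = g s \<Longrightarrow> \<forall>x\<in>E. f x = g x"
      using Suc_dim by blast
    have v: "v \<in> CC.line_extension \<rat> v E" unfolding mem using S(1) by (intro bexI[of _ 1] bexI[of _ 0]) auto
    have "f u = g u" if h: "field_hom V f" "field_hom V g" "\<forall>s\<in>insert v S. f s = g s" "u \<in> CC.line_extension \<rat> v E" for f g u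
    proof -
      obtain q e where qe: "q \<in> \<rat>" "e \<in> E" "u = q * v + e" using h(4) mem by blast
      have V: "v \<in> V" "e \<in> V" "q \<in> V" "q * v \<in> V"
        using v sub Suc_dim(5) qe subfield_Rats[OF assms(3)] subfield_mult[OF assms(3)] by blast+
      have lin: "f u = q * f v + f e" if "field_hom V f" for f
        using qe V field_hom_add[OF assms(3) that] field_hom_mult[OF assms(3) that] field_hom_Rats[OF assms(3) that] by simp
      have "f v = g v" "f e = g e" using h(3) S(4)[OF h(1,2)] qe(2) by auto
      then show ?thesis using lin[OF h(1)] lin[OF h(2)] by simp
    qed
    then have a: "\<forall>f g. field_hom V f \<longrightarrow> field_hom V g \<longrightarrow> (\<forall>s\<in>insert v S. f s = g s) \<longrightarrow>
        (\<forall>x\<in>CC.line_extension \<rat> v E. f x = g x)" by blast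
    have b: "insert v S \<subseteq> CC.line_extension \<rat> v E" "0 \<in> CC.line_extension \<rat> v E" using S(1,2) sub v by blast+
    show ?case
      by (rule conjI[OF b(2)], rule exI[of _ "insert v S"], rule conjI[OF b(1)], rule conjI[OF _ a]) (simp add: S(3))
  qed
qed

text \<open>A spanning set over the rationals determines the automorphisms.\<close>

lemma number_field_determining_set:
  assumes "number_field F" "F \<subseteq> Qab"
  obtains S where "finite S" "S \<subseteq> F"
    "\<And>\<sigma> \<tau> x. \<sigma> \<in> carrier GG \<Longrightarrow> \<tau> \<in> carrier GG \<Longrightarrow> (\<And>s. s \<in> S \<Longrightarrow> \<sigma> s = \<tau> s) \<Longrightarrow> x \<in> F \<Longrightarrow> \<sigma> x = \<tau> x"
proof -
  interpret CC: field CC by (rule field_CC)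
  obtain n where "CC.dimension n \<rat> F" using assms(1) by (auto simp: number_field_def CC.finite_dimension_def)
  from dimension_finite_determining_set[OF this assms(2) subfield_Qab] obtain S where S: "S \<subseteq> F" "finite S"
    "\<And>f g. field_hom Qab f \<Longrightarrow> field_hom Qab g \<Longrightarrow> \<forall>s\<in>S. f s = g s \<Longrightarrow> \<forall>x\<in>F. f x = g x" by blast
  have "\<sigma> x = \<tau> x" if "\<sigma> \<in> carrier GG" "\<tau> \<in> carrier GG" "\<And>s. s \<in> S \<Longrightarrow> \<sigma> s = \<tau> s" "x \<in> F" for \<sigma> \<tau> x
    using S(3)[of \<sigma> \<tau>] that Gal_memD(1) unfolding GG_def by blast
  then show thesis using that[OF S(2,1)] by blast
qed

section \<open>The field of a character\<close>

text \<open>An automorphism that agrees with \<open>\<sigma>\<close> on a spanning set of \<open>F\<close> lies in the same coset.\<close>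

lemma galois_coset_determined:
  assumes FKK: "F \<in> KK" and \<rho>: "\<rho> \<in> carrier GG"
    and \<sigma>: "\<sigma> \<in> carrier GG" "\<sigma> \<in> \<rho> <#\<^bsub>GG\<^esub> carrier (Gal Qab F)"
  shows "\<exists>S. finite S \<and> S \<subseteq> Qab \<and>
    (\<forall>\<tau>\<in>carrier GG. (\<forall>s\<in>S. \<tau> s = \<sigma> s) \<longrightarrow> \<tau> \<in> \<rho> <#\<^bsub>GG\<^esub> carrier (Gal Qab F))"
proof -
  interpret GG: group GG by (rule group_GG)
  have F: "number_field F" "F \<subseteq> Qab" using FKK by (simp_all add: KK_def)
  obtain S where S: "finite S" "S \<subseteq> F"
    "\<And>\<sigma> \<tau> x. \<sigma> \<in> carrier GG \<Longrightarrow> \<tau> \<in> carrier GG \<Longrightarrow> (\<And>s. s \<in> S \<Longrightarrow> \<sigma> s = \<tau> s) \<Longrightarrow> x \<in> F \<Longrightarrow> \<sigma> x = \<tau> x"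
    using number_field_determining_set[OF F] by blast
  have sF: "subfield F CC" using F(1) by (simp add: number_field_def)
  have GF: "carrier (Gal Qab F) \<subseteq> carrier GG" unfolding GG_def by (rule Gal_mono[OF subfield_Rats[OF sF]])
  have "\<tau> \<in> \<rho> <#\<^bsub>GG\<^esub> carrier (Gal Qab F)" if h: "\<tau> \<in> carrier GG" "\<forall>s\<in>S. \<tau> s = \<sigma> s" for \<tau>
  proof -
    obtain h where h': "h \<in> carrier (Gal Qab F)" "\<sigma> = \<rho> \<otimes>\<^bsub>GG\<^esub> h" using \<sigma>(2) by (auto simp: l_coset_def)
    have hG: "h \<in> carrier GG" using h' GF by blast
    have agree: "\<tau> x = \<sigma> x" if "x \<in> F" for x using S(3)[OF h(1) \<sigma>(1)] h(2) that by blast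
    let ?\<upsilon> = "inv\<^bsub>GG\<^esub> \<rho> \<otimes>\<^bsub>GG\<^esub> \<tau>"
    have \<upsilon>: "?\<upsilon> \<in> carrier GG" using \<rho> h(1) by simp
    have "?\<upsilon> x = x" if x: "x \<in> F" for x
    proof -
      have xQ: "x \<in> Qab" using x F(2) by blast
      have "?\<upsilon> x = (inv\<^bsub>GG\<^esub> \<rho>) (\<tau> x)" using GG_mult_apply[OF _ h(1) xQ] \<rho> by simp
      also have "\<dots> = (inv\<^bsub>GG\<^esub> \<rho>) (\<rho> (h x))" using agree[OF x] h'(2) GG_mult_apply[OF \<rho> hG xQ] by simp
      also have "\<dots> = x" using GG_inv_apply(1)[OF \<rho> xQ] Gal_memD(3)[OF h'(1) x] by simp
      finally show ?thesis .
    qed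
    then have "?\<upsilon> \<in> carrier (Gal Qab F)" using \<upsilon> unfolding GG_def Gal_mem_iff by blast
    moreover have "\<tau> = \<rho> \<otimes>\<^bsub>GG\<^esub> ?\<upsilon>" using \<rho> h(1) by (simp add: GG.m_assoc[symmetric])
    ultimately show ?thesis unfolding l_coset_def by blast
  qed
  then have "\<forall>\<tau>\<in>carrier GG. (\<forall>s\<in>S. \<tau> s = \<sigma> s) \<longrightarrow> \<tau> \<in> \<rho> <#\<^bsub>GG\<^esub> carrier (Gal Qab F)" by blast
  then show ?thesis using S(1,2) F(2) by blast
qed

lemma krull_open_determined:
  assumes "openin krull_topology W" "\<sigma> \<in> W" "\<sigma> \<in> carrier GG"
  obtains S where "finite S" "S \<subseteq> Qab" "\<And>\<tau>. \<tau> \<in> carrier GG \<Longrightarrow> (\<And>s. s \<in> S \<Longrightarrow> \<tau> s = \<sigma> s) \<Longrightarrow> \<tau> \<in> W"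
proof -
  interpret GG: group GG by (rule group_GG)
  let ?B = "{\<rho> <#\<^bsub>GG\<^esub> carrier (Gal Qab F) |\<rho> F. \<rho> \<in> carrier GG \<and> F \<in> KK}"
  have "generate_topology_on ?B W"
    using assms(1) by (simp add: krull_topology_def openin_topology_generated_by_iff)
  then have "\<sigma> \<in> W \<longrightarrow> (\<exists>S. finite S \<and> S \<subseteq> Qab \<and> (\<forall>\<tau>\<in>carrier GG. (\<forall>s\<in>S. \<tau> s = \<sigma> s) \<longrightarrow> \<tau> \<in> W))"
  proof (induction rule: generate_topology_on.induct)
    case (Int A B)
    show ?case
    proof
      assume "\<sigma> \<in> A \<inter> B"
      then obtain S T where "finite S \<and> S \<subseteq> Qab \<and> (\<forall>\<tau>\<in>carrier GG. (\<forall>s\<in>S. \<tau> s = \<sigma> s) \<longrightarrow> \<tau> \<in> A)"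
        "finite T \<and> T \<subseteq> Qab \<and> (\<forall>\<tau>\<in>carrier GG. (\<forall>s\<in>T. \<tau> s = \<sigma> s) \<longrightarrow> \<tau> \<in> B)" using Int by blast
      then show "\<exists>S. finite S \<and> S \<subseteq> Qab \<and> (\<forall>\<tau>\<in>carrier GG. (\<forall>s\<in>S. \<tau> s = \<sigma> s) \<longrightarrow> \<tau> \<in> A \<inter> B)"
        by (intro exI[of _ "S \<union> T"]) auto
    qed
  next
    case (UN \<K>)
    show ?case
    proof
      assume "\<sigma> \<in> \<Union>\<K>"
      then obtain A where A: "A \<in> \<K>" "\<sigma> \<in> A" by blast
      then obtain S where "finite S" "S \<subseteq> Qab" "\<forall>\<tau>\<in>carrier GG. (\<forall>s\<in>S. \<tau> s = \<sigma> s) \<longrightarrow> \<tau> \<in> A"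
        using UN.IH[OF A(1)] by auto
      then show "\<exists>S. finite S \<and> S \<subseteq> Qab \<and> (\<forall>\<tau>\<in>carrier GG. (\<forall>s\<in>S. \<tau> s = \<sigma> s) \<longrightarrow> \<tau> \<in> \<Union>\<K>)"
        using A(1) by (intro exI[of _ S]) blast
    qed
  next
    case (Basis B)
    then obtain \<rho> F where B: "B = \<rho> <#\<^bsub>GG\<^esub> carrier (Gal Qab F)" "\<rho> \<in> carrier GG" "F \<in> KK" by blast
    show ?case unfolding B(1) by (intro impI galois_coset_determined[OF B(3,2) assms(3)])
  next
    case Empty
    show ?case by simp
  qed
  then obtain S where "finite S" "S \<subseteq> Qab" "\<forall>\<tau>\<in>carrier GG. (\<forall>s\<in>S. \<tau> s = \<sigma> s) \<longrightarrow> \<tau> \<in> W"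
    using assms(2) by auto
  then show thesis by (intro that[of S]) simp_all
qed

lemma Rats_in_KK: "\<rat> \<in> KK"
proof -
  interpret CC: field CC by (rule field_CC)
  have "CC.dimension 1 \<rat> \<rat>" using CC.dimension_one[OF subfield_Rats_CC] .
  then show ?thesis using subfield_Rats_CC subfield_Rats[OF subfield_Qab]
    by (auto simp: KK_def number_field_def CC.finite_dimension_def)
qed

context
  fixes \<psi> :: "(complex \<Rightarrow> complex) \<Rightarrow> complex"
  assumes \<psi>: "finite_order_char \<psi>"
begin

lemma char_mult: "\<sigma> \<in> carrier GG \<Longrightarrow> \<tau> \<in> carrier GG \<Longrightarrow> \<psi> (\<sigma> \<otimes>\<^bsub>GG\<^esub> \<tau>) = \<psi> \<sigma> * \<psi> \<tau>"
  using \<psi> hom_mult[of \<psi> GG "mult_of CC"] by (simp add: finite_order_char_def)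

lemma char_one: "\<psi> \<one>\<^bsub>GG\<^esub> = 1" and char_nonzero: "\<sigma> \<in> carrier GG \<Longrightarrow> \<psi> \<sigma> \<noteq> 0"
proof -
  interpret GG: group GG by (rule group_GG)
  show nz: "\<psi> \<sigma> \<noteq> 0" if "\<sigma> \<in> carrier GG" for \<sigma>
    using \<psi> hom_in_carrier[of \<psi> GG "mult_of CC" \<sigma>] that by (simp add: finite_order_char_def)
  have "\<psi> \<one>\<^bsub>GG\<^esub> * \<psi> \<one>\<^bsub>GG\<^esub> = \<psi> \<one>\<^bsub>GG\<^esub>" using char_mult[of "\<one>\<^bsub>GG\<^esub>" "\<one>\<^bsub>GG\<^esub>"] by simp
  then show "\<psi> \<one>\<^bsub>GG\<^esub> = 1" using nz[of "\<one>\<^bsub>GG\<^esub>"] by simp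
qed

lemma char_pow: "\<sigma> \<in> carrier GG \<Longrightarrow> \<psi> (\<sigma> [^]\<^bsub>GG\<^esub> (n::nat)) = \<psi> \<sigma> ^ n"
proof (induction n)
  case (Suc n)
  interpret GG: group GG by (rule group_GG)
  show ?case using Suc char_mult[of "\<sigma> [^]\<^bsub>GG\<^esub> n" \<sigma>] by (simp add: mult.commute)
qed (simp add: char_one)

lemma char_inv: "\<sigma> \<in> carrier GG \<Longrightarrow> \<psi> (inv\<^bsub>GG\<^esub> \<sigma>) = inverse (\<psi> \<sigma>)"
proof -
  assume s: "\<sigma> \<in> carrier GG"
  interpret GG: group GG by (rule group_GG)
  have "\<psi> \<sigma> * \<psi> (inv\<^bsub>GG\<^esub> \<sigma>) = 1" using char_mult[of \<sigma> "inv\<^bsub>GG\<^esub> \<sigma>"] s char_one by simp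
  then show ?thesis by (simp add: inverse_unique)
qed

lemma char_kernel: "kernel GG (mult_of CC) \<psi> = {\<sigma> \<in> carrier GG. \<psi> \<sigma> = 1}"
  by (simp add: kernel_def)

text \<open>Since \<open>\<psi>\<close> is continuous with finitely many values, its kernel is open and so contains the stabilizer of a
finite set.\<close>

lemma char_kernel_open:
  obtains S where "finite S" "S \<subseteq> Qab" "\<And>\<sigma>. \<sigma> \<in> carrier GG \<Longrightarrow> (\<And>s. s \<in> S \<Longrightarrow> \<sigma> s = s) \<Longrightarrow> \<psi> \<sigma> = 1"
proof -
  interpret GG: group GG by (rule group_GG)
  obtain n where n: "n > 0" "\<And>\<sigma>. \<sigma> \<in> carrier GG \<Longrightarrow> \<psi> \<sigma> ^ n = 1" using \<psi> by (auto simp: finite_order_char_def)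
  \<comment> \<open>A neighbourhood of \<open>1\<close> that contains no other value of \<open>\<psi>\<close>.\<close>
  define U where "U = - {z::complex. z ^ n = 1 \<and> z \<noteq> 1}"
  have "finite {z::complex. z ^ n = 1 \<and> z \<noteq> 1}"
    by (rule finite_subset[OF _ finite_roots_unity[of n]]) (use n(1) in auto)
  then have "open U" unfolding U_def by (intro open_Compl finite_imp_closed)
  have top: "\<one>\<^bsub>GG\<^esub> \<in> topspace krull_topology"
  proof -
    have "\<one>\<^bsub>GG\<^esub> \<in> \<one>\<^bsub>GG\<^esub> <#\<^bsub>GG\<^esub> carrier (Gal Qab \<rat>)"
      using GG.one_closed by (force simp: l_coset_def GG_def[symmetric])
    then show ?thesis unfolding krull_topology_def topology_generated_by_topspace using Rats_in_KK GG.one_closed by blast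
  qed
  have "continuous_map krull_topology euclidean \<psi>" using \<psi> by (simp add: finite_order_char_def)
  then have "openin krull_topology {\<sigma> \<in> topspace krull_topology. \<psi> \<sigma> \<in> U}"
    using \<open>open U\<close> by (auto simp: continuous_map_def)
  moreover have "\<one>\<^bsub>GG\<^esub> \<in> {\<sigma> \<in> topspace krull_topology. \<psi> \<sigma> \<in> U}" using top char_one by (simp add: U_def)
  ultimately obtain S where S: "finite S" "S \<subseteq> Qab"
    "\<And>\<tau>. \<tau> \<in> carrier GG \<Longrightarrow> (\<And>s. s \<in> S \<Longrightarrow> \<tau> s = \<one>\<^bsub>GG\<^esub> s) \<Longrightarrow> \<tau> \<in> {\<sigma> \<in> topspace krull_topology. \<psi> \<sigma> \<in> U}"
    using krull_open_determined[OF _ _ GG.one_closed] by blast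
  show thesis
  proof (rule that[OF S(1,2)])
    fix \<sigma> assume s: "\<sigma> \<in> carrier GG" "\<And>s. s \<in> S \<Longrightarrow> \<sigma> s = s"
    have "\<sigma> \<in> {\<sigma> \<in> topspace krull_topology. \<psi> \<sigma> \<in> U}"
      by (rule S(3)[OF s(1)]) (use s(2) S(2) GG_one_apply in auto)
    then have "\<psi> \<sigma> \<in> U" by simp
    then show "\<psi> \<sigma> = 1" using n(2)[OF s(1)] by (simp add: U_def)
  qed
qed

lemma subfield_char_field: "subfield (char_field \<psi>) CC"
  unfolding char_field_def char_kernel
  by (rule subfield_fixed_field[OF subfield_Qab]) (use Gal_memD(1) in \<open>auto simp: GG_def\<close>)

lemma char_field_subset_Qab: "char_field \<psi> \<subseteq> Qab"
  by (auto simp: char_field_def fixed_field_def)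

text \<open>By \<open>char_kernel_open\<close>, the kernel of \<open>\<psi>\<close> contains the automorphisms that fix some finite set \<open>S\<close>. Let
\<open>V\<close> be the field belonging to \<open>S\<close>; it has finitely many automorphisms and contains \<open>K\<close>. If \<open>\<sigma>\<close> fixes
\<open>K\<close>, then Artin's lemma, for the group \<open>H\<close> of restrictions to \<open>V\<close> of elements of the kernel, yields an
element \<open>\<kappa>\<close> of the kernel that agrees with \<open>\<sigma>\<close> on \<open>V\<close>. So \<open>\<kappa>\<inverse> \<sigma>\<close> fixes
\<open>S\<close>, and \<open>\<psi>\<close> takes the same value at \<open>\<sigma>\<close> and at \<open>\<kappa>\<close>.\<close>

lemma char_field_galois:
  shows "finite (carrier (Gal (char_field \<psi>) \<rat>))"
    and "\<sigma> \<in> carrier GG \<Longrightarrow> (\<forall>x\<in>char_field \<psi>. \<sigma> x = x) \<longleftrightarrow> \<psi> \<sigma> = 1"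
proof -
  interpret GG: group GG by (rule group_GG)
  obtain S where S: "finite S" "S \<subseteq> Qab" "\<And>\<sigma>. \<sigma> \<in> carrier GG \<Longrightarrow> (\<And>s. s \<in> S \<Longrightarrow> \<sigma> s = s) \<Longrightarrow> \<psi> \<sigma> = 1"
    using char_kernel_open by blast
  define V where "V = fixed_field Qab {\<sigma> \<in> carrier GG. \<forall>s\<in>S. \<sigma> s = s}"
  have V: "subfield V CC" "V \<subseteq> Qab" "S \<subseteq> V" "finite (carrier (Gal V \<rat>))"
    using fixing_finite_set[OF S(1,2)] by (simp_all add: V_def)
  have "char_field \<psi> \<subseteq> V" unfolding char_field_def char_kernel V_def fixed_field_def using S(3) by auto
  then show "finite (carrier (Gal (char_field \<psi>) \<rat>))"
    by (rule finite_Gal_subfield[OF V(1,2,4) subfield_char_field])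
  assume \<sigma>: "\<sigma> \<in> carrier GG"
  show "(\<forall>x\<in>char_field \<psi>. \<sigma> x = x) \<longleftrightarrow> \<psi> \<sigma> = 1"
  proof
    assume "\<psi> \<sigma> = 1"
    then show "\<forall>x\<in>char_field \<psi>. \<sigma> x = x" using \<sigma> unfolding char_field_def char_kernel fixed_field_def by blast
  next
    assume fix_\<sigma>: "\<forall>x\<in>char_field \<psi>. \<sigma> x = x"
    have nV: "normal_field V" by (rule normal_field_Qab[OF V(1,2)])
    obtain \<theta> where \<theta>: "\<theta> \<in> V" "inj_on (\<lambda>\<tau>. \<tau> \<theta>) (carrier (Gal V \<rat>))"
      using exists_separating_element[OF nV subfield_Rats[OF V(1)] V(4)] by blast
    have res: "restrict \<tau> V \<in> carrier (Gal V \<rat>)" if "\<tau> \<in> carrier GG" for \<tau>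
      by (rule GG_restrict[OF V(1,2) that subfield_Rats[OF V(1)]]) (use that Gal_memD(3) in \<open>auto simp: GG_def\<close>)
    interpret GV: group "Gal V \<rat>" by (rule group_Gal[OF V(1) subfield_Rats[OF V(1)]])
    have res_mult: "restrict (\<tau> \<otimes>\<^bsub>GG\<^esub> \<upsilon>) V = restrict \<tau> V \<otimes>\<^bsub>Gal V \<rat>\<^esub> restrict \<upsilon> V"
      if h: "\<tau> \<in> carrier GG" "\<upsilon> \<in> carrier GG" for \<tau> \<upsilon>
    proof (rule Gal_eqI[OF res[OF GG.m_closed[OF h]] GV.m_closed[OF res[OF h(1)] res[OF h(2)]]])
      fix x assume x: "x \<in> V"
      then have xQ: "x \<in> Qab" using V(2) by blast
      have "\<upsilon> x \<in> V" using Gal_memD(2)[OF res[OF h(2)] x] x by simp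
      then show "restrict (\<tau> \<otimes>\<^bsub>GG\<^esub> \<upsilon>) V x = (restrict \<tau> V \<otimes>\<^bsub>Gal V \<rat>\<^esub> restrict \<upsilon> V) x"
        using x GG_mult_apply[OF h xQ] Gal_mult_apply[OF V(1) subfield_Rats[OF V(1)] res[OF h(1)] res[OF h(2)] x] by simp
    qed
    define H where "H = (\<lambda>\<tau>. restrict \<tau> V) ` {\<tau> \<in> carrier GG. \<psi> \<tau> = 1}"
    have "subgroup H (Gal V \<rat>)"
    proof (rule GV.subgroupI)
      show "H \<subseteq> carrier (Gal V \<rat>)" using res by (auto simp: H_def)
      show "H \<noteq> {}" using char_one by (auto simp: H_def)
      show "a \<otimes>\<^bsub>Gal V \<rat>\<^esub> b \<in> H" if ab: "a \<in> H" "b \<in> H" for a b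
      proof -
        obtain \<tau> \<upsilon> where t: "\<tau> \<in> carrier GG" "\<psi> \<tau> = 1" "a = restrict \<tau> V" "\<upsilon> \<in> carrier GG" "\<psi> \<upsilon> = 1" "b = restrict \<upsilon> V"
          using ab by (auto simp: H_def)
        have "\<tau> \<otimes>\<^bsub>GG\<^esub> \<upsilon> \<in> {\<tau> \<in> carrier GG. \<psi> \<tau> = 1}" using t char_mult by simp
        then show ?thesis unfolding H_def by (rule image_eqI[rotated]) (simp only: t(3,6) res_mult[OF t(1,4)])
      qed
      show "inv\<^bsub>Gal V \<rat>\<^esub> a \<in> H" if a: "a \<in> H" for a
      proof -
        obtain \<tau> where t: "\<tau> \<in> carrier GG" "\<psi> \<tau> = 1" "a = restrict \<tau> V" using a by (auto simp: H_def)
        have i: "inv\<^bsub>GG\<^esub> \<tau> \<in> {\<tau> \<in> carrier GG. \<psi> \<tau> = 1}" using t char_inv by simp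
        have o: "restrict \<one>\<^bsub>GG\<^esub> V = \<one>\<^bsub>Gal V \<rat>\<^esub>"
          by (rule Gal_eqI[OF res[OF GG.one_closed] GV.one_closed])
            (use GG_one_apply V(2) Gal_one_apply[OF V(1) subfield_Rats[OF V(1)]] in auto)
        have "inv\<^bsub>Gal V \<rat>\<^esub> a = restrict (inv\<^bsub>GG\<^esub> \<tau>) V"
          by (rule GV.inv_equality) (use res_mult[of "inv\<^bsub>GG\<^esub> \<tau>" \<tau>] t i res o in auto)
        then show ?thesis unfolding H_def by (rule image_eqI[OF _ i])
      qed
    qed
    moreover have "restrict \<sigma> V x = x" if x: "x \<in> fixed_field V H" for x
    proof -
      have "x \<in> V" using x by (simp add: fixed_field_def)
      moreover have "x \<in> char_field \<psi>"
        unfolding char_field_def char_kernel fixed_field_def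
        using x V(2) by (auto simp: fixed_field_def H_def)
      ultimately show ?thesis using fix_\<sigma> by simp
    qed
    ultimately have "restrict \<sigma> V \<in> H"
      using artin[OF V(1) _ subfield_Rats[OF V(1)] \<theta>, of H "restrict \<sigma> V"] res[OF \<sigma>] V(2) Qab_subset_Qbar by blast
    then obtain \<kappa> where \<kappa>: "\<kappa> \<in> carrier GG" "\<psi> \<kappa> = 1" "restrict \<sigma> V = restrict \<kappa> V" by (auto simp: H_def)
    let ?\<rho> = "inv\<^bsub>GG\<^esub> \<kappa> \<otimes>\<^bsub>GG\<^esub> \<sigma>"
    have "?\<rho> s = s" if s: "s \<in> S" for s
    proof -
      have sQ: "s \<in> Qab" "s \<in> V" using s S(2) V(3) by auto
      have "\<sigma> s = \<kappa> s" using \<kappa>(3) sQ(2) by (metis restrict_apply')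
      then show ?thesis using GG_mult_apply[OF _ \<sigma> sQ(1), of "inv\<^bsub>GG\<^esub> \<kappa>"] GG_inv_apply(1)[OF \<kappa>(1) sQ(1)] \<kappa>(1) by simp
    qed
    then have "\<psi> ?\<rho> = 1" using S(3)[of ?\<rho>] \<kappa>(1) \<sigma> by simp
    then show "\<psi> \<sigma> = 1" using char_mult[of "inv\<^bsub>GG\<^esub> \<kappa>" \<sigma>] char_inv[OF \<kappa>(1)] \<kappa> \<sigma> by simp
  qed
qed

lemma char_field_in_KK: "char_field \<psi> \<in> KK"
  using number_field_if_normal_finite[OF normal_field_Qab[OF subfield_char_field char_field_subset_Qab] char_field_galois(1)]
    char_field_subset_Qab by (simp add: KK_def)

end

section \<open>Abelian groups acted on by integer polynomials\<close>

locale int_poly_action = comm_group A for A :: "('a, 'm) monoid_scheme" (structure) +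
  fixes act :: "int poly \<Rightarrow> 'a \<Rightarrow> 'a"
  assumes act_closed: "x \<in> carrier A \<Longrightarrow> act P x \<in> carrier A"
    and act_hom: "x \<in> carrier A \<Longrightarrow> y \<in> carrier A \<Longrightarrow> act P (x \<otimes> y) = act P x \<otimes> act P y"
    and act_add: "x \<in> carrier A \<Longrightarrow> act (P + Q) x = act P x \<otimes> act Q x"
    and act_mult: "x \<in> carrier A \<Longrightarrow> act (P * Q) x = act P (act Q x)"
begin

lemma act_one_elem: "act P \<one> = \<one>"
  using act_hom[of \<one> \<one> P] act_closed[of \<one> P] by simp

lemma annihilator_ideal:
  assumes "x \<in> carrier A" shows "poly_ideal {P. act P x = \<one>}"
proof -
  have "act 0 x = \<one>" using act_add[OF assms, of 0 0] act_closed[OF assms, of 0] by simp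
  then show ?thesis using assms by (simp add: poly_ideal_def act_add act_mult act_one_elem)
qed

lemma cyclotomic_kernel_eq_norm_kernel:
  assumes g: "0 < g" and X: "\<And>x. x \<in> carrier A \<Longrightarrow> act (X_pow_minus_1 g) x = \<one>"
    and D: "\<And>m. m \<in> D \<Longrightarrow> m dvd g \<and> 1 < m" "\<And>l. prime l \<Longrightarrow> l dvd g \<Longrightarrow> l \<in> D"
  shows "{x \<in> carrier A. act (cyclotomic g) x = \<one>} = {x \<in> carrier A. \<forall>m\<in>D. act (geometric_norm g m) x = \<one>}"
proof (intro Collect_cong conj_cong refl iffI ballI)
  fix x assume x: "x \<in> carrier A"
  note J = annihilator_ideal[OF x]
  show "act (geometric_norm g m) x = \<one>" if "act (cyclotomic g) x = \<one>" "m \<in> D" for m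
    using geometric_norm_mem_ideal[OF J g] D(1)[OF that(2)] that(1) by blast
  show "act (cyclotomic g) x = \<one>" if "\<forall>m\<in>D. act (geometric_norm g m) x = \<one>"
    using cyclotomic_mem_ideal[OF J g] X[OF x] D(2) that by blast
qed

end

text \<open>An element of a subgroup of order \<open>m\<close> has trivial \<open>m\<close>-th power, so it is a power of \<open>\<sigma>\<close> whose
exponent is divisible by \<open>g/m\<close>. There are \<open>m\<close> such powers.\<close>

lemma (in group) cyclic_subgroup_powers:
  assumes fin: "finite (carrier G)" and \<sigma>: "\<sigma> \<in> carrier G" "generate G {\<sigma>} = carrier G"
    and H: "subgroup H G"
  defines "g \<equiv> card (carrier G)" and "m \<equiv> card H"
  shows "m dvd g" "bij_betw (\<lambda>i. \<sigma> [^]\<^bsub>G\<^esub> (i * (g div m))) {..<m} H"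
proof -
  have ord: "ord \<sigma> = g" using generate_pow_card[OF \<sigma>(1)] \<sigma>(2) by (simp add: g_def)
  have g0: "0 < g" unfolding g_def using fin one_closed by (auto simp: card_gt_0_iff)
  have HG: "H \<subseteq> carrier G" using subgroup.subset[OF H] .
  have m0: "0 < m" unfolding m_def using finite_subset[OF HG fin] subgroup.one_closed[OF H] by (auto simp: card_gt_0_iff)
  show mg: "m dvd g" unfolding m_def g_def using lagrange[OF H] by (intro dvdI[of _ _ "card (rcosets\<^bsub>G\<^esub> H)"]) (simp add: Coset.order_def mult.commute[of "card H"])
  define k where "k = g div m"
  have k: "g = m * k" "0 < k" using mg g0 by (auto simp: k_def)
  have inj: "inj_on (\<lambda>i. \<sigma> [^] (i * k)) {..<m}"
  proof (rule inj_onI)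
    fix i j assume ij: "i \<in> {..<m}" "j \<in> {..<m}" "\<sigma> [^] (i * k) = \<sigma> [^] (j * k)"
    have "i * k < m * k" "j * k < m * k" using ij(1,2) k(2) by simp_all
    then have "i * k \<le> ord \<sigma> - 1" "j * k \<le> ord \<sigma> - 1" unfolding ord k(1) by linarith+
    then have "i * k \<in> {0..ord \<sigma> - 1}" "j * k \<in> {0..ord \<sigma> - 1}" by simp_all
    then have "i * k = j * k" using ij(3) inj_onD[OF ord_inj[OF \<sigma>(1)]] by blast
    then show "i = j" using k(2) by simp
  qed
  have "H \<subseteq> (\<lambda>i. \<sigma> [^] (i * k)) ` {..<m}"
  proof
    fix h assume h: "h \<in> H"
    then have hG: "h \<in> carrier G" using HG by blast
    then obtain j :: nat where j: "h = \<sigma> [^] j"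
      using generate_pow_on_finite_carrier[OF fin \<sigma>(1)] \<sigma>(2) by auto
    have "h [^] m = \<one>"
    proof -
      interpret HH: group "G\<lparr>carrier := H\<rparr>" by (rule subgroup_imp_group[OF H])
      have "h [^]\<^bsub>G\<lparr>carrier := H\<rparr>\<^esub> Coset.order (G\<lparr>carrier := H\<rparr>) = \<one>\<^bsub>G\<lparr>carrier := H\<rparr>\<^esub>"
        using HH.pow_order_eq_1[of h] h by simp
      then show ?thesis by (simp add: Coset.order_def m_def flip: nat_pow_consistent)
    qed
    then have "\<sigma> [^] (j * m) = \<one>" using j \<sigma>(1) by (simp add: nat_pow_pow)
    then have "m * k dvd m * j" using pow_eq_id[OF \<sigma>(1)] ord k(1) by (simp add: mult.commute)
    then have "k dvd j" using m0 by simp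
    then obtain i where "j = k * i" by (rule dvdE)
    then have i: "j = i * k" by (simp add: mult.commute)
    have "\<sigma> [^] (i * k) = \<sigma> [^] ((i mod m) * k)"
    proof -
      have "i * k = g * (i div m) + (i mod m) * k"
        unfolding k(1) using div_mult_mod_eq[of i m] by (metis add_mult_distrib mult.assoc mult.commute)
      then have "\<sigma> [^] (i * k) = (\<sigma> [^] g) [^] (i div m) \<otimes> \<sigma> [^] ((i mod m) * k)"
        using \<sigma>(1) by (simp only: nat_pow_pow nat_pow_mult)
      then show ?thesis using pow_ord_eq_1[OF \<sigma>(1)] ord \<sigma>(1) by simp
    qed
    then show "h \<in> (\<lambda>i. \<sigma> [^] (i * k)) ` {..<m}" using j i m0 by auto
  qed
  moreover have "card ((\<lambda>i. \<sigma> [^] (i * k)) ` {..<m}) = card H" using card_image[OF inj] by (simp add: m_def)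
  ultimately have "(\<lambda>i. \<sigma> [^] (i * k)) ` {..<m} = H" using card_subset_eq[of "(\<lambda>i. \<sigma> [^] (i * k)) ` {..<m}" H] by auto
  then show "bij_betw (\<lambda>i. \<sigma> [^] (i * (g div m))) {..<m} H" using inj by (simp add: bij_betw_def k_def)
qed

section \<open>Cyclic abelian number fields\<close>

locale cyclic_abelian_field =
  fixes K :: "complex set" and \<sigma> :: "complex \<Rightarrow> complex"
  assumes subfield_K: "subfield K CC" and K_Qab: "K \<subseteq> Qab"
    and finite_Gal: "finite (carrier (Gal K \<rat>))"
    and \<sigma>: "\<sigma> \<in> carrier (Gal K \<rat>)" and gen: "generate (Gal K \<rat>) {\<sigma>} = carrier (Gal K \<rat>)"
begin

abbreviation "G \<equiv> Gal K \<rat>"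
abbreviation "g \<equiv> card (carrier G)"

sublocale G: group G by (rule group_Gal[OF subfield_K subfield_Rats[OF subfield_K]])

lemma normal_K: "normal_field K" by (rule normal_field_Qab[OF subfield_K K_Qab])

lemma g_pos: "0 < g" using finite_Gal G.one_closed by (auto simp: card_gt_0_iff)

lemma ord_\<sigma>: "G.ord \<sigma> = g" using G.generate_pow_card[OF \<sigma>] gen by simp

lemma degree_K: "field_degree K \<rat> = g"
  by (rule field_degree_eq_card_Gal[OF subfield_K K_Qab finite_Gal subfield_Rats_CC subfield_Rats[OF subfield_K]])

lemma Gal_intermediate_subgroup:
  assumes "subfield k CC" "k \<subseteq> K" shows "subgroup (carrier (Gal K k)) G"
proof -
  interpret H: group "Gal K k" by (rule group_Gal[OF subfield_K assms(2)])
  have sub: "carrier (Gal K k) \<subseteq> carrier G" by (rule Gal_mono[OF subfield_Rats[OF assms(1)]])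
  have mult: "a \<otimes>\<^bsub>G\<^esub> b = a \<otimes>\<^bsub>Gal K k\<^esub> b" for a b by (simp add: Gal_def)
  show ?thesis
  proof (rule G.subgroupI[OF sub])
    show "carrier (Gal K k) \<noteq> {}" using H.one_closed by blast
    fix a assume a: "a \<in> carrier (Gal K k)"
    have "inv\<^bsub>Gal K k\<^esub> a \<otimes>\<^bsub>G\<^esub> a = \<one>\<^bsub>G\<^esub>" unfolding mult using H.l_inv[OF a] by (simp add: Gal_def)
    then have "inv\<^bsub>G\<^esub> a = inv\<^bsub>Gal K k\<^esub> a" by (rule G.inv_equality) (use a sub H.inv_closed[OF a] in auto)
    then show "inv\<^bsub>G\<^esub> a \<in> carrier (Gal K k)" using a by simp
    show "a \<otimes>\<^bsub>G\<^esub> b \<in> carrier (Gal K k)" if "b \<in> carrier (Gal K k)" for b unfolding mult using a that by simp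
  qed
qed

lemma Gal_proper:
  assumes "subfield k CC" "k \<subset> K" shows "card (carrier (Gal K k)) dvd g" "1 < card (carrier (Gal K k))"
proof -
  have kK: "k \<subseteq> K" using assms(2) by blast
  note H = Gal_intermediate_subgroup[OF assms(1) kK]
  show "card (carrier (Gal K k)) dvd g"
    by (rule G.cyclic_subgroup_powers(1)[OF finite_Gal \<sigma> gen H])
  have fin: "finite (carrier (Gal K k))" by (rule finite_subset[OF subgroup.subset[OF H] finite_Gal])
  have one: "\<one>\<^bsub>G\<^esub> \<in> carrier (Gal K k)" by (rule subgroup.one_closed[OF H])
  show "1 < card (carrier (Gal K k))"
  proof (rule ccontr)
    assume "\<not> 1 < card (carrier (Gal K k))"
    then have "card (carrier (Gal K k)) = 1" using fin one card_gt_0_iff[of "carrier (Gal K k)"] by auto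
    then have "carrier (Gal K k) = {\<one>\<^bsub>G\<^esub>}" using one by (auto simp: card_1_singleton_iff)
    then have "fixed_field K (carrier (Gal K k)) = K"
      by (auto simp: fixed_field_def Gal_one_apply[OF subfield_K subfield_Rats[OF subfield_K]])
    then show False using normal_field_fixed[OF normal_K assms(1) kK] assms(2) by blast
  qed
qed

text \<open>The description of \<open>subfield_of_codegree\<close> is unique: a subfield over which \<open>K\<close> has degree \<open>l\<close> is the fixed
field of its Galois group, and a cyclic group has one subgroup of order \<open>l\<close>. Existence is Artin's lemma for
the subgroup generated by \<open>\<sigma>^(g/l)\<close>.\<close>

lemma subfield_of_codegree_prime:
  assumes l: "prime l" "l dvd g"
  shows "subfield (subfield_of_codegree K l) CC" "subfield_of_codegree K l \<subset> K"
    "card (carrier (Gal K (subfield_of_codegree K l))) = l"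
proof -
  have deg: "field_degree K k = card (carrier (Gal K k))" if "subfield k CC" "k \<subseteq> K" for k
    by (rule field_degree_eq_card_Gal[OF subfield_K K_Qab finite_Gal that])
  have l0: "l \<noteq> 0" using l(1) by auto
  have ex: "\<exists>k. subfield k CC \<and> k \<subseteq> K \<and> field_degree K k = l"
  proof -
    define \<tau> where "\<tau> = \<sigma> [^]\<^bsub>G\<^esub> (g div l)"
    have \<tau>: "\<tau> \<in> carrier G" using \<sigma> by (simp add: \<tau>_def)
    have gl: "g div l dvd g" "g div l \<noteq> 0" using l g_pos l0 by (auto elim!: dvdE)
    have "G.ord \<tau> = g div (g div l)" unfolding \<tau>_def using G.ord_pow[OF \<sigma>, of "g div l"] gl ord_\<sigma> by simp
    also have "\<dots> = l" using l g_pos l0 by (auto elim!: dvdE)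
    finally have card: "card (generate G {\<tau>}) = l" using G.generate_pow_card[OF \<tau>] by simp
    define H where "H = generate G {\<tau>}"
    have H: "subgroup H G" unfolding H_def using \<tau> by (intro G.generate_is_subgroup) simp
    define k where "k = fixed_field K H"
    have sk: "subfield k CC" unfolding k_def
      by (rule subfield_fixed_field[OF subfield_K]) (use Gal_memD(1) subgroup.mem_carrier[OF H] in blast)
    have kK: "k \<subseteq> K" by (auto simp: k_def fixed_field_def)
    obtain \<theta> where \<theta>: "\<theta> \<in> K" "inj_on (\<lambda>\<tau>. \<tau> \<theta>) (carrier G)"
      using exists_separating_element[OF normal_K subfield_Rats[OF subfield_K] finite_Gal] by blast
    have "carrier (Gal K k) = H"
    proof (intro equalityI subsetI)
      fix \<rho> assume "\<rho> \<in> H"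
      then show "\<rho> \<in> carrier (Gal K k)"
        using subgroup.mem_carrier[OF H] unfolding Gal_mem_iff k_def fixed_field_def by blast
    next
      fix \<rho> assume r: "\<rho> \<in> carrier (Gal K k)"
      show "\<rho> \<in> H"
      proof (rule artin[OF subfield_K _ subfield_Rats[OF subfield_K] \<theta> H])
        show "K \<subseteq> Qbar" using K_Qab Qab_subset_Qbar by blast
        show "\<rho> \<in> carrier G" using r Gal_mono[OF subfield_Rats[OF sk]] by blast
        show "\<rho> x = x" if "x \<in> fixed_field K H" for x using Gal_memD(3)[OF r] that by (simp add: k_def)
      qed
    qed
    then show ?thesis using sk kK deg[OF sk kK] card by (auto simp: H_def)
  qed
  have uniq: "k = k'" if "subfield k CC \<and> k \<subseteq> K \<and> field_degree K k = l" "subfield k' CC \<and> k' \<subseteq> K \<and> field_degree K k' = l" for k k'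
  proof -
    have img: "carrier (Gal K k) = (\<lambda>i. \<sigma> [^]\<^bsub>G\<^esub> (i * (g div l))) ` {..<l}"
      if "subfield k CC \<and> k \<subseteq> K \<and> field_degree K k = l" for k
      using G.cyclic_subgroup_powers(2)[OF finite_Gal \<sigma> gen Gal_intermediate_subgroup[of k]] deg[of k] that
      by (simp add: bij_betw_def)
    have eq: "carrier (Gal K k) = carrier (Gal K k')" by (rule trans[OF img[OF that(1)] img[OF that(2), symmetric]])
    have "fixed_field K (carrier (Gal K k)) = k" by (rule normal_field_fixed[OF normal_K]) (use that in simp_all)
    moreover have "fixed_field K (carrier (Gal K k')) = k'" by (rule normal_field_fixed[OF normal_K]) (use that in simp_all)
    ultimately show ?thesis unfolding eq by (rule trans[OF sym])
  qed
  have "\<exists>!k. subfield k CC \<and> k \<subseteq> K \<and> field_degree K k = l" using ex uniq by blast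
  from theI'[OF this] have k: "subfield (subfield_of_codegree K l) CC" "subfield_of_codegree K l \<subseteq> K"
    "field_degree K (subfield_of_codegree K l) = l" by (simp_all add: subfield_of_codegree_def)
  show "subfield (subfield_of_codegree K l) CC" by (rule k(1))
  show c: "card (carrier (Gal K (subfield_of_codegree K l))) = l" using deg[OF k(1,2)] k(3) by simp
  interpret KK: group "Gal K K" by (rule group_Gal[OF subfield_K subset_refl])
  have "\<tau> = \<one>\<^bsub>Gal K K\<^esub>" if "\<tau> \<in> carrier (Gal K K)" for \<tau>
    by (rule Gal_eqI[OF that KK.one_closed]) (use Gal_memD(3)[OF that] Gal_one_apply[OF subfield_K subset_refl] in simp)
  then have "carrier (Gal K K) \<subseteq> {\<one>\<^bsub>Gal K K\<^esub>}" by blast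
  then have "card (carrier (Gal K K)) \<le> 1" using card_mono[of "{\<one>\<^bsub>Gal K K\<^esub>}"] by fastforce
  then have "subfield_of_codegree K l \<noteq> K" using c prime_gt_1_nat[OF l(1)] by auto
  then show "subfield_of_codegree K l \<subset> K" using k(2) by blast
qed

lemma poly_at_extend_range:
  assumes "degree P \<le> n"
  shows "poly_at G P \<sigma> = (\<Sum>i\<le>n. frag_cmul (coeff P i) (frag_of (\<sigma> [^]\<^bsub>G\<^esub> i)))"
  unfolding poly_at_def using assms by (intro sum.mono_neutral_left) (auto simp: coeff_eq_0)

lemma poly_at_add: "poly_at G (P + Q) \<sigma> = poly_at G P \<sigma> + poly_at G Q \<sigma>"
proof -
  define n where "n = max (degree P) (degree Q)"
  have "degree P \<le> n" "degree Q \<le> n" "degree (P + Q) \<le> n" using degree_add_le_max[of P Q] by (auto simp: n_def)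
  then show ?thesis by (simp add: poly_at_extend_range[of _ n] frag_cmul_distrib sum.distrib)
qed

lemma poly_at_sum: "poly_at G (\<Sum>i\<in>I. P i) \<sigma> = (\<Sum>i\<in>I. poly_at G (P i) \<sigma>)"
proof (induction I rule: infinite_finite_induct)
  case (insert i I) then show ?case by (simp add: poly_at_add)
qed (simp_all add: poly_at_def)

lemma poly_at_monom: "poly_at G (monom 1 n) \<sigma> = frag_of (\<sigma> [^]\<^bsub>G\<^esub> n)"
proof -
  have "poly_at G (monom 1 n) \<sigma> = (\<Sum>i\<le>n. if i = n then frag_of (\<sigma> [^]\<^bsub>G\<^esub> i) else 0)"
    unfolding poly_at_extend_range[OF degree_monom_le] by (rule sum.cong) auto
  then show ?thesis by simp
qed

lemma keys_poly_at: "Poly_Mapping.keys (poly_at G P \<sigma>) \<subseteq> carrier G"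
proof -
  have "poly_at G P \<sigma> \<in> carrier (free_Abelian_group (carrier G))"
    unfolding poly_at_def using \<sigma> by (intro sum_closed_free_Abelian_group) (auto dest!: subsetD[OF keys_cmul])
  then show ?thesis by simp
qed

lemma alg_norm_eq_poly_at:
  assumes "subfield k CC" "k \<subseteq> K"
  shows "alg_norm K k = poly_at G (geometric_norm g (card (carrier (Gal K k)))) \<sigma>"
proof -
  let ?m = "card (carrier (Gal K k))"
  have "poly_at G (geometric_norm g ?m) \<sigma> = (\<Sum>i<?m. frag_of (\<sigma> [^]\<^bsub>G\<^esub> (i * (g div ?m))))"
    unfolding geometric_norm_def poly_at_sum poly_at_monom ..
  also have "\<dots> = (\<Sum>\<tau>\<in>carrier (Gal K k). frag_of \<tau>)"
    by (rule sum.reindex_bij_betw[OF G.cyclic_subgroup_powers(2)[OF finite_Gal \<sigma> gen Gal_intermediate_subgroup[OF assms]]])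
  finally show ?thesis by (simp add: alg_norm_def)
qed

end

text \<open>Restriction to \<open>K\<close> identifies the quotient by the kernel of \<open>\<psi>\<close> with the Galois group of \<open>K\<close>. So the
\<open>n\<close>-th power of \<open>\<psi>\<close> is trivial if and only if \<open>n\<close> is a multiple of the order of \<open>\<sigma>\<close>.\<close>

lemma char_order_eq:
  assumes \<psi>: "finite_order_char \<psi>" and \<sigma>: "\<sigma> \<in> carrier (Gal (char_field \<psi>) \<rat>)"
    and gen: "generate (Gal (char_field \<psi>) \<rat>) {\<sigma>} = carrier (Gal (char_field \<psi>) \<rat>)"
  shows "char_order \<psi> = card (carrier (Gal (char_field \<psi>) \<rat>))"
proof -
  interpret cyclic_abelian_field "char_field \<psi>" \<sigma>
    by (rule cyclic_abelian_field.intro) (use \<sigma> gen subfield_char_field[OF \<psi>] char_field_subset_Qab[OF \<psi>] char_field_galois(1)[OF \<psi>] in auto)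
  let ?K = "char_field \<psi>"
  interpret GG: group GG by (rule group_GG)
  have res: "restrict s ?K \<in> carrier G" if "s \<in> carrier GG" for s
    by (rule GG_restrict[OF subfield_K K_Qab that subfield_Rats[OF subfield_K]]) (use that Gal_memD(3) in \<open>auto simp: GG_def\<close>)
  have pow: "restrict (s [^]\<^bsub>GG\<^esub> n) ?K = restrict s ?K [^]\<^bsub>G\<^esub> n" if s: "s \<in> carrier GG" for s and n :: nat
  proof (induction n)
    case 0
    show ?case by (rule Gal_eqI[OF res G.nat_pow_closed[OF res[OF s]]])
      (use K_Qab Gal_one_apply[OF subfield_K subfield_Rats[OF subfield_K]] GG_one_apply in auto)
  next
    case (Suc n)
    show ?case
    proof (rule Gal_eqI[OF res G.nat_pow_closed[OF res[OF s]]])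
      show "s [^]\<^bsub>GG\<^esub> Suc n \<in> carrier GG" using s by simp
      fix x assume x: "x \<in> ?K"
      then have xQ: "x \<in> Qab" using K_Qab by blast
      have sx: "s x \<in> ?K" using Gal_memD(2)[OF res[OF s] x] x by simp
      have "(s [^]\<^bsub>GG\<^esub> Suc n) x = (s [^]\<^bsub>GG\<^esub> n) (s x)" using GG_mult_apply[OF _ s xQ] s by simp
      also have "\<dots> = (restrict s ?K [^]\<^bsub>G\<^esub> n) (s x)" 
        unfolding fun_cong[OF Suc, of "s x", symmetric] using sx by simp
      also have "\<dots> = (restrict s ?K [^]\<^bsub>G\<^esub> Suc n) x"
        using Gal_mult_apply[OF subfield_K subfield_Rats[OF subfield_K] G.nat_pow_closed[OF res[OF s]] res[OF s] x] x by simp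
      finally show "restrict (s [^]\<^bsub>GG\<^esub> Suc n) ?K x = (restrict s ?K [^]\<^bsub>G\<^esub> Suc n) x" using x by simp
    qed
  qed
  have ker: "\<psi> s = 1 \<longleftrightarrow> restrict s ?K = \<one>\<^bsub>G\<^esub>" if s: "s \<in> carrier GG" for s
  proof -
    have "(\<forall>x\<in>?K. s x = x) \<longleftrightarrow> restrict s ?K = \<one>\<^bsub>G\<^esub>"
    proof
      assume "\<forall>x\<in>?K. s x = x"
      then show "restrict s ?K = \<one>\<^bsub>G\<^esub>"
        by (intro Gal_eqI[OF res[OF s] G.one_closed]) (simp add: Gal_one_apply[OF subfield_K subfield_Rats[OF subfield_K]])
    next
      assume "restrict s ?K = \<one>\<^bsub>G\<^esub>"
      then show "\<forall>x\<in>?K. s x = x" using Gal_one_apply[OF subfield_K subfield_Rats[OF subfield_K]] by (metis restrict_apply')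
    qed
    then show ?thesis using char_field_galois(2)[OF \<psi> s] by simp
  qed
  have iff: "(\<forall>s\<in>carrier GG. \<psi> s ^ n = 1) \<longleftrightarrow> g dvd n" for n
  proof
    assume all: "\<forall>s\<in>carrier GG. \<psi> s ^ n = 1"
    obtain s where s: "s \<in> carrier GG" "restrict s ?K = \<sigma>" using GG_lift[OF subfield_K K_Qab \<sigma>] by blast
    have "\<sigma> [^]\<^bsub>G\<^esub> n = \<one>\<^bsub>G\<^esub>" using all ker[of "s [^]\<^bsub>GG\<^esub> n"] pow[OF s(1), of n] char_pow[OF \<psi> s(1), of n] s by simp
    then show "g dvd n" using G.pow_eq_id[OF \<sigma>] ord_\<sigma> by simp
  next
    assume "g dvd n"
    show "\<forall>s\<in>carrier GG. \<psi> s ^ n = 1"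
    proof
      fix s assume s: "s \<in> carrier GG"
      have "G.ord (restrict s ?K) dvd n"
        using dvd_trans[OF G.ord_dvd_group_order[OF res[OF s], unfolded Coset.order_def] \<open>g dvd n\<close>] .
      then have "restrict s ?K [^]\<^bsub>G\<^esub> n = \<one>\<^bsub>G\<^esub>" using G.pow_eq_id[OF res[OF s]] by blast
      then show "\<psi> s ^ n = 1" using ker[of "s [^]\<^bsub>GG\<^esub> n"] pow[OF s, of n] char_pow[OF \<psi> s, of n] s by simp
    qed
  qed
  have "char_order \<psi> = (LEAST n. 0 < n \<and> g dvd n)" by (simp add: char_order_def iff)
  also have "\<dots> = g" by (rule Least_equality) (use g_pos in \<open>auto dest: dvd_imp_le\<close>)
  finally show ?thesis .
qed

text \<open>All laws are checked on pure tensors, on which \<open>act P\<close> works in the first factor.\<close>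

lemma int_poly_action_tensor:
  assumes "int_poly_action A act" and B: "comm_group B"
  shows "int_poly_action (tensor A B) (\<lambda>P. tensor_map A B (act P))"
proof -
  interpret A: int_poly_action A act by fact
  interpret tensor_factors A B using A.comm_group_axioms B by (simp add: tensor_factors_def)
  interpret T: comm_group "tensor A B" by (rule comm_group_tensor)
  have ah: "act P \<in> hom A A" for P by (rule homI) (simp_all add: A.act_closed A.act_hom)
  have th: "tensor_map A B (act P) \<in> hom (tensor A B) (tensor A B)" for P
    by (rule tensor_map_hom[OF A.comm_group_axioms A.comm_group_axioms B ah])
  have tp: "tensor_map A B (act P) (pure_tensor A B a b) = pure_tensor A B (act P a) b"
    if "a \<in> carrier A" "b \<in> carrier B" for P a b
    by (rule tensor_map_pure[OF A.comm_group_axioms A.comm_group_axioms B ah that])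
  have tg: "group_hom (tensor A B) (tensor A B) (tensor_map A B (act P))" for P
    using th by (simp add: group_hom_def group_hom_axioms_def)
  note closed = hom_in_carrier[OF th] and mult = hom_mult[OF th] and inv = group_hom.hom_inv[OF tg]
  show ?thesis
  proof (intro int_poly_action.intro int_poly_action_axioms.intro comm_group_tensor)
    fix t P Q assume t: "t \<in> carrier (tensor A B)"
    show "tensor_map A B (act P) t \<in> carrier (tensor A B)" by (rule closed[OF t])
    show "tensor_map A B (act P) (t \<otimes>\<^bsub>tensor A B\<^esub> s) = tensor_map A B (act P) t \<otimes>\<^bsub>tensor A B\<^esub> tensor_map A B (act P) s"
      if "s \<in> carrier (tensor A B)" for s by (rule mult[OF t that])
    show "tensor_map A B (act (P + Q)) t = tensor_map A B (act P) t \<otimes>\<^bsub>tensor A B\<^esub> tensor_map A B (act Q) t"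
      using t
    proof (induction rule: tensor_induct)
      case (pure a b)
      then show ?case using bilinear_pure_tensor by (simp add: tp A.act_add A.act_closed bilinear_on_def)
    next
      case (diff s t)
      then show ?case by (simp add: mult inv closed T.inv_mult T.m_ac)
    qed
    show "tensor_map A B (act (P * Q)) t = tensor_map A B (act P) (tensor_map A B (act Q) t)"
      using t
    proof (induction rule: tensor_induct)
      case (pure a b)
      then show ?case by (simp add: tp A.act_mult A.act_closed)
    next
      case (diff s t)
      then show ?case by (simp add: mult inv closed)
    qed
  qed
qed

section \<open>The chi-part and the norm conditions\<close>

lemma group_ring_simps:
  "carrier (group_ring G) = {c. Poly_Mapping.keys c \<subseteq> carrier G}"
  "c \<oplus>\<^bsub>group_ring G\<^esub> d = c + d" "\<zero>\<^bsub>group_ring G\<^esub> = 0" "\<one>\<^bsub>group_ring G\<^esub> = frag_of \<one>\<^bsub>G\<^esub>"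
  "frag_of a \<otimes>\<^bsub>group_ring G\<^esub> frag_of b = frag_of (a \<otimes>\<^bsub>G\<^esub> b)"
  by (simp_all add: group_ring_def)

locale descended_module = cyclic_abelian_field +
  fixes M :: "complex set \<Rightarrow> ((complex \<Rightarrow> complex) \<Rightarrow>\<^sub>0 int, 'm) module"
  assumes family: "GG_family M" and K_KK: "K \<in> KK"
begin

sublocale M: module "group_ring GG" "M K" using family K_KK by (simp add: GG_family_def)

abbreviation "N \<equiv> descend M K"
abbreviation "A \<equiv> add_monoid N"

definition act :: "int poly \<Rightarrow> 'm \<Rightarrow> 'm"
  where "act P x = poly_at G P \<sigma> \<odot>\<^bsub>N\<^esub> x"

abbreviation lift :: "((complex \<Rightarrow> complex) \<Rightarrow>\<^sub>0 int) \<Rightarrow> ((complex \<Rightarrow> complex) \<Rightarrow>\<^sub>0 int)"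
  where "lift c \<equiv> frag_extend (\<lambda>\<tau>. frag_of (lift_aut K \<tau>)) c"

lemma N_simps: "carrier N = carrier (M K)" "x \<oplus>\<^bsub>N\<^esub> y = x \<oplus>\<^bsub>M K\<^esub> y" "\<zero>\<^bsub>N\<^esub> = \<zero>\<^bsub>M K\<^esub>"
  "c \<odot>\<^bsub>N\<^esub> x = lift c \<odot>\<^bsub>M K\<^esub> x" "A = add_monoid (M K)"
  by (simp_all add: descend_def)

lemma comm_group_A: "comm_group A"
  unfolding N_simps(5) by (rule M.a_comm_group)

lemma lift_aut: assumes "\<tau> \<in> carrier G" shows "lift_aut K \<tau> \<in> carrier GG" "restrict (lift_aut K \<tau>) K = \<tau>"
proof -
  have "\<exists>s. s \<in> carrier GG \<and> restrict s K = \<tau>" using GG_lift[OF subfield_K K_Qab assms] by blast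
  from someI_ex[OF this] show "lift_aut K \<tau> \<in> carrier GG" "restrict (lift_aut K \<tau>) K = \<tau>" by (simp_all add: lift_aut_def)
qed

lemma lift_aut_apply: "\<tau> \<in> carrier G \<Longrightarrow> x \<in> K \<Longrightarrow> lift_aut K \<tau> x = \<tau> x"
  using lift_aut(2)[of \<tau>] by (metis restrict_apply')

lemma lift_closed:
  assumes "Poly_Mapping.keys c \<subseteq> carrier G" shows "lift c \<in> carrier (group_ring GG)"
proof -
  have "Poly_Mapping.keys (lift c) \<subseteq> (\<Union>\<tau>\<in>Poly_Mapping.keys c. Poly_Mapping.keys (frag_of (lift_aut K \<tau>)))"
    by (rule keys_frag_extend)
  also have "\<dots> \<subseteq> carrier GG" using assms lift_aut(1) by auto
  finally show ?thesis by (simp add: group_ring_simps)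
qed

lemma smult_add:
  assumes "c \<in> carrier (group_ring GG)" "d \<in> carrier (group_ring GG)" "x \<in> carrier (M K)"
  shows "(c + d) \<odot>\<^bsub>M K\<^esub> x = c \<odot>\<^bsub>M K\<^esub> x \<oplus>\<^bsub>M K\<^esub> d \<odot>\<^bsub>M K\<^esub> x"
  using M.smult_l_distr[OF assms] by (simp add: group_ring_simps)

lemma smult_frag_of_mult:
  assumes "a \<in> carrier GG" "b \<in> carrier GG" "x \<in> carrier (M K)"
  shows "frag_of (a \<otimes>\<^bsub>GG\<^esub> b) \<odot>\<^bsub>M K\<^esub> x = frag_of a \<odot>\<^bsub>M K\<^esub> (frag_of b \<odot>\<^bsub>M K\<^esub> x)"
  using M.smult_assoc1[of "frag_of a" "frag_of b" x] assms by (simp add: group_ring_simps)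

text \<open>The quotient of the two automorphisms fixes \<open>K\<close> and so acts trivially on \<open>M K\<close>.\<close>

lemma smult_frag_of_cong:
  assumes ab: "a \<in> carrier GG" "b \<in> carrier GG" and eq: "\<And>z. z \<in> K \<Longrightarrow> a z = b z" and x: "x \<in> carrier (M K)"
  shows "frag_of a \<odot>\<^bsub>M K\<^esub> x = frag_of b \<odot>\<^bsub>M K\<^esub> x"
proof -
  interpret GG: group GG by (rule group_GG)
  let ?\<rho> = "inv\<^bsub>GG\<^esub> b \<otimes>\<^bsub>GG\<^esub> a"
  have \<rho>: "?\<rho> \<in> carrier GG" using ab by simp
  have "?\<rho> z = z" if "z \<in> K" for z
    using GG_mult_apply[of "inv\<^bsub>GG\<^esub> b" a z] GG_inv_apply(1)[OF ab(2), of z] ab eq[OF that] that K_Qab by auto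
  then have "?\<rho> \<in> carrier (Gal Qab K)" using \<rho> unfolding GG_def Gal_mem_iff by blast
  then have "frag_of ?\<rho> \<odot>\<^bsub>M K\<^esub> x = x" using family K_KK x by (simp add: GG_family_def)
  moreover have "a = b \<otimes>\<^bsub>GG\<^esub> ?\<rho>" using ab by (simp add: GG.m_assoc[symmetric])
  ultimately show ?thesis using smult_frag_of_mult[OF ab(2) \<rho> x] by simp
qed

text \<open>The chosen lift of \<open>\<sigma> \<otimes> \<tau>\<close> need not be the product of the lifts of \<open>\<sigma>\<close> and \<open>\<tau>\<close>, but both
have the same restriction to \<open>K\<close> and therefore act alike.\<close>

lemma lift_shift:
  assumes "Poly_Mapping.keys c \<subseteq> carrier G" "x \<in> carrier (M K)"
  shows "lift (frag_extend (\<lambda>\<tau>. frag_of (\<sigma> \<otimes>\<^bsub>G\<^esub> \<tau>)) c) \<odot>\<^bsub>M K\<^esub> x =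
    frag_of (lift_aut K \<sigma>) \<odot>\<^bsub>M K\<^esub> (lift c \<odot>\<^bsub>M K\<^esub> x)"
proof -
  let ?s = "frag_extend (\<lambda>\<tau>. frag_of (\<sigma> \<otimes>\<^bsub>G\<^esub> \<tau>))"
  have keys: "Poly_Mapping.keys (?s c) \<subseteq> carrier G" if "Poly_Mapping.keys c \<subseteq> carrier G" for c
  proof -
    have "Poly_Mapping.keys (?s c) \<subseteq> (\<Union>\<tau>\<in>Poly_Mapping.keys c. Poly_Mapping.keys (frag_of (\<sigma> \<otimes>\<^bsub>G\<^esub> \<tau>)))"
      by (rule keys_frag_extend)
    also have "\<dots> \<subseteq> carrier G" using that \<sigma> by auto
    finally show ?thesis .
  qed
  have s: "frag_of (lift_aut K \<sigma>) \<in> carrier (group_ring GG)" using lift_aut(1)[OF \<sigma>] by (simp add: group_ring_simps)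
  have zero: "0 \<odot>\<^bsub>M K\<^esub> x = \<zero>\<^bsub>M K\<^esub>" using M.smult_l_null[OF assms(2)] by (simp add: group_ring_simps)
  show ?thesis using assms(1)
  proof (rule free_Abelian_group_induct)
    show "lift (?s 0) \<odot>\<^bsub>M K\<^esub> x = frag_of (lift_aut K \<sigma>) \<odot>\<^bsub>M K\<^esub> (lift 0 \<odot>\<^bsub>M K\<^esub> x)"
      using M.smult_r_null[OF s] by (simp add: zero)
  next
    fix \<tau> assume t: "\<tau> \<in> carrier G"
    have "frag_of (lift_aut K (\<sigma> \<otimes>\<^bsub>G\<^esub> \<tau>)) \<odot>\<^bsub>M K\<^esub> x = frag_of (lift_aut K \<sigma> \<otimes>\<^bsub>GG\<^esub> lift_aut K \<tau>) \<odot>\<^bsub>M K\<^esub> x"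
    proof (rule smult_frag_of_cong)
      interpret GG: group GG by (rule group_GG)
      show "lift_aut K (\<sigma> \<otimes>\<^bsub>G\<^esub> \<tau>) \<in> carrier GG" "lift_aut K \<sigma> \<otimes>\<^bsub>GG\<^esub> lift_aut K \<tau> \<in> carrier GG"
        using lift_aut(1) \<sigma> t by simp_all
      fix z assume z: "z \<in> K"
      then have zQ: "z \<in> Qab" using K_Qab by blast
      have "lift_aut K (\<sigma> \<otimes>\<^bsub>G\<^esub> \<tau>) z = \<sigma> (\<tau> z)"
        using lift_aut_apply[OF G.m_closed[OF \<sigma> t] z] Gal_mult_apply[OF subfield_K subfield_Rats[OF subfield_K] \<sigma> t z] by simp
      also have "\<dots> = (lift_aut K \<sigma> \<otimes>\<^bsub>GG\<^esub> lift_aut K \<tau>) z"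
        using GG_mult_apply[OF lift_aut(1)[OF \<sigma>] lift_aut(1)[OF t] zQ] lift_aut_apply[OF t z]
          lift_aut_apply[OF \<sigma> Gal_memD(2)[OF t z]] by simp
      finally show "lift_aut K (\<sigma> \<otimes>\<^bsub>G\<^esub> \<tau>) z = (lift_aut K \<sigma> \<otimes>\<^bsub>GG\<^esub> lift_aut K \<tau>) z" .
    qed (rule assms(2))
    then show "lift (?s (frag_of \<tau>)) \<odot>\<^bsub>M K\<^esub> x = frag_of (lift_aut K \<sigma>) \<odot>\<^bsub>M K\<^esub> (lift (frag_of \<tau>) \<odot>\<^bsub>M K\<^esub> x)"
      using smult_frag_of_mult[OF lift_aut(1)[OF \<sigma>] lift_aut(1)[OF t] assms(2)] by simp
  next
    fix c d assume cd: "Poly_Mapping.keys c \<subseteq> carrier G" "Poly_Mapping.keys d \<subseteq> carrier G"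
      and IH: "lift (?s c) \<odot>\<^bsub>M K\<^esub> x = frag_of (lift_aut K \<sigma>) \<odot>\<^bsub>M K\<^esub> (lift c \<odot>\<^bsub>M K\<^esub> x)"
        "lift (?s d) \<odot>\<^bsub>M K\<^esub> x = frag_of (lift_aut K \<sigma>) \<odot>\<^bsub>M K\<^esub> (lift d \<odot>\<^bsub>M K\<^esub> x)"
    have k: "Poly_Mapping.keys (c - d) \<subseteq> carrier G" using cd keys_diff[of c d] by blast
    note cl = lift_closed[OF k] lift_closed[OF cd(2)] lift_closed[OF keys[OF k]] lift_closed[OF keys[OF cd(2)]]
    have "lift (?s (c - d)) \<odot>\<^bsub>M K\<^esub> x \<oplus>\<^bsub>M K\<^esub> lift (?s d) \<odot>\<^bsub>M K\<^esub> x = lift (?s c) \<odot>\<^bsub>M K\<^esub> x"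
      using smult_add[OF cl(3,4) assms(2)] by (simp flip: frag_extend_add)
    moreover have "lift (c - d) \<odot>\<^bsub>M K\<^esub> x \<oplus>\<^bsub>M K\<^esub> lift d \<odot>\<^bsub>M K\<^esub> x = lift c \<odot>\<^bsub>M K\<^esub> x"
      using smult_add[OF cl(1,2) assms(2)] by (simp flip: frag_extend_add)
    then have "frag_of (lift_aut K \<sigma>) \<odot>\<^bsub>M K\<^esub> (lift (c - d) \<odot>\<^bsub>M K\<^esub> x) \<oplus>\<^bsub>M K\<^esub> frag_of (lift_aut K \<sigma>) \<odot>\<^bsub>M K\<^esub> (lift d \<odot>\<^bsub>M K\<^esub> x)
        = frag_of (lift_aut K \<sigma>) \<odot>\<^bsub>M K\<^esub> (lift c \<odot>\<^bsub>M K\<^esub> x)"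
      using M.smult_r_distr[OF s] cl assms(2) by (metis M.smult_closed)
    ultimately have "lift (?s (c - d)) \<odot>\<^bsub>M K\<^esub> x \<oplus>\<^bsub>M K\<^esub> lift (?s d) \<odot>\<^bsub>M K\<^esub> x =
        frag_of (lift_aut K \<sigma>) \<odot>\<^bsub>M K\<^esub> (lift (c - d) \<odot>\<^bsub>M K\<^esub> x) \<oplus>\<^bsub>M K\<^esub> lift (?s d) \<odot>\<^bsub>M K\<^esub> x"
      using IH by simp
    then show "lift (?s (c - d)) \<odot>\<^bsub>M K\<^esub> x = frag_of (lift_aut K \<sigma>) \<odot>\<^bsub>M K\<^esub> (lift (c - d) \<odot>\<^bsub>M K\<^esub> x)"
      using M.add.r_cancel cl assms(2) s M.smult_closed by metis
  qed
qed

lemma act_unfold: "act P x = lift (poly_at G P \<sigma>) \<odot>\<^bsub>M K\<^esub> x"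
  by (simp add: act_def N_simps)

lemma act_in: "x \<in> carrier (M K) \<Longrightarrow> act P x \<in> carrier (M K)"
  unfolding act_unfold by (rule M.smult_closed[OF lift_closed[OF keys_poly_at]])

lemma act_poly_add: "x \<in> carrier (M K) \<Longrightarrow> act (P + Q) x = act P x \<oplus>\<^bsub>M K\<^esub> act Q x"
  unfolding act_unfold poly_at_add frag_extend_add
  by (rule smult_add[OF lift_closed[OF keys_poly_at] lift_closed[OF keys_poly_at]])

lemma act_shift:
  assumes "x \<in> carrier (M K)" shows "act (pCons 0 P) x = frag_of (lift_aut K \<sigma>) \<odot>\<^bsub>M K\<^esub> act P x"
proof -
  have "poly_at G (pCons 0 P) \<sigma> = (\<Sum>i\<le>Suc (degree P). frag_cmul (coeff (pCons 0 P) i) (frag_of (\<sigma> [^]\<^bsub>G\<^esub> i)))"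
    by (rule poly_at_extend_range) (simp add: degree_pCons_le)
  also have "\<dots> = (\<Sum>i\<le>degree P. frag_cmul (coeff P i) (frag_of (\<sigma> \<otimes>\<^bsub>G\<^esub> \<sigma> [^]\<^bsub>G\<^esub> i)))"
    unfolding sum.atMost_Suc_shift using G.nat_pow_Suc2[OF \<sigma>] by simp
  also have "\<dots> = frag_extend (\<lambda>\<tau>. frag_of (\<sigma> \<otimes>\<^bsub>G\<^esub> \<tau>)) (poly_at G P \<sigma>)"
    by (simp add: poly_at_def frag_extend_sum frag_extend_cmul comp_def)
  finally show ?thesis unfolding act_unfold using lift_shift[OF keys_poly_at assms] by simp
qed

lemma act_one: assumes "x \<in> carrier (M K)" shows "act 1 x = x"
proof -
  interpret GG: group GG by (rule group_GG)
  have "poly_at G 1 \<sigma> = frag_of \<one>\<^bsub>G\<^esub>" using poly_at_monom[of 0] by simp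
  then have "act 1 x = frag_of (lift_aut K \<one>\<^bsub>G\<^esub>) \<odot>\<^bsub>M K\<^esub> x" by (simp add: act_unfold)
  also have "\<dots> = frag_of \<one>\<^bsub>GG\<^esub> \<odot>\<^bsub>M K\<^esub> x"
    by (rule smult_frag_of_cong[OF lift_aut(1)[OF G.one_closed] GG.one_closed _ assms])
      (use lift_aut_apply[OF G.one_closed] Gal_one_apply[OF subfield_K subfield_Rats[OF subfield_K]] GG_one_apply K_Qab in auto)
  finally show ?thesis using M.smult_one[OF assms] by (simp add: group_ring_simps)
qed

lemma act_smult:
  assumes "x \<in> carrier (M K)" shows "act (smult a P) x = act [:a:] (act P x)"
proof -
  note cl = act_in[OF assms] act_in[OF act_in[OF assms]]
  show ?thesis
  proof (induction a rule: int_induct[of _ 0])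
    case base
    have "act 0 y = \<zero>\<^bsub>M K\<^esub>" if "y \<in> carrier (M K)" for y
      using act_poly_add[OF that, of 0 0] act_in[OF that, of 0] by (simp add: M.add.r_cancel_one')
    then show ?case using assms cl by simp
  next
    case (step1 i)
    have "[:i + 1:] = [:i:] + 1" by (simp add: one_pCons)
    then have "act [:i + 1:] (act P x) = act [:i:] (act P x) \<oplus>\<^bsub>M K\<^esub> act P x"
      using act_poly_add[OF cl(1)] act_one[OF cl(1)] by metis
    then show ?case using step1 act_poly_add[OF assms, of "smult i P" P] by (simp add: smult_add_left)
  next
    case (step2 i)
    have "[:i:] = [:i - 1:] + 1" by (simp add: one_pCons)
    then have e1: "act [:i:] (act P x) = act [:i - 1:] (act P x) \<oplus>\<^bsub>M K\<^esub> act P x"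
      using act_poly_add[OF cl(1)] act_one[OF cl(1)] by metis
    have "smult i P = smult (i - 1) P + P" by (simp add: smult_diff_left)
    then have e2: "act (smult i P) x = act (smult (i - 1) P) x \<oplus>\<^bsub>M K\<^esub> act P x"
      using act_poly_add[OF assms] by metis
    have "act (smult (i - 1) P) x \<oplus>\<^bsub>M K\<^esub> act P x = act [:i - 1:] (act P x) \<oplus>\<^bsub>M K\<^esub> act P x"
      using e1 e2 step2(2) by simp
    then show ?case using M.add.r_cancel cl by metis
  qed
qed

lemma act_poly_mult:
  assumes "x \<in> carrier (M K)" shows "act (P * Q) x = act P (act Q x)"
proof (induction P)
  case 0
  have "act 0 y = \<zero>\<^bsub>M K\<^esub>" if "y \<in> carrier (M K)" for y
    using act_poly_add[OF that, of 0 0] act_in[OF that, of 0] by (simp add: M.add.r_cancel_one')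
  then show ?case using assms act_in[OF assms] by simp
next
  case (pCons a P)
  have "pCons a P * Q = smult a Q + pCons 0 (P * Q)" by simp
  then have "act (pCons a P * Q) x = act [:a:] (act Q x) \<oplus>\<^bsub>M K\<^esub> frag_of (lift_aut K \<sigma>) \<odot>\<^bsub>M K\<^esub> act P (act Q x)"
    using act_poly_add[OF assms, of "smult a Q" "pCons 0 (P * Q)"] act_smult[OF assms] act_shift[OF assms] pCons(2) by simp
  moreover have "pCons a P = [:a:] + pCons 0 P" by simp
  then have "act (pCons a P) (act Q x) = act [:a:] (act Q x) \<oplus>\<^bsub>M K\<^esub> frag_of (lift_aut K \<sigma>) \<odot>\<^bsub>M K\<^esub> act P (act Q x)"
    using act_poly_add[OF act_in[OF assms], of "[:a:]" "pCons 0 P"] act_shift[OF act_in[OF assms]] by simp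
  ultimately show ?case by simp
qed

lemma act_X_pow_minus_1: assumes "x \<in> carrier (M K)" shows "act (X_pow_minus_1 g) x = \<zero>\<^bsub>M K\<^esub>"
proof -
  have "\<sigma> [^]\<^bsub>G\<^esub> g = \<sigma> [^]\<^bsub>G\<^esub> (0::nat)" using G.pow_ord_eq_1[OF \<sigma>] ord_\<sigma> by simp
  then have "act (monom 1 g) x = act (monom 1 0) x" by (simp only: act_unfold poly_at_monom)
  then have "act (monom 1 g) x = x" using act_one[OF assms] by simp
  moreover have "monom 1 g = X_pow_minus_1 g + (1 :: int poly)" by (simp add: X_pow_minus_1_def)
  ultimately have "act (X_pow_minus_1 g) x \<oplus>\<^bsub>M K\<^esub> x = x"
    using act_poly_add[OF assms, of "X_pow_minus_1 g" 1] act_one[OF assms] by simp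
  then show ?thesis using act_in[OF assms, of "X_pow_minus_1 g"] assms by (simp add: M.add.r_cancel_one)
qed

lemma int_poly_action_A: "int_poly_action A act"
  by (intro int_poly_action.intro int_poly_action_axioms.intro comm_group_A)
    (simp_all add: N_simps act_in act_poly_add act_poly_mult, simp add: act_unfold M.smult_r_distr lift_closed[OF keys_poly_at])

text \<open>The equality is \<open>cyclotomic_kernel_eq_norm_kernel\<close> for the action on \<open>M K\<close>, and the bijection follows from the
same lemma for the action on the tensor product, together with \<open>tensor_kernel_torsion_free\<close>. The hypotheses on
\<open>S\<close> hold for the set of all proper subfields and for that of the subfields of prime codegree alike.\<close>

lemma norm_kernels:
  assumes p: "prime p"
    and S: "\<And>k. k \<in> S \<Longrightarrow> subfield k CC \<and> k \<subset> K"
      "\<And>l. prime l \<Longrightarrow> l dvd g \<Longrightarrow> \<exists>k\<in>S. card (carrier (Gal K k)) = l"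
  defines "C \<equiv> {x \<in> carrier N. act (cyclotomic g) x = \<zero>\<^bsub>N\<^esub>}" and "Z \<equiv> add_monoid (padic_int p)"
  shows "C = norm_kernel N K S"
    and "bij_betw (tensor_map A Z (\<lambda>x. x)) (carrier (tensor (A\<lparr>carrier := C\<rparr>) Z)) (norm_kernel (tensor_Zp p N) K S)"
proof -
  interpret a: int_poly_action A act by (rule int_poly_action_A)
  have Z: "comm_group Z" "torsion_free Z"
    unfolding Z_def by (rule comm_group_padic_int[OF prime_gt_0_nat[OF p]], rule torsion_free_padic_int[OF p])
  interpret t: int_poly_action "tensor A Z" "\<lambda>P. tensor_map A Z (act P)"
    by (rule int_poly_action_tensor[OF int_poly_action_A Z(1)])
  interpret tensor_factors A Z using comm_group_A Z by (simp add: tensor_factors_def)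
  define D where "D = (\<lambda>k. card (carrier (Gal K k))) ` S"
  have D: "\<And>m. m \<in> D \<Longrightarrow> m dvd g \<and> 1 < m" "\<And>l. prime l \<Longrightarrow> l dvd g \<Longrightarrow> l \<in> D"
  proof -
    show "m dvd g \<and> 1 < m" if "m \<in> D" for m using that Gal_proper S(1) unfolding D_def by blast
    show "l \<in> D" if "prime l" "l dvd g" for l using S(2)[OF that] unfolding D_def by blast
  qed
  have norm: "alg_norm K k = poly_at G (geometric_norm g (card (carrier (Gal K k)))) \<sigma>" if "k \<in> S" for k
    using alg_norm_eq_poly_at[of k] S(1)[OF that] by blast
  have X: "act (X_pow_minus_1 g) x = \<one>\<^bsub>A\<^esub>" if "x \<in> carrier A" for x
    using act_X_pow_minus_1[of x] that by (simp add: N_simps)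
  have XT: "tensor_map A Z (act (X_pow_minus_1 g)) t = \<one>\<^bsub>tensor A Z\<^esub>" if "t \<in> carrier (tensor A Z)" for t
    using that
  proof (induction rule: tensor_induct)
    case (pure a b)
    have "act P \<in> hom A A" for P by (rule homI) (rule a.act_closed a.act_hom; assumption)+
    then have "tensor_map A Z (act (X_pow_minus_1 g)) (pure_tensor A Z a b) = pure_tensor A Z \<one>\<^bsub>A\<^esub> b"
      using tensor_map_pure[OF comm_group_A comm_group_A Z(1) _ pure] X[OF pure(1)] by simp
    moreover have "pure_tensor A Z \<one>\<^bsub>A\<^esub> b = pure_tensor A Z \<one>\<^bsub>A\<^esub> b \<otimes>\<^bsub>tensor A Z\<^esub> pure_tensor A Z \<one>\<^bsub>A\<^esub> b"
      using bilinear_pure_tensor pure(2) a.one_closed a.l_one[OF a.one_closed] unfolding bilinear_on_def by metis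
    ultimately show ?case using pure_tensor_closed[OF a.one_closed pure(2)] by (metis t.l_cancel_one')
  next
    case (diff s t)
    have "tensor_map A Z (act (X_pow_minus_1 g)) (inv\<^bsub>tensor A Z\<^esub> t) = \<one>\<^bsub>tensor A Z\<^esub>"
      using t.act_hom[OF diff(2) t.inv_closed[OF diff(2)], of "X_pow_minus_1 g"] diff(2,4) t.act_closed[OF t.inv_closed[OF diff(2)]]
        t.act_one_elem by simp
    then show ?case using t.act_hom[OF diff(1) t.inv_closed[OF diff(2)]] diff(3) by simp
  qed
  have C1: "C = {x \<in> carrier A. act (cyclotomic g) x = \<one>\<^bsub>A\<^esub>}" by (simp add: C_def)
  show "C = norm_kernel N K S"
    by (rule trans[OF trans[OF C1 a.cyclotomic_kernel_eq_norm_kernel[OF g_pos X D]]])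
      (auto simp: norm_kernel_def D_def act_def norm)
  have C2: "C = kernel A A (act (cyclotomic g))" unfolding C1 by (simp add: kernel_def)
  have "norm_kernel (tensor_Zp p N) K S = {t \<in> carrier (tensor A Z). \<forall>m\<in>D. tensor_map A Z (act (geometric_norm g m)) t = \<one>\<^bsub>tensor A Z\<^esub>}"
    by (auto simp: norm_kernel_def tensor_Zp_def Let_def D_def norm Z_def act_def[abs_def])
  also have "\<dots> = {t \<in> carrier (tensor A Z). tensor_map A Z (act (cyclotomic g)) t = \<one>\<^bsub>tensor A Z\<^esub>}"
    by (rule t.cyclotomic_kernel_eq_norm_kernel[OF g_pos XT D, symmetric])
  finally have nk: "norm_kernel (tensor_Zp p N) K S = \<dots>" .
  have "act (cyclotomic g) \<in> hom A A" by (rule homI) (rule a.act_closed a.act_hom; assumption)+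
  then show "bij_betw (tensor_map A Z (\<lambda>x. x)) (carrier (tensor (A\<lparr>carrier := C\<rparr>) Z)) (norm_kernel (tensor_Zp p N) K S)"
    using tensor_kernel_torsion_free[OF comm_group_A Z] by (simp only: nk C2)
qed

end

theorem theorem3p7:
  fixes M :: "complex set \<Rightarrow> ((complex \<Rightarrow> complex) \<Rightarrow>\<^sub>0 int, 'm) module"
    and p :: nat
    and \<chi> \<psi> :: "(complex \<Rightarrow> complex) \<Rightarrow> complex"
    and \<sigma> :: "complex \<Rightarrow> complex"
  assumes "GG_family M"
    and "prime p"
    and "irreducible_rational_char \<chi>"
    and "constituent \<psi> \<chi>"
    and "\<sigma> \<in> carrier (Gal (char_field \<psi>) \<rat>)"
    and "generate (Gal (char_field \<psi>) \<rat>) {\<sigma>} = carrier (Gal (char_field \<psi>) \<rat>)"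
  shows "let K = char_field \<psi>;
             N = descend M K;
             A = (add_monoid N)\<lparr>carrier := M_alg M \<psi> \<sigma>\<rparr>;
             Z = add_monoid (padic_int p);
             \<iota> = tensor_map (add_monoid N) Z (\<lambda>x. x)
         in M_alg M \<psi> \<sigma> = norm_kernel N K (proper_subfields K)
          \<and> bij_betw \<iota> (carrier (tensor A Z)) (norm_kernel (tensor_Zp p N) K (proper_subfields K))
          \<and> M_alg M \<psi> \<sigma> = norm_kernel N K (prime_codegree_subfields K)
          \<and> bij_betw \<iota> (carrier (tensor A Z)) (norm_kernel (tensor_Zp p N) K (prime_codegree_subfields K))"
proof -
  have \<psi>: "finite_order_char \<psi>" using assms(4) by (simp add: constituent_def)
  interpret descended_module "char_field \<psi>" \<sigma> M
    by (intro descended_module.intro cyclic_abelian_field.intro descended_module_axioms.intro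
        subfield_char_field[OF \<psi>] char_field_subset_Qab[OF \<psi>] char_field_galois(1)[OF \<psi>] char_field_in_KK[OF \<psi>] assms)
  let ?K = "char_field \<psi>"
  have C: "M_alg M \<psi> \<sigma> = {x \<in> carrier N. act (cyclotomic g) x = \<zero>\<^bsub>N\<^esub>}"
    by (simp add: M_alg_def Let_def act_def char_order_eq[OF \<psi> \<sigma> gen])
  have cod: "subfield_of_codegree ?K l \<in> proper_subfields ?K" "subfield_of_codegree ?K l \<in> prime_codegree_subfields ?K"
    if "prime l" "l dvd g" for l
    using subfield_of_codegree_prime[OF that] that degree_K by (auto simp: proper_subfields_def prime_codegree_subfields_def)
  have proper: "subfield k CC \<and> k \<subset> ?K" if "k \<in> proper_subfields ?K" for k
    using that by (simp add: proper_subfields_def)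
  have codegree: "subfield k CC \<and> k \<subset> ?K" if k: "k \<in> prime_codegree_subfields ?K" for k
  proof -
    obtain l where "k = subfield_of_codegree ?K l" "prime l" "l dvd g"
      using k unfolding prime_codegree_subfields_def degree_K by blast
    then show ?thesis using subfield_of_codegree_prime(1,2)[of l] by blast
  qed
  have ex1: "\<exists>k\<in>proper_subfields ?K. card (carrier (Gal ?K k)) = l" if "prime l" "l dvd g" for l
    using cod(1)[OF that] subfield_of_codegree_prime(3)[OF that] by blast
  have ex2: "\<exists>k\<in>prime_codegree_subfields ?K. card (carrier (Gal ?K k)) = l" if "prime l" "l dvd g" for l
    using cod(2)[OF that] subfield_of_codegree_prime(3)[OF that] by blast
  show ?thesis unfolding Let_def C
    using norm_kernels[OF assms(2) proper ex1] norm_kernels[OF assms(2) codegree ex2] by blast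
qed

end
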